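(* Let $n\geq 2$ be an integer and let $X(\mathtt{BP}_n)$ be the multipath complex of the bidirectional polygonal digraph $\mathtt{BP}_n$ on $n+1$ vertices. Then \[ \mathrm{H}_i(X(\mathtt{BP}_n)) = \begin{cases} \mathbb{Z} & \text{if } i=0,\\ \mathbb{Z}^2 & \text{if } i=n-1,\\ \mathbb{Z} & \text{if } i=\lfloor \frac{n-1}{2}\rfloor \text{ and } n\equiv 1,2 \mod 4,\\ \mathbb{Z}^3 & \text{if } i=\lfloor \frac{n-1}{2}\rfloor \text{ and } n\equiv 3 \mod 4,\\ \mathbb{Z} & \text{if } i=\lfloor \frac{n-1}{2}\rfloor+1 \text{ and } n\equiv 0 \mod 4, \end{cases} \] and $\mathrm{H}_i(X(\mathtt{BP}_n))=0$ otherwise. In particular, with $\nu_n=\lfloor\frac{n-1}{2}\rfloor-1$, the complex $X(\mathtt{BP}_n)$ is not $(\nu_n+1)$-connected for $n\equiv 1,2,3 \mod 4$.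
   Context: A digraph has at most one edge $(v,w)$ from $v$ to $w$ for each ordered pair of vertices. For an edge $e=(v,w)$, $s(e)=v$ is its source and $t(e)=w$ its target. A simple path in a digraph is a sequence of edges $e_1,\dots,e_k$ with $s(e_{i+1})=t(e_i)$ for all $i<k$, such that $s(e_i)=s(e_j)$ or $t(e_i)=t(e_j)$ implies $i=j$, and which is not a cycle, i.e. $s(e_1)\neq t(e_k)$. A multipath of a digraph $G$ is a spanning subgraph each of whose connected components is either a single vertex or a simple path. The multipath complex $X(G)$ is the (abstract) simplicial complex whose simplices are the nonempty edge sets of multipaths of $G$ (the empty simplex corresponds to the multipath with no edges); topological statements refer to its geometric realization, and $\mathrm{H}_*$ denotes (unreduced) homology with integer coefficients. The bidirectional polygonal digraph $\mathtt{BP}_n$ has $n+1$ vertices $0,1,\dots,n$ and the $2n+2$ edges $(i,i+1)$ and $(i+1,i)$, with $i$ taken modulo $n+1$. Convention: a space is $k$-connected if it is nonempty and its homotopy groups $\pi_j$ vanish for all $0\le j\leq k$.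
   Formalization: For n=2 the cases i=0 and i=⌊(n-1)/2⌋ coincide and the list as written gives H_0=Z, which is false since X(BP_2) is two disjoint circles; the formal statement adds coinciding cases, giving H_0=Z^2 there, and agrees with the list for all n≥3. *)

theory Defs
  imports "HOL-Homology.Homology" "Graph_Theory.Digraph_Component"
begin

text \<open>
  Digraphs have at most one edge for each ordered pair of vertices, so they are rendered
  by \<^typ>\<open>'a pair_pre_digraph\<close>: an edge is a pair, with source \<^const>\<open>fst\<close> and target \<^const>\<open>snd\<close>.
\<close>

definition simple_dipath :: "('a \<times> 'a) list \<Rightarrow> bool" where
  "simple_dipath es \<longleftrightarrow>
     es \<noteq> [] \<and>
     (\<forall>i. Suc i < length es \<longrightarrow> fst (es ! Suc i) = snd (es ! i)) \<and>
     (\<forall>i < length es. \<forall>j < length es.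
        fst (es ! i) = fst (es ! j) \<or> snd (es ! i) = snd (es ! j) \<longrightarrow> i = j) \<and>
     fst (hd es) \<noteq> snd (last es)"

definition is_single_vertex :: "('a, 'b) pre_digraph \<Rightarrow> bool" where
  "is_single_vertex C \<longleftrightarrow> (\<exists>v. verts C = {v}) \<and> arcs C = {}"

definition is_simple_dipath :: "('a, 'a \<times> 'a) pre_digraph \<Rightarrow> bool" where
  "is_simple_dipath C \<longleftrightarrow>
     (\<exists>es. simple_dipath es \<and> arcs C = set es \<and> verts C = fst ` set es \<union> snd ` set es)"

text \<open>
  Connected components are taken in the underlying undirected graph. The constant
  \<^const>\<open>Digraph_Component.connected\<close> expresses exactly this weak connectedness.
\<close>

definition component :: "('a, 'b) pre_digraph \<Rightarrow> ('a, 'b) pre_digraph \<Rightarrow> bool" where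
  "component C G \<longleftrightarrow> pre_digraph.max_subgraph G Digraph_Component.connected C"

definition multipath :: "'a pair_pre_digraph \<Rightarrow> 'a pair_pre_digraph \<Rightarrow> bool" where
  "multipath H G \<longleftrightarrow>
     spanning (with_proj H) (with_proj G) \<and>
     (\<forall>C. component C (with_proj H) \<longrightarrow> is_single_vertex C \<or> is_simple_dipath C)"

text \<open>
  An abstract simplicial complex is given by its set of nonempty simplices; the vertices
  of the multipath complex are edges of the digraph.
\<close>

definition multipath_complex :: "'a pair_pre_digraph \<Rightarrow> ('a \<times> 'a) set set" where
  "multipath_complex G = {parcs H |H. multipath H G \<and> parcs H \<noteq> {}}"

definition BP :: "nat \<Rightarrow> nat pair_pre_digraph" where
  "BP n = \<lparr> pverts = {0..n},
            parcs = (\<Union>i \<in> {0..n}. {(i, (i + 1) mod (n + 1)), ((i + 1) mod (n + 1), i)}) \<rparr>"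

text \<open>
  Points of the realization are barycentric coordinate functions whose support is a simplex.
  They carry the topology of pointwise convergence, which for a finite complex (the
  multipath complex of a finite digraph) is the usual coherent topology. A sum over an infinite
  support is 0, so infinite sets contribute no points.
\<close>

definition geometric_realization :: "'v set set \<Rightarrow> ('v \<Rightarrow> real) topology" where
  "geometric_realization K =
     subtopology (powertop_real UNIV)
       {x. (\<forall>v. 0 \<le> x v) \<and> {v. x v \<noteq> 0} \<in> K \<and> (\<Sum>v | x v \<noteq> 0. x v) = 1}"

definition Z_pow :: "nat \<Rightarrow> (nat \<Rightarrow> int) monoid" where
  "Z_pow r = product_group {..<r} (\<lambda>_. integer_group)"

definition cube :: "nat \<Rightarrow> (nat \<Rightarrow> real) topology" where
  "cube j = subtopology (powertop_real {..<j}) ({..<j} \<rightarrow>\<^sub>E {0..1})"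

definition cube_boundary :: "nat \<Rightarrow> (nat \<Rightarrow> real) set" where
  "cube_boundary j = {x \<in> topspace (cube j). \<exists>i<j. x i = 0 \<or> x i = 1}"

text \<open>
  The underlying set of \<open>\<pi>\<^sub>j(X, x0)\<close>: homotopy classes, relative to the boundary, of maps of pairs
  from the \<open>j\<close>-cube and its boundary to \<open>(X, x0)\<close>. For \<open>j = 0\<close> the cube is a point with
  empty boundary, and this is the set of path components of \<open>X\<close>.
\<close>

definition homotopy_group_set :: "nat \<Rightarrow> 'a topology \<Rightarrow> 'a \<Rightarrow> ((nat \<Rightarrow> real) \<Rightarrow> 'a) set set" where
  "homotopy_group_set j X x0 =
     {f. continuous_map (cube j) X f \<and> (\<forall>x \<in> cube_boundary j. f x = x0)} //
     {(f, g). homotopic_with (\<lambda>h. \<forall>x \<in> cube_boundary j. h x = x0) (cube j) X f g}"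

definition k_connected :: "int \<Rightarrow> 'a topology \<Rightarrow> bool" where
  "k_connected k X \<longleftrightarrow>
     topspace X \<noteq> {} \<and>
     (\<forall>x0 \<in> topspace X. \<forall>j. int j \<le> k \<longrightarrow> is_singleton (homotopy_group_set j X x0))"

end

theory Submission
  imports Defs
begin

text \<open>
  A set of edges of the bidirectional polygon on \<open>m = n + 1\<close> vertices is a multipath iff it is an independent
  set of the conflict graph (common source, common target, or opposite edges) and is not one of the two
  full directed cycles. Hence the complex is the independence complex \<open>I\<close> of the conflict graph with two
  facets of dimension \<open>n\<close> removed, which adds two classes in degree \<open>n - 1\<close> because \<open>I\<close> has no homology in
  degree \<open>n\<close>.

  The homology of \<open>I\<close> comes from one long exact sequence. If a face \<open>s\<close> is deleted from \<open>K\<close>, then excision and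
  radial projection from the barycentre of \<open>s\<close> identify the relative homology with the reduced
  homology, shifted by one, of the complex of those faces that do not contain \<open>s\<close> but span a face with \<open>s\<close>.
  Vertices whose neighbourhood contains that of another vertex can therefore be dropped,
  and an isolated edge of the conflict graph acts as a suspension; the conflict graph minus two
  opposite vertices, and the links of these vertices, dissolve in this way with period 4.

  For the last claim, the edges at odd positions span a cross-polytope sphere of dimension
  \<open>d = \<lfloor>(n - 1) / 2\<rfloor>\<close> that is a retract of a subcomplex whose homology in degree \<open>d\<close> injects into that of \<open>I\<close>.
  In a \<open>d\<close>-connected space this sphere would be null-homotopic.
\<close>

section \<open>Free abelian groups of finite rank\<close>

text \<open>No homomorphism of homology groups is computed to get the ranks. All groups are free of
  finite rank, and every deletion is chosen so that one map of its long exact sequence has, in each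
  degree, a trivial source or a trivial target. The sequence then falls apart into short exact
  sequences with free quotient, and ranks just add up. The obstacle is a collision of degrees: for
  \<open>n\<close> congruent to 0 modulo 4 (\<open>m\<close> congruent to 1) the link of
  \<open>(True, 0)\<close> and the block obtained by deleting both vertices at position 0 have their
  classes in the same degree. That collision also explains the residues in the last claim. For
  \<open>n\<close> congruent to 0 the group of \<open>I\<close> in degree \<open>d\<close> is zero,
  so the sphere on the odd positions is homologically trivial there; for the other residues the
  links have nothing in degree \<open>d\<close> that could kill its class. Homotopy is linked to
  homology without the Hurewicz theorem: to refute connectedness it suffices to exhibit one explicit
  sphere with nonzero class.\<close>

lemma free_Abelian_group_DirProd:
  assumes "S \<inter> T = {}"
  shows "free_Abelian_group S \<times>\<times> free_Abelian_group T \<cong> free_Abelian_group (S \<union> T)"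
proof -
  let ?h = "\<lambda>(x, y). x + y"
  have "?h \<in> iso (free_Abelian_group S \<times>\<times> free_Abelian_group T) (free_Abelian_group (S \<union> T))"
  proof (rule isoI)
    show hom: "?h \<in> hom (free_Abelian_group S \<times>\<times> free_Abelian_group T) (free_Abelian_group (S \<union> T))"
    proof (rule homI)
      fix p assume "p \<in> carrier (free_Abelian_group S \<times>\<times> free_Abelian_group T)"
      then show "?h p \<in> carrier (free_Abelian_group (S \<union> T))"
        using keys_add[of "fst p" "snd p"] by (cases p) (simp, blast)
    qed auto
    interpret group_hom "free_Abelian_group S \<times>\<times> free_Abelian_group T" "free_Abelian_group (S \<union> T)" ?h
      using hom by (simp add: group_hom_def group_hom_axioms_def DirProd_group)
    have decomp: "\<exists>x y. Poly_Mapping.keys x \<subseteq> S \<and> Poly_Mapping.keys y \<subseteq> T \<and> z = x + y"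
      if "Poly_Mapping.keys z \<subseteq> S \<union> T" for z :: "'a \<Rightarrow>\<^sub>0 int"
      using that
    proof (rule free_Abelian_group_induct)
      show "\<exists>x y. Poly_Mapping.keys x \<subseteq> S \<and> Poly_Mapping.keys y \<subseteq> T \<and> 0 = x + y"
        by (intro exI[of _ 0]) auto
    next
      fix u v :: "'a \<Rightarrow>\<^sub>0 int"
      assume u: "\<exists>x y. Poly_Mapping.keys x \<subseteq> S \<and> Poly_Mapping.keys y \<subseteq> T \<and> u = x + y"
        and v: "\<exists>x y. Poly_Mapping.keys x \<subseteq> S \<and> Poly_Mapping.keys y \<subseteq> T \<and> v = x + y"
      obtain x y where "Poly_Mapping.keys x \<subseteq> S" "Poly_Mapping.keys y \<subseteq> T" "u = x + y"
        using u by auto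
      moreover obtain x' y' where "Poly_Mapping.keys x' \<subseteq> S" "Poly_Mapping.keys y' \<subseteq> T" "v = x' + y'"
        using v by auto
      moreover from calculation have "Poly_Mapping.keys (x - x') \<subseteq> S" "Poly_Mapping.keys (y - y') \<subseteq> T"
        using keys_diff[of x x'] keys_diff[of y y'] by auto
      ultimately show "\<exists>x y. Poly_Mapping.keys x \<subseteq> S \<and> Poly_Mapping.keys y \<subseteq> T \<and> u - v = x + y"
        by (intro exI[of _ "x - x'"] exI[of _ "y - y'"]) simp
    next
      fix a
      assume "a \<in> S \<union> T"
      then consider "a \<in> S" | "a \<in> T" by auto
      then show "\<exists>x y. Poly_Mapping.keys x \<subseteq> S \<and> Poly_Mapping.keys y \<subseteq> T \<and> frag_of a = x + y"
      proof cases
        case 1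
        then show ?thesis by (intro exI[of _ "frag_of a"] exI[of _ 0]) auto
      next
        case 2
        then show ?thesis by (intro exI[of _ 0] exI[of _ "frag_of a"]) auto
      qed
    qed
    have surj: "?h ` carrier (free_Abelian_group S \<times>\<times> free_Abelian_group T) = carrier (free_Abelian_group (S \<union> T))"
    proof (intro equalityI subsetI)
      fix z assume "z \<in> carrier (free_Abelian_group (S \<union> T))"
      then obtain x y where "Poly_Mapping.keys x \<subseteq> S" "Poly_Mapping.keys y \<subseteq> T" "z = x + y"
        using decomp[of z] by auto
      then show "z \<in> ?h ` carrier (free_Abelian_group S \<times>\<times> free_Abelian_group T)"
        by (intro image_eqI[of _ _ "(x, y)"]) auto
    qed (use hom_closed in \<open>auto simp only:\<close>)
    have "p = \<one>\<^bsub>free_Abelian_group S \<times>\<times> free_Abelian_group T\<^esub>"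
      if "p \<in> carrier (free_Abelian_group S \<times>\<times> free_Abelian_group T)"
        "?h p = \<one>\<^bsub>free_Abelian_group (S \<union> T)\<^esub>" for p
    proof -
      obtain x y where "p = (x, y)" by (cases p)
      with that have p: "p = (x, y)" "Poly_Mapping.keys x \<subseteq> S" "Poly_Mapping.keys y \<subseteq> T" "x + y = 0"
        by auto
      then have "x = - y" by (simp add: eq_neg_iff_add_eq_0)
      then have "Poly_Mapping.keys y \<subseteq> S \<inter> T" using p by simp
      then have "y = 0" using assms by simp
      then show ?thesis using p by simp
    qed
    then have "inj_on ?h (carrier (free_Abelian_group S \<times>\<times> free_Abelian_group T))"
      using inj_on_one_iff by auto
    with surj show "bij_betw ?h (carrier (free_Abelian_group S \<times>\<times> free_Abelian_group T)) (carrier (free_Abelian_group (S \<union> T)))"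
      by (simp add: bij_betw_def)
  qed
  then show ?thesis by (rule is_isoI)
qed

lemma free_Abelian_group_card_cong:
  assumes "finite S" "finite T" "card S = card T"
  shows "free_Abelian_group S \<cong> free_Abelian_group T"
  using assms by (simp add: isomorphic_free_Abelian_groups eqpoll_iff_card)

abbreviation free_rank :: "nat \<Rightarrow> (nat \<Rightarrow>\<^sub>0 int) monoid" where
  "free_rank r \<equiv> free_Abelian_group {..<r}"

lemma free_rank_trivial_iff: "trivial_group (free_rank r) \<longleftrightarrow> r = 0"
proof
  assume "trivial_group (free_rank r)"
  then have c: "carrier (free_rank r) = {0}" by (simp add: trivial_group_def)
  show "r = 0"
  proof (rule ccontr)
    assume "r \<noteq> 0"
    then have "frag_of 0 \<in> carrier (free_rank r)" by simp
    then show False using c by (simp only:) simp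
  qed
qed (use group_free_Abelian_group[of "{..<r}"] in \<open>auto simp: trivial_group_def free_Abelian_group_def\<close>)

lemma isomorphic_trivial_groups:
  assumes "group G" "group H" "trivial_group G" "trivial_group H"
  shows "G \<cong> H"
proof (rule is_isoI[of "\<lambda>_. \<one>\<^bsub>H\<^esub>"])
  interpret G: group G by fact
  interpret H: group H by fact
  have "carrier G = {\<one>\<^bsub>G\<^esub>}" "carrier H = {\<one>\<^bsub>H\<^esub>}"
    using assms by (auto simp: trivial_group_def)
  then show "(\<lambda>_. \<one>\<^bsub>H\<^esub>) \<in> iso G H"
    by (auto simp: iso_def hom_def bij_betw_def)
qed

lemma iso_free_rank_0:
  assumes "group G"
  shows "G \<cong> free_rank 0 \<longleftrightarrow> trivial_group G"
proof
  assume "G \<cong> free_rank 0"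
  then show "trivial_group G"
    using assms free_rank_trivial_iff[of 0] isomorphic_group_triviality[of G "free_rank 0"] by simp
next
  assume "trivial_group G"
  then show "G \<cong> free_rank 0"
    using assms free_rank_trivial_iff[of 0] by (intro isomorphic_trivial_groups) auto
qed

text \<open>For finitely many factors the direct sum and the direct product coincide, and a direct
  sum of copies of the integers is free abelian.\<close>

lemma free_rank_Z_pow: "free_rank r \<cong> Z_pow r"
proof -
  have "carrier (sum_group {..<r} (\<lambda>i. integer_group)) = carrier (product_group {..<r} (\<lambda>i. integer_group))"
    by (auto simp: carrier_sum_group)
  then have "subgroup_generated (product_group {..<r} (\<lambda>i. integer_group))
      (carrier (sum_group {..<r} (\<lambda>i. integer_group))) = product_group {..<r} (\<lambda>i. integer_group)"
    by (metis group.subgroup_generated_group_carrier group_integer_group product_group)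
  moreover have "sum_group {..<r} (\<lambda>i. integer_group) =
      subgroup_generated (product_group {..<r} (\<lambda>i. integer_group))
      (carrier (sum_group {..<r} (\<lambda>i. integer_group)))"
    by (simp add: carrier_sum_group) (simp add: sum_group_def)
  ultimately have "sum_group {..<r} (\<lambda>i. integer_group) = Z_pow r"
    unfolding Z_pow_def by simp
  then show ?thesis
    using group.iso_sym[OF _ isomorphic_sum_integer_group, of "{..<r}"]
      sum_group[of "{..<r}" "\<lambda>i. integer_group"] by simp
qed

text \<open>A free quotient splits off.\<close>
lemma short_exact_free_rank:
  fixes A :: "('a, 'x) monoid_scheme" and B :: "('b, 'y) monoid_scheme" and C :: "('c, 'z) monoid_scheme"
  assumes "group A" "comm_group B" "group C"
    and f: "f \<in> hom A B" "inj_on f (carrier A)"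
    and g: "g \<in> hom B C" "g ` carrier B = carrier C"
    and ker: "kernel B C g = f ` carrier A"
    and A: "A \<cong> free_rank a" and C: "C \<cong> free_rank c"
  shows "B \<cong> free_rank (a + c)"
proof -
  interpret A: group A by fact
  interpret B: comm_group B by fact
  interpret C: group C by fact
  interpret f: group_hom A B f by (simp add: group_hom_def group_hom_axioms_def f A.is_group B.is_group)
  interpret g: group_hom B C g by (simp add: group_hom_def group_hom_axioms_def g C.is_group B.is_group)
  have "free_rank c \<cong> C" using C by (simp add: C.iso_sym)
  then obtain \<gamma> where \<gamma>: "\<gamma> \<in> iso (free_rank c) C" by (auto simp: is_iso_def)
  have g\<gamma>: "\<gamma> x \<in> g ` carrier B" if "x \<in> carrier (free_rank c)" for x
    using \<gamma> that g(2) by (auto simp: iso_def dest: hom_in_carrier)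
  \<comment> \<open>Lifts of the images of the generators. Freeness extends them to a homomorphism
    \<open>h\<close> with \<open>g (h x) = \<gamma> x\<close>, which is the splitting.\<close>
  define b where "b i = (SOME b. b \<in> carrier B \<and> g b = \<gamma> (frag_of i))" for i
  have b: "b i \<in> carrier B \<and> g (b i) = \<gamma> (frag_of i)" if "i < c" for i
  proof -
    have "\<gamma> (frag_of i) \<in> g ` carrier B" using g\<gamma> that by simp
    then show ?thesis unfolding b_def by (intro someI_ex[of "\<lambda>b. b \<in> carrier B \<and> g b = \<gamma> (frag_of i)"]) auto
  qed
  obtain h where h: "h \<in> hom (free_rank c) B" "\<And>i. i \<in> {..<c} \<Longrightarrow> h (frag_of i) = b i"
    by (rule B.free_Abelian_group_universal[of b "{..<c}"]) (use b in auto)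
  interpret h: group_hom "free_rank c" B h by (simp add: group_hom_def group_hom_axioms_def h B.is_group)
  interpret \<gamma>: group_hom "free_rank c" C \<gamma>
    using \<gamma> by (simp add: group_hom_def group_hom_axioms_def iso_def C.is_group)
  have gh: "g (h x) = \<gamma> x" if "Poly_Mapping.keys x \<subseteq> {..<c}" for x
    using that
  proof (rule free_Abelian_group_induct)
    show "g (h 0) = \<gamma> 0" using h.hom_one \<gamma>.hom_one by simp
  next
    fix x y assume xy: "Poly_Mapping.keys x \<subseteq> {..<c}" "Poly_Mapping.keys y \<subseteq> {..<c}"
      and eq: "g (h x) = \<gamma> x" "g (h y) = \<gamma> y"
    have *: "x - y = x \<otimes>\<^bsub>free_rank c\<^esub> inv\<^bsub>free_rank c\<^esub> y" using xy by simp
    have "x \<in> carrier (free_rank c)" "y \<in> carrier (free_rank c)" using xy by auto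
    then show "g (h (x - y)) = \<gamma> (x - y)" unfolding * using eq
      by (simp del: mult_free_Abelian_group inv_free_Abelian_group carrier_free_Abelian_group_iff)
  next
    fix i assume "i \<in> {..<c}"
    then show "g (h (frag_of i)) = \<gamma> (frag_of i)" using h b by simp
  qed
  let ?k = "\<lambda>(x, y). f x \<otimes>\<^bsub>B\<^esub> h y"
  have "?k \<in> iso (A \<times>\<times> free_rank c) B"
  proof (rule isoI)
    show hom: "?k \<in> hom (A \<times>\<times> free_rank c) B"
    proof (rule homI)
      fix p q assume "p \<in> carrier (A \<times>\<times> free_rank c)" "q \<in> carrier (A \<times>\<times> free_rank c)"
      then obtain x y x' y' where pq: "p = (x, y)" "q = (x', y')" "x \<in> carrier A" "x' \<in> carrier A"
        "y \<in> carrier (free_rank c)" "y' \<in> carrier (free_rank c)"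
        by (auto simp: DirProd_def)
      then show "?k (p \<otimes>\<^bsub>A \<times>\<times> free_rank c\<^esub> q) = ?k p \<otimes>\<^bsub>B\<^esub> ?k q"
        using h.hom_mult[OF pq(5,6)] f.hom_mult[OF pq(3,4)] h.hom_closed[OF pq(5)] h.hom_closed[OF pq(6)]
          f.hom_closed[OF pq(3)] f.hom_closed[OF pq(4)]
        by (simp add: B.m_ac del: carrier_free_Abelian_group_iff)
    qed (auto simp: DirProd_def)
    interpret k: group_hom "A \<times>\<times> free_rank c" B ?k
      using hom by (simp add: group_hom_def group_hom_axioms_def DirProd_group A.is_group B.is_group)
    have gf: "g (f x) = \<one>\<^bsub>C\<^esub>" if "x \<in> carrier A" for x
      using ker that by (auto simp: kernel_def)
    have "z \<in> ?k ` carrier (A \<times>\<times> free_rank c)" if z: "z \<in> carrier B" for z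
    proof -
      have "g z \<in> \<gamma> ` carrier (free_rank c)"
        using \<gamma> z g.hom_closed[OF z] by (auto simp: iso_def bij_betw_def)
      then obtain y where y: "y \<in> carrier (free_rank c)" "\<gamma> y = g z" by auto
      have "z \<otimes>\<^bsub>B\<^esub> inv\<^bsub>B\<^esub> (h y) \<in> kernel B C g"
        using z y gh[of y] h.hom_closed[OF y(1)] by (simp add: kernel_def)
      then obtain x where x: "x \<in> carrier A" "f x = z \<otimes>\<^bsub>B\<^esub> inv\<^bsub>B\<^esub> (h y)"
        using ker by auto
      have "?k (x, y) = z" using x z h.hom_closed[OF y(1)] by (simp add: B.m_assoc)
      then show ?thesis using x y by (intro image_eqI[of _ _ "(x, y)"]) auto
    qed
    then have surj: "?k ` carrier (A \<times>\<times> free_rank c) = carrier B"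
      using k.hom_closed by (intro equalityI subsetI) (auto simp only:)
    have "p = \<one>\<^bsub>A \<times>\<times> free_rank c\<^esub>" if "p \<in> carrier (A \<times>\<times> free_rank c)" "?k p = \<one>\<^bsub>B\<^esub>" for p
    proof -
      obtain x y where "p = (x, y)" by (cases p)
      with that have p: "p = (x, y)" "x \<in> carrier A" "y \<in> carrier (free_rank c)" "f x \<otimes>\<^bsub>B\<^esub> h y = \<one>\<^bsub>B\<^esub>"
        by auto
      have "\<one>\<^bsub>C\<^esub> = g (f x \<otimes>\<^bsub>B\<^esub> h y)" using p by simp
      also have "\<dots> = g (f x) \<otimes>\<^bsub>C\<^esub> g (h y)"
        using h.hom_closed[OF p(3)] f.hom_closed[OF p(2)] by (rule g.hom_mult[rotated])
      also have "\<dots> = \<gamma> y" using p(2,3) gf[of x] gh[of y] \<gamma>.hom_closed[OF p(3)] by simp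
      finally have "y = \<one>\<^bsub>free_rank c\<^esub>"
        using inj_onD[of \<gamma> "carrier (free_rank c)" y "\<one>\<^bsub>free_rank c\<^esub>"] p \<gamma> \<gamma>.hom_one
        by (simp add: iso_def bij_betw_def)
      moreover from this have "f x = \<one>\<^bsub>B\<^esub>" using p h.hom_one by simp
      then have "x = \<one>\<^bsub>A\<^esub>" using inj_onD[OF f(2), of x "\<one>\<^bsub>A\<^esub>"] p by simp
      ultimately show ?thesis using p by simp
    qed
    then have "inj_on ?k (carrier (A \<times>\<times> free_rank c))"
      by (subst k.inj_on_one_iff) (intro allI impI)
    with surj show "bij_betw ?k (carrier (A \<times>\<times> free_rank c)) (carrier B)"
      by (simp add: bij_betw_def)
  qed
  then have "A \<times>\<times> free_rank c \<cong> B" by (rule is_isoI)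
  then have "B \<cong> A \<times>\<times> free_rank c"
    by (simp add: group.iso_sym DirProd_group A.is_group)
  also have "\<dots> \<cong> free_rank a \<times>\<times> free_Abelian_group {a..<a + c}"
    by (intro A.DirProd_iso_trans A free_Abelian_group_card_cong) auto
  also have "\<dots> \<cong> free_Abelian_group ({..<a} \<union> {a..<a + c})"
    by (rule free_Abelian_group_DirProd) auto
  also have "{..<a} \<union> {a..<a + c} = {..<a + c}" by auto
  finally show ?thesis .
qed

section \<open>Geometric realizations and the star of a face\<close>

lemma continuous_on_Min_image:
  fixes f :: "'i \<Rightarrow> 'a::topological_space \<Rightarrow> real"
  assumes "finite I" "I \<noteq> {}" "\<And>i. i \<in> I \<Longrightarrow> continuous_on S (f i)"
  shows "continuous_on S (\<lambda>x. Min ((\<lambda>i. f i x) ` I))"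
  using assms
proof (induction I rule: finite_ne_induct)
  case (insert i I)
  then have "continuous_on S (\<lambda>x. min (f i x) (Min ((\<lambda>i. f i x) ` I)))"
    by (intro continuous_on_min) auto
  then show ?case
    using insert.hyps by simp
qed auto

lemma continuous_on_coordinate: "continuous_on S (\<lambda>x::'i \<Rightarrow> real. x v)"
  by (rule continuous_on_subset[OF continuous_on_product_coordinates]) simp

text \<open>The deformations of realizations below are straight lines, so that only membership of
  the convex combinations in \<open>U\<close> has to be checked. The predicate \<open>P\<close>
  makes room for homotopies of pairs.\<close>

lemma homotopic_with_line:
  fixes f g :: "('i \<Rightarrow> real) \<Rightarrow> 'j \<Rightarrow> real"
  assumes f: "continuous_on S f" and g: "continuous_on S g"
    and line: "\<And>t x. 0 \<le> t \<Longrightarrow> t \<le> 1 \<Longrightarrow> x \<in> S \<Longrightarrow> (\<lambda>v. (1 - t) * f x v + t * g x v) \<in> U"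
    and P: "\<And>t. 0 \<le> t \<Longrightarrow> t \<le> 1 \<Longrightarrow> P (\<lambda>x v. (1 - t) * f x v + t * g x v)"
  shows "homotopic_with P (top_of_set S) (top_of_set U) f g"
proof -
  let ?h = "\<lambda>p v. (1 - fst p) * f (snd p) v + fst p * g (snd p) v"
  have c: "continuous_on ({0..1} \<times> S) (\<lambda>p. k (snd p) v)" if "continuous_on S k"
    for k :: "('i \<Rightarrow> real) \<Rightarrow> 'j \<Rightarrow> real" and v
    using that
    by (intro continuous_on_compose2[OF continuous_on_product_then_coordinatewise[OF that]] continuous_intros) auto
  have "continuous_on ({0..1} \<times> S) ?h"
    by (intro continuous_on_coordinatewise_then_product continuous_intros c f g)
  then have "continuous_map (prod_topology (top_of_set {0..1}) (top_of_set S)) (top_of_set U) ?h"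
    using line by auto
  then show ?thesis
    unfolding homotopic_with_def using P by (intro exI[of _ ?h]) auto
qed

definition simplicial_complex :: "'v set set \<Rightarrow> bool" where
  "simplicial_complex K \<longleftrightarrow> finite (\<Union>K) \<and> {} \<notin> K \<and> (\<forall>s\<in>K. \<forall>t\<subseteq>s. t \<noteq> {} \<longrightarrow> t \<in> K)"

definition realized :: "'v set set \<Rightarrow> ('v \<Rightarrow> real) set" where
  "realized K = {x. (\<forall>v. 0 \<le> x v) \<and> {v. x v \<noteq> 0} \<in> K \<and> (\<Sum>v | x v \<noteq> 0. x v) = 1}"

lemma geometric_realization_eq: "geometric_realization K = top_of_set (realized K)"
  unfolding geometric_realization_def realized_def euclidean_product_topology ..

lemma simplicial_complexD:
  assumes "simplicial_complex K"
  shows "finite (\<Union>K)" "{} \<notin> K" "s \<in> K \<Longrightarrow> t \<subseteq> s \<Longrightarrow> t \<noteq> {} \<Longrightarrow> t \<in> K"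
    "s \<in> K \<Longrightarrow> finite s" "s \<in> K \<Longrightarrow> s \<noteq> {}"
  using assms by (auto simp: simplicial_complex_def intro: finite_subset)

text \<open>Summing over one fixed finite set instead of the varying support makes the weight
  condition linear in \<open>x\<close>.\<close>

lemma realized_iff:
  assumes "finite V" "\<Union>K \<subseteq> V"
  shows "x \<in> realized K \<longleftrightarrow> (\<forall>v. 0 \<le> x v) \<and> {v. x v \<noteq> 0} \<in> K \<and> sum x V = 1"
proof -
  have "sum x V = (\<Sum>v | x v \<noteq> 0. x v)" if "{v. x v \<noteq> 0} \<in> K"
    by (rule sum.mono_neutral_right) (use assms that in auto)
  then show ?thesis by (auto simp: realized_def)
qed

text \<open>Total weight 1 makes the support of \<open>y\<close> nonempty, hence a face of the
  simplex supporting \<open>x\<close>. This is the membership test for constructions that do not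
  enlarge supports.\<close>

lemma realized_subset_support:
  assumes K: "simplicial_complex K" and V: "finite V" "\<Union>K \<subseteq> V" and x: "x \<in> realized K"
    and y: "\<And>v. 0 \<le> y v" "\<And>v. y v \<noteq> 0 \<Longrightarrow> x v \<noteq> 0" "sum y V = 1"
  shows "y \<in> realized K"
proof -
  have "{v. y v \<noteq> 0} \<noteq> {}"
    using y(3) by (metis (mono_tags, lifting) Collect_empty_eq sum.neutral zero_neq_one)
  moreover have "{v. y v \<noteq> 0} \<subseteq> {v. x v \<noteq> 0}" using y by auto
  moreover have "{v. x v \<noteq> 0} \<in> K" using x by (simp add: realized_def)
  ultimately have "{v. y v \<noteq> 0} \<in> K" using simplicial_complexD(3)[OF K] by blast
  then show ?thesis using y V by (simp add: realized_iff)
qed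

definition barycentre :: "'v set \<Rightarrow> 'v \<Rightarrow> real" where
  "barycentre s v = (if v \<in> s then 1 / card s else 0)"

lemma barycentre_in:
  assumes "simplicial_complex K" "s \<in> K"
  shows "barycentre s \<in> realized K"
proof -
  have s: "finite s" "s \<noteq> {}" using assms simplicial_complexD by auto
  then have "{v. barycentre s v \<noteq> 0} = s" by (auto simp: barycentre_def)
  moreover have "(\<Sum>v\<in>s. barycentre s v) = 1" using s by (simp add: barycentre_def)
  ultimately show ?thesis using assms by (auto simp: realized_def barycentre_def)
qed

lemma realized_empty_iff:
  assumes "simplicial_complex K"
  shows "realized K = {} \<longleftrightarrow> K = {}"
proof
  assume "realized K = {}"
  then show "K = {}" using barycentre_in[OF assms] by auto
qed (simp add: realized_def)

section \<open>Deletion of a face and excision around its barycentre\<close>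

locale face =
  fixes K :: "'v set set" and s :: "'v set"
  assumes complex: "simplicial_complex K" and s_in: "s \<in> K"
begin

definition del :: "'v set set" where "del = {t \<in> K. \<not> s \<subseteq> t}"
text \<open>For a vertex \<open>s\<close> this is the usual link, for a facet the boundary of
  \<open>s\<close>, and in general the join of the boundary of \<open>s\<close> with the usual link.
  The star of \<open>s\<close> is the cone over it from the barycentre of \<open>s\<close>.\<close>

definition lnk :: "'v set set" where "lnk = {t \<in> del. t \<union> s \<in> K}"

abbreviation "V \<equiv> \<Union>K"
abbreviation "k \<equiv> real (card s)"
text \<open>For points of the open star of \<open>s\<close>, \<open>k * mn x\<close> is the weight at the barycentre of \<open>s\<close> when the star is
  written as the cone from that barycentre, and \<open>retr\<close> is the radial projection away from it.\<close>
definition mn :: "('v \<Rightarrow> real) \<Rightarrow> real" where "mn x = Min (x ` s)"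
definition retr :: "('v \<Rightarrow> real) \<Rightarrow> 'v \<Rightarrow> real" where
  "retr x v = (x v - (if v \<in> s then mn x else 0)) / (1 - k * mn x)"

lemma face_basics: "finite s" "s \<noteq> {}" "s \<subseteq> V" "k > 0" "finite V"
  using complex s_in simplicial_complexD by (auto simp: card_gt_0_iff)

lemma complex_del: "simplicial_complex del" and complex_lnk: "simplicial_complex lnk"
proof -
  show d: "simplicial_complex del"
    using complex unfolding simplicial_complex_def del_def
    by (auto intro: finite_subset[of _ "\<Union>K"])
  have "t \<union> s \<in> K" if "u \<union> s \<in> K" "t \<subseteq> u" for t u
    using simplicial_complexD(3)[OF complex, of "u \<union> s" "t \<union> s"] that face_basics by auto
  then show "simplicial_complex lnk"
    using d unfolding simplicial_complex_def lnk_def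
    by (auto intro: finite_subset[of _ "\<Union>del"])
qed

lemma P_iff: "x \<in> realized K \<longleftrightarrow> (\<forall>v. 0 \<le> x v) \<and> {v. x v \<noteq> 0} \<in> K \<and> sum x V = 1"
  by (rule realized_iff) (use face_basics in auto)

lemma P_del_iff: "x \<in> realized del \<longleftrightarrow> (\<forall>v. 0 \<le> x v) \<and> {v. x v \<noteq> 0} \<in> del \<and> sum x V = 1"
  by (rule realized_iff) (use face_basics in \<open>auto simp: del_def\<close>)

lemma P_lnk_iff: "x \<in> realized lnk \<longleftrightarrow> (\<forall>v. 0 \<le> x v) \<and> {v. x v \<noteq> 0} \<in> lnk \<and> sum x V = 1"
  by (rule realized_iff) (use face_basics in \<open>auto simp: lnk_def del_def\<close>)

lemma P_sub:
  assumes "x \<in> realized K" "\<And>v. 0 \<le> y v" "\<And>v. y v \<noteq> 0 \<Longrightarrow> x v \<noteq> 0" "sum y V = 1"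
  shows "y \<in> realized K"
  by (rule realized_subset_support[OF complex face_basics(5) order_refl assms])

lemma mn_le: "v \<in> s \<Longrightarrow> mn x \<le> x v"
  using face_basics by (auto simp: mn_def)

lemma mn_attained: obtains w where "w \<in> s" "mn x = x w"
proof -
  have "Min (x ` s) \<in> x ` s" using face_basics by (intro Min_in) auto
  then show ?thesis using that by (auto simp: mn_def)
qed

lemma mn_geI: "(\<And>v. v \<in> s \<Longrightarrow> c \<le> x v) \<Longrightarrow> c \<le> mn x"
  by (metis mn_attained)

lemma mn_nonneg: "x \<in> realized K \<Longrightarrow> 0 \<le> mn x"
  by (rule mn_geI) (simp add: realized_def)

lemma mn_pos_iff:
  assumes "x \<in> realized K"
  shows "0 < mn x \<longleftrightarrow> s \<subseteq> {v. x v \<noteq> 0}"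
proof
  assume "0 < mn x"
  then show "s \<subseteq> {v. x v \<noteq> 0}" using mn_le[of _ x] by force
next
  assume *: "s \<subseteq> {v. x v \<noteq> 0}"
  obtain w where "w \<in> s" "mn x = x w" by (rule mn_attained)
  then show "0 < mn x" using * assms by (auto simp: P_iff order_less_le)
qed

lemma P_del_eq: "realized del = {x \<in> realized K. mn x = 0}"
proof -
  have "x \<in> realized del \<longleftrightarrow> x \<in> realized K \<and> mn x = 0" for x
    using mn_pos_iff[of x] mn_nonneg[of x] unfolding P_del_iff P_iff by (auto simp: del_def)
  then show ?thesis by auto
qed

lemma sum_ind: "(\<Sum>v\<in>V. if v \<in> s then c else 0) = k * c"
  using face_basics by (simp add: sum.inter_restrict[symmetric] Int_absorb1)

lemma continuous_mn: "continuous_on S mn"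
  unfolding mn_def by (intro continuous_on_Min_image continuous_on_coordinate face_basics)

lemma continuous_retr:
  assumes "\<And>x. x \<in> S \<Longrightarrow> k * mn x < 1"
  shows "continuous_on S retr"
proof (rule continuous_on_coordinatewise_then_product)
  fix v
  have "continuous_on S (\<lambda>x. if v \<in> s then mn x else 0)"
    by (cases "v \<in> s") (auto intro: continuous_mn)
  moreover have "1 - k * mn x \<noteq> 0" if "x \<in> S" for x using assms[OF that] by simp
  ultimately show "continuous_on S (\<lambda>x. retr x v)"
    unfolding retr_def by (intro continuous_intros continuous_on_coordinate continuous_mn) auto
qed

text \<open>Subtracting \<open>mn x\<close> on \<open>s\<close> removes the weight
  \<open>k * mn x\<close> and makes some coordinate in \<open>s\<close> vanish, so rescaling by
  \<open>1 - k * mn x\<close> gives a point of \<open>del\<close>. The last clause names such a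
  coordinate, at which \<open>mn\<close> can be bounded along lines.\<close>

lemma retr_props:
  assumes x: "x \<in> realized K" and lt: "k * mn x < 1"
  shows "0 \<le> retr x v" "retr x v \<noteq> 0 \<Longrightarrow> x v \<noteq> 0" "sum (retr x) V = 1"
    "retr x \<in> realized del" "mn x > 0 \<Longrightarrow> retr x \<in> realized lnk"
    "mn x = 0 \<Longrightarrow> retr x = x" "\<exists>w\<in>s. mn x = x w \<and> retr x w = 0"
proof -
  show nn: "0 \<le> retr x v" for v
    using lt mn_le[of v x] x by (auto simp: retr_def realized_def)
  show sp: "retr x v \<noteq> 0 \<Longrightarrow> x v \<noteq> 0" for v
    using mn_le[of v x] mn_nonneg[OF x] by (auto simp: retr_def split: if_splits)
  show sm: "sum (retr x) V = 1"
  proof -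
    have "sum (retr x) V = (sum x V - (\<Sum>v\<in>V. if v \<in> s then mn x else 0)) / (1 - k * mn x)"
      by (simp add: retr_def[abs_def] sum_subtractf sum_divide_distrib[symmetric])
    also have "\<dots> = 1" using x lt unfolding P_iff sum_ind by simp
    finally show ?thesis .
  qed
  show ex: "\<exists>w\<in>s. mn x = x w \<and> retr x w = 0"
  proof -
    obtain w where "w \<in> s" "mn x = x w" by (rule mn_attained)
    then show ?thesis by (intro bexI[of _ w]) (auto simp: retr_def)
  qed
  have PK: "retr x \<in> realized K"
    by (rule P_sub[OF x nn sp sm])
  then show PD: "retr x \<in> realized del"
    unfolding P_del_iff P_iff using ex by (auto simp: del_def)
  show "retr x \<in> realized lnk" if "mn x > 0"
  proof -
    have "s \<subseteq> {v. x v \<noteq> 0}" using that mn_pos_iff[OF x] by simp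
    then have "{v. retr x v \<noteq> 0} \<union> s \<subseteq> {v. x v \<noteq> 0}" using sp by auto
    moreover have "{v. x v \<noteq> 0} \<in> K" using x by (simp add: P_iff)
    ultimately have "{v. retr x v \<noteq> 0} \<union> s \<in> K"
      using simplicial_complexD(3)[OF complex] face_basics(2) by blast
    then show ?thesis using PD unfolding P_lnk_iff P_del_iff by (auto simp: lnk_def)
  qed
  show "retr x = x" if "mn x = 0" using that by (auto simp: retr_def fun_eq_iff)
qed

text \<open>Since the weights add up to 1, \<open>k * mn x\<close> is at most 1, with equality only
  at the barycentre of \<open>s\<close>: \<open>T\<close> is the realization punctured
  there.\<close>

definition T where "T = {x \<in> realized K. k * mn x < 1}"
definition St where "St = {x \<in> realized K. 0 < mn x}"

lemma line_in_P:
  assumes x: "x \<in> realized K" and t: "0 \<le> t" "t \<le> (1::real)"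
    and y: "\<And>v. 0 \<le> y v" "\<And>v. y v \<noteq> 0 \<Longrightarrow> x v \<noteq> 0" "sum y V = 1"
  shows "(\<lambda>v. (1 - t) * y v + t * x v) \<in> realized K"
proof (rule P_sub[OF x])
  show "0 \<le> (1 - t) * y v + t * x v" for v using x t y by (simp add: P_iff)
  show "(1 - t) * y v + t * x v \<noteq> 0 \<Longrightarrow> x v \<noteq> 0" for v using y(2)[of v] by auto
  show "(\<Sum>v\<in>V. (1 - t) * y v + t * x v) = 1"
    using x y by (simp add: sum.distrib sum_distrib_left[symmetric] P_iff)
qed

text \<open>\<open>retr\<close> is a deformation retraction of \<open>T\<close> onto
  \<open>del\<close>, along straight lines that do not move the points of
  \<open>del\<close>.\<close>

lemma T_rel_trivial: "trivial_group (relative_homology_group p (top_of_set T) (realized del))"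
proof (rule trivial_relative_homology_group_alt)
  have sub: "realized del \<subseteq> T" by (auto simp: P_del_eq T_def)
  show "continuous_map (top_of_set T) (subtopology (top_of_set T) (realized del)) retr"
    using continuous_retr[of T] retr_props(4) sub
    by (auto simp: T_def subtopology_subtopology Int_absorb1 continuous_map_in_subtopology)
  show "homotopic_with (\<lambda>h. h ` realized del \<subseteq> realized del) (top_of_set T) (top_of_set T) retr id"
  proof (rule homotopic_with_line)
    show "continuous_on T retr" by (rule continuous_retr) (simp add: T_def)
    show "continuous_on T id" by (rule continuous_on_id')
    fix t :: real assume t: "0 \<le> t" "t \<le> 1"
    show "(\<lambda>x v. (1 - t) * retr x v + t * id x v) ` realized del \<subseteq> realized del"
    proof (rule image_subsetI)
      fix x assume x: "x \<in> realized del"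
      then have "retr x = x" by (intro retr_props(6)) (auto simp: P_del_eq)
      then have "(\<lambda>v. (1 - t) * retr x v + t * id x v) = x" by (auto simp: fun_eq_iff algebra_simps)
      then show "(\<lambda>v. (1 - t) * retr x v + t * id x v) \<in> realized del" using x by simp
    qed
    fix x assume "x \<in> T"
    then have x: "x \<in> realized K" "k * mn x < 1" by (auto simp: T_def)
    let ?l = "\<lambda>v. (1 - t) * retr x v + t * id x v"
    have l: "?l \<in> realized K"
      unfolding id_apply by (rule line_in_P[OF x(1) t retr_props(1-3)[OF x]])
    obtain w where w: "w \<in> s" "mn x = x w" "retr x w = 0" using retr_props(7)[OF x] by auto
    \<comment> \<open>At \<open>w\<close> the retracted point vanishes, so \<open>mn\<close> never
      exceeds \<open>mn x\<close> along the line, and the line misses the barycentre.\<close>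
    have "mn ?l \<le> ?l w" using w by (intro mn_le)
    also have "\<dots> = t * mn x" using w by simp
    also have "\<dots> \<le> mn x" using t mn_nonneg[OF x(1)] by (simp add: mult_left_le_one_le)
    finally have "k * mn ?l \<le> k * mn x" by (simp add: mult_left_mono)
    then show "?l \<in> T" using l x by (simp add: T_def)
  qed
qed

text \<open>The open star is star-shaped about the barycentre: its points are positive on all of
  \<open>s\<close>, and convex combinations preserve this.\<close>

lemma St_contractible: "contractible_space (top_of_set St)" and St_nonempty: "barycentre s \<in> St"
proof -
  have b: "barycentre s \<in> realized K" by (rule barycentre_in[OF complex s_in])
  have bp: "barycentre s v > 0" if "v \<in> s" for v using that face_basics by (simp add: barycentre_def)
  show "barycentre s \<in> St"
  proof -
    obtain w where "w \<in> s" "mn (barycentre s) = barycentre s w" by (rule mn_attained)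
    then show ?thesis using b bp by (simp add: St_def)
  qed
  have "homotopic_with (\<lambda>x. True) (top_of_set St) (top_of_set St) (\<lambda>x. barycentre s) id"
  proof (rule homotopic_with_line)
    fix t :: real and x assume t: "0 \<le> t" "t \<le> 1" and "x \<in> St"
    then have x: "x \<in> realized K" "mn x > 0" by (auto simp: St_def)
    have xs: "x v > 0" if "v \<in> s" for v using mn_le[OF that, of x] x by simp
    let ?l = "\<lambda>v. (1 - t) * barycentre s v + t * id x v"
    have "?l \<in> realized K"
      unfolding id_apply
    proof (rule line_in_P[OF x(1) t])
      show "x v \<noteq> 0" if "barycentre s v \<noteq> 0" for v
        using that xs[of v] by (auto simp: barycentre_def split: if_splits)
    qed (use b in \<open>auto simp: P_iff\<close>)
    moreover have "mn ?l > 0"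
    proof -
      obtain w where w: "w \<in> s" "mn ?l = ?l w" using mn_attained by blast
      then show ?thesis using bp[of w] xs[of w] t
        by (cases "t = 0") (auto intro: add_nonneg_pos)
    qed
    ultimately show "?l \<in> St" by (simp add: St_def)
  qed (auto intro: continuous_intros)
  then show "contractible_space (top_of_set St)"
    unfolding contractible_space_def by (intro exI) (rule homotopic_with_symD)
qed

text \<open>Since \<open>T\<close> retracts onto \<open>del\<close>, excision compares the pair \<open>(K, del)\<close> with the pair \<open>(St, St \<inter> T)\<close>, a contractible
  open star and the star punctured at its barycentre, which is homotopy equivalent to \<open>lnk\<close>.\<close>
definition bump :: "('v \<Rightarrow> real) \<Rightarrow> 'v \<Rightarrow> real" where
  "bump y v = y v / 2 + (if v \<in> s then 1 / (2 * k) else 0)"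

text \<open>\<open>bump y\<close> is the midpoint of \<open>y\<close> and the barycentre of
  \<open>s\<close>. As \<open>y\<close> vanishes somewhere on \<open>s\<close>, the minimum over
  \<open>s\<close> is exactly half of \<open>1 / k\<close>, which is what \<open>retr\<close>
  subtracts again.\<close>

lemma bump_props:
  assumes y: "y \<in> realized lnk"
  shows "0 \<le> bump y v" "sum (bump y) V = 1" "{v. bump y v \<noteq> 0} = {v. y v \<noteq> 0} \<union> s"
    "mn (bump y) = 1 / (2 * k)" "bump y \<in> St \<inter> T" "retr (bump y) = y"
proof -
  have y': "\<And>v. 0 \<le> y v" "{v. y v \<noteq> 0} \<union> s \<in> K" "\<not> s \<subseteq> {v. y v \<noteq> 0}" "sum y V = 1"
    using y unfolding P_lnk_iff by (auto simp: lnk_def del_def)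
  show nn: "0 \<le> bump y v" for v using y' by (simp add: bump_def)
  show sm: "sum (bump y) V = 1"
    unfolding bump_def sum.distrib sum_ind using y' face_basics by (simp add: sum_divide_distrib[symmetric])
  show sp: "{v. bump y v \<noteq> 0} = {v. y v \<noteq> 0} \<union> s"
    using y'(1) face_basics(4) by (auto simp: bump_def add_nonneg_eq_0_iff split: if_splits)
  have P: "bump y \<in> realized K"
    unfolding P_iff sp using nn sm y' by auto
  obtain w where w: "w \<in> s" "y w = 0" using y' by auto
  show mn: "mn (bump y) = 1 / (2 * k)"
  proof (rule antisym)
    show "mn (bump y) \<le> 1 / (2 * k)" using mn_le[OF w(1), of "bump y"] w by (simp add: bump_def)
    show "1 / (2 * k) \<le> mn (bump y)" by (rule mn_geI) (use y' in \<open>simp add: bump_def\<close>)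
  qed
  show "bump y \<in> St \<inter> T" using P face_basics mn by (simp add: St_def T_def)
  show "retr (bump y) = y" unfolding fun_eq_iff retr_def mn using face_basics by (auto simp: bump_def)
qed

text \<open>\<open>retr\<close> and \<open>bump\<close> are inverse up to homotopy:
  \<open>retr \<circ> bump\<close> is the identity, and \<open>bump \<circ> retr\<close> only slides
  points along the rays from the barycentre.\<close>

lemma St_T_lnk: "top_of_set (St \<inter> T) homotopy_equivalent_space top_of_set (realized lnk)"
  unfolding homotopy_equivalent_space_def
proof (intro exI conjI)
  have cr: "continuous_on (St \<inter> T) retr" by (rule continuous_retr) (simp add: T_def)
  have rl: "retr x \<in> realized lnk" if "x \<in> St \<inter> T" for x
    using that retr_props(5)[of x] by (auto simp: St_def T_def)
  have cb: "continuous_on (realized lnk) bump"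
    unfolding bump_def[abs_def]
    by (intro continuous_on_coordinatewise_then_product continuous_intros continuous_on_coordinate) simp
  show "continuous_map (top_of_set (St \<inter> T)) (top_of_set (realized lnk)) retr"
    using cr rl by (auto simp del: Int_iff)
  show "continuous_map (top_of_set (realized lnk)) (top_of_set (St \<inter> T)) bump"
    using cb bump_props(5) by (auto simp del: Int_iff)
  show "homotopic_with (\<lambda>x. True) (top_of_set (realized lnk)) (top_of_set (realized lnk)) (retr \<circ> bump) id"
    by (rule homotopic_with_equal)
       (use bump_props(6) in \<open>auto intro: continuous_on_eq[OF continuous_on_id]\<close>)
  show "homotopic_with (\<lambda>x. True) (top_of_set (St \<inter> T)) (top_of_set (St \<inter> T)) (bump \<circ> retr) id"
  proof (rule homotopic_with_line)
    show "continuous_on (St \<inter> T) (bump \<circ> retr)"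
      by (rule continuous_on_compose[OF cr continuous_on_subset[OF cb]]) (use rl in auto)
    show "continuous_on (St \<inter> T) id" by (rule continuous_on_id')
    fix t :: real and x assume t: "0 \<le> t" "t \<le> 1" and xs: "x \<in> St \<inter> T"
    then have x: "x \<in> realized K" "mn x > 0" "k * mn x < 1" by (auto simp: St_def T_def)
    note b = bump_props[OF rl[OF xs]]
    have ssub: "s \<subseteq> {v. x v \<noteq> 0}" using mn_pos_iff[OF x(1)] x by simp
    let ?l = "\<lambda>v. (1 - t) * (bump \<circ> retr) x v + t * id x v"
    have l: "?l \<in> realized K"
      unfolding id_apply comp_def
    proof (rule line_in_P[OF x(1) t])
      show "x v \<noteq> 0" if "bump (retr x) v \<noteq> 0" for v
        using that b(3) ssub retr_props(2)[OF x(1,3), of v] by auto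
    qed (use b in auto)
    obtain w where w: "w \<in> s" "mn x = x w" "retr x w = 0" using retr_props(7)[OF x(1,3)] by auto
    \<comment> \<open>Evaluating at a vertex where \<open>retr x\<close> vanishes bounds
      \<open>k * mn ?l\<close> by a convex combination of \<open>1 / 2\<close> and
      \<open>k * mn x\<close>, both below 1.\<close>
    have "mn ?l \<le> ?l w" using w by (intro mn_le)
    also have "?l w = (1 - t) * (1 / (2 * k)) + t * mn x" using w by (simp add: bump_def)
    also have "k * \<dots> = (1 - t) * (k * (1 / (2 * k))) + t * (k * mn x)"
      by (simp only: distrib_left mult.left_commute)
    also have "k * (1 / (2 * k)) = 1 / 2" using face_basics by simp
    finally have le: "k * mn ?l \<le> (1 - t) * (1 / 2) + t * (k * mn x)" using face_basics by (simp add: mult_left_mono)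
    have "(1 - t) * (1 / 2) + t * (k * mn x) < 1"
    proof (cases "t = 0")
      case False
      then have "t * (k * mn x) < t * 1" using t x(3) by (intro mult_strict_left_mono) auto
      then show ?thesis using t by (simp add: field_simps)
    qed simp
    with le have lt: "k * mn ?l < 1" by simp
    have "mn ?l > 0"
    proof -
      obtain w where w: "w \<in> s" "mn ?l = ?l w" using mn_attained by blast
      have "bump (retr x) w > 0" using b(1)[of w] b(3) w by (auto simp: order_less_le)
      moreover have "x w > 0" using mn_le[OF w(1), of x] x by simp
      ultimately show ?thesis using w t
        by (cases "t = 0") (auto intro: add_nonneg_pos)
    qed
    then show "?l \<in> St \<inter> T" using l lt by (simp add: St_def T_def)
  qed simp
qed

lemma relative_iso_star:
  "relative_homology_group p (top_of_set (realized K)) (realized del)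
     \<cong> relative_homology_group p (top_of_set St) (St \<inter> T)"
proof -
  let ?X = "top_of_set (realized K)"
  have sub: "realized del \<subseteq> T" "T \<subseteq> realized K"
    by (auto simp: P_del_eq T_def)
  have XT: "subtopology ?X T = top_of_set T"
    using sub by (simp add: subtopology_subtopology Int_absorb1)
  \<comment> \<open>In the exact sequence of the triple \<open>del\<close>, \<open>T\<close>,
    \<open>K\<close> both outer terms are relative groups of the pair \<open>(T, del)\<close>, which
    vanish.\<close>
  have "hom_induced p ?X (realized del) ?X T id
      \<in> iso (relative_homology_group p ?X (realized del)) (relative_homology_group p ?X T)"
  proof (rule very_short_exact_sequence)
    show "exact_seq
         ([relative_homology_group (p - 1) (subtopology ?X T) (realized del), relative_homology_group p ?X T,
           relative_homology_group p ?X (realized del), relative_homology_group p (subtopology ?X T) (realized del)],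
          [hom_relboundary p ?X T (realized del), hom_induced p ?X (realized del) ?X T id,
           hom_induced p (subtopology ?X T) (realized del) ?X (realized del) id])"
      using homology_exactness_triple_1[OF sub(1), of p ?X] homology_exactness_triple_3[OF sub(1), of p ?X]
      by fastforce
  qed (simp_all only: XT T_rel_trivial)
  then have 1: "relative_homology_group p ?X (realized del) \<cong> relative_homology_group p ?X T"
    by (rule is_isoI)
  have op: "openin ?X T"
  proof -
    have "openin ?X (realized K \<inter> (\<lambda>x. k * mn x) -` {..<1})"
      by (rule continuous_openin_preimage_gen) (auto intro!: continuous_intros continuous_mn)
    moreover have "realized K \<inter> (\<lambda>x. k * mn x) -` {..<1} = T" by (auto simp: T_def)
    ultimately show ?thesis by simp
  qed
  have cl: "closedin ?X (realized del)"
  proof -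
    have "closedin ?X (realized K \<inter> mn -` {0})"
      by (rule continuous_closedin_preimage) (auto intro!: continuous_mn)
    moreover have "realized K \<inter> mn -` {0} = realized del" by (auto simp: P_del_eq)
    ultimately show ?thesis by simp
  qed
  \<comment> \<open>\<open>del\<close> can be excised because it is closed and lies inside the open
    set \<open>T\<close>.\<close>
  have "?X closure_of realized del \<subseteq> ?X interior_of T"
    using cl op sub by (simp add: closure_of_closedin interior_of_openin)
  from homology_excision_axiom[OF this sub(2), of p]
  have "relative_homology_group p (subtopology ?X (realized K - realized del)) (T - realized del)
      \<cong> relative_homology_group p (subtopology ?X (realized K)) T"
    by (rule is_isoI)
  moreover have "realized K - realized del = St"
    using mn_nonneg by (auto simp: P_del_eq St_def order_le_less)
  moreover have "T - realized del = St \<inter> T"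
    using mn_nonneg by (auto simp: P_del_eq St_def T_def order_le_less)
  moreover have "subtopology ?X St = top_of_set St"
    by (simp add: subtopology_subtopology Int_absorb1 St_def)
  moreover have "subtopology ?X (realized K) = ?X"
    by (simp add: subtopology_subtopology)
  ultimately have "relative_homology_group p (top_of_set St) (St \<inter> T) \<cong> relative_homology_group p ?X T"
    by simp
  then have "relative_homology_group p ?X T \<cong> relative_homology_group p (top_of_set St) (St \<inter> T)"
    by (rule group.iso_sym[rotated]) simp
  with 1 show ?thesis by (rule iso_trans)
qed

lemma relative_iso_lnk:
  assumes "lnk \<noteq> {}"
  shows "relative_homology_group p (geometric_realization K) (realized del)
     \<cong> reduced_homology_group (p - 1) (geometric_realization lnk)"
proof -
  obtain y where "y \<in> realized lnk"
    using realized_empty_iff[OF complex_lnk] assms by auto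
  then have ne: "bump y \<in> St \<inter> T" by (rule bump_props)
  have "relative_homology_group p (top_of_set St) (St \<inter> T)
      \<cong> reduced_homology_group (p - 1) (subtopology (top_of_set St) (St \<inter> T))"
    by (rule isomorphic_group_relative_homology_of_contractible[OF St_contractible]) (use ne in auto)
  also have "subtopology (top_of_set St) (St \<inter> T) = top_of_set (St \<inter> T)"
    by (simp add: subtopology_subtopology Int_absorb1)
  also have "reduced_homology_group (p - 1) \<dots> \<cong> reduced_homology_group (p - 1) (top_of_set (realized lnk))"
    by (rule homotopy_equivalent_space_imp_isomorphic_reduced_homology_groups[OF St_T_lnk])
  finally show ?thesis
    unfolding geometric_realization_eq by (rule iso_trans[OF relative_iso_star])
qed

text \<open>An empty \<open>lnk\<close> means that \<open>s\<close> is an isolated vertex. The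
  punctured star is then empty, and the relative group becomes the unreduced homology of the
  contractible star.\<close>

lemma relative_iso_lnk_empty:
  assumes "lnk = {}"
  shows "relative_homology_group p (geometric_realization K) (realized del)
     \<cong> homology_group p (top_of_set St)"
proof -
  have "x \<notin> St \<inter> T" for x
    using assms retr_props(5)[of x] by (auto simp: St_def T_def realized_def)
  then have "St \<inter> T = {}" by blast
  then show ?thesis
    using relative_iso_star[of p] by (simp add: geometric_realization_eq)
qed

end

section \<open>Homology after deleting a face\<close>

text \<open>The empty complex is given its usual reduced homology in degree \<open>-1\<close>; the library's reduced homology
  of the empty space vanishes in all degrees.\<close>
definition homology_type :: "'v set set \<Rightarrow> (int \<Rightarrow> nat) \<Rightarrow> bool" where
  "homology_type K f \<longleftrightarrow>
     (if K = {} then f = (\<lambda>i. if i = -1 then 1 else 0)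
      else \<forall>i. reduced_homology_group i (geometric_realization K) \<cong> free_rank (f i))"

lemma trivial_target_hom:
  assumes "h \<in> hom G H" "trivial_group H" "x \<in> carrier G"
  shows "h x = \<one>\<^bsub>H\<^esub>"
  using hom_in_carrier[OF assms(1,3)] assms(2) by (auto simp: trivial_group_def)

lemma trivial_source_hom:
  assumes "h \<in> hom G H" "group G" "group H" "trivial_group G" "x \<in> carrier G"
  shows "h x = \<one>\<^bsub>H\<^esub>"
proof -
  have "x = \<one>\<^bsub>G\<^esub>" using assms by (auto simp: trivial_group_def)
  then show ?thesis using hom_one[OF assms(1-3)] by simp
qed

lemma trivial_free_rankI: "group G \<Longrightarrow> G \<cong> free_rank r \<Longrightarrow> r = 0 \<Longrightarrow> trivial_group G"
  using iso_free_rank_0[of G] by simp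

lemma comm_group_reduced_homology_group: "comm_group (reduced_homology_group p X)"
  unfolding reduced_homology_group_def
  by (rule group.abelian_subgroup_generated[OF group_relative_homology_group abelian_homology_group])

lemma homology_group_contractible:
  assumes "contractible_space X" "topspace X \<noteq> {}"
  shows "homology_group p X \<cong> free_rank (if p = 0 then 1 else 0)"
proof (cases "p = 0")
  case True
  have "homology_group 0 X \<cong> integer_group"
    using assms by (intro isomorphic_integer_zeroth_homology_group contractible_imp_path_connected_space)
  also have "\<dots> \<cong> free_Abelian_group {0::nat}"
    by (rule isomorphic_group_integer_free_Abelian_group_singleton)
  also have "{0::nat} = {..<1}" by auto
  finally show ?thesis using True by simp
next
  case False
  then have "trivial_group (homology_group p X)"
    using trivial_reduced_homology_group_contractible_space[OF assms(1), of p]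
    by (simp add: un_reduced_homology_group)
  then show ?thesis using False iso_free_rank_0[of "homology_group p X"] by simp
qed

text \<open>The map to a point has the reduced homology as kernel, and the inclusion of any point
  \<open>a\<close> shows that it is surjective.\<close>

lemma homology_group_of_reduced:
  assumes "topspace X \<noteq> {}" "reduced_homology_group p X \<cong> free_rank r"
  shows "homology_group p X \<cong> free_rank (r + (if p = 0 then 1 else 0))"
proof -
  let ?pt = "discrete_topology {()}"
  let ?g = "hom_induced p X {} ?pt {} (\<lambda>x. ())"
  obtain a where a: "a \<in> topspace X" using assms(1) by blast
  have car: "carrier (reduced_homology_group p X) \<subseteq> carrier (homology_group p X)"
    by (rule carrier_reduced_homology_group_subset)
  have pt: "homology_group p ?pt \<cong> free_rank (if p = 0 then 1 else 0)"
    by (rule homology_group_contractible)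
      (auto simp: contractible_space_def intro!: exI[of _ "()"] homotopic_with_equal)
  show ?thesis
  proof (rule short_exact_free_rank[where f = "\<lambda>x. x" and g = ?g, OF _ _ _ _ _ _ _ _ assms(2) pt])
    show "comm_group (homology_group p X)" by (rule abelian_homology_group)
    show "(\<lambda>x. x) \<in> hom (reduced_homology_group p X) (homology_group p X)"
      using car by (auto simp: hom_def reduced_homology_group_def)
    show g: "?g \<in> hom (homology_group p X) (homology_group p ?pt)"
      by (rule hom_induced_empty_hom)
    have "y = ?g (hom_induced p ?pt {} X {} (\<lambda>_. a) y)" if "y \<in> carrier (homology_group p ?pt)" for y
    proof -
      have "?g (hom_induced p ?pt {} X {} (\<lambda>_. a) y) = hom_induced p ?pt {} ?pt {} ((\<lambda>x. ()) \<circ> (\<lambda>_. a)) y"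
        using a by (intro hom_induced_compose') auto
      also have "(\<lambda>x. ()) \<circ> (\<lambda>_. a) = id" by auto
      also have "hom_induced p ?pt {} ?pt {} id y = y" using that by (rule hom_induced_id)
      finally show ?thesis by simp
    qed
    then show "?g ` carrier (homology_group p X) = carrier (homology_group p ?pt)"
      using hom_in_carrier[OF g] by (intro equalityI subsetI image_eqI[OF _ hom_induced_carrier]) auto
    show "kernel (homology_group p X) (homology_group p ?pt) ?g = (\<lambda>x. x) ` carrier (reduced_homology_group p X)"
      by (simp add: carrier_reduced_homology_group)
  qed auto
qed

lemma support_nonempty:
  fixes f :: "'v \<Rightarrow> real"
  assumes "sum f A = 1"
  shows "{v. f v \<noteq> 0} \<noteq> {}"
proof
  assume "{v. f v \<noteq> 0} = {}"
  then have "f v = 0" for v by auto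
  then show False using assms by simp
qed

text \<open>A cone contracts along straight lines to its apex \<open>v\<close>.\<close>

lemma homology_type_cone:
  assumes K: "simplicial_complex K" and v: "{v} \<in> K" "\<And>t. t \<in> K \<Longrightarrow> insert v t \<in> K"
  shows "homology_type K (\<lambda>_. 0)"
proof -
  let ?P = "realized K" and ?V = "\<Union>K"
  have fin: "finite ?V" "v \<in> ?V" using simplicial_complexD(1)[OF K] v by auto
  note P_iff = realized_iff[OF fin(1) order_refl]
  have "homotopic_with (\<lambda>x. True) (top_of_set ?P) (top_of_set ?P) (\<lambda>x w. if w = v then 1 else 0) id"
  proof (rule homotopic_with_line)
    fix t :: real and x assume t: "0 \<le> t" "t \<le> 1" and x: "x \<in> ?P"
    let ?l = "\<lambda>w. (1 - t) * (if w = v then 1 else 0) + t * id x w"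
    have x': "\<And>w. 0 \<le> x w" "{w. x w \<noteq> 0} \<in> K" "sum x ?V = 1"
      using x by (auto simp: P_iff)
    have nn: "0 \<le> ?l w" for w using t x' by simp
    have sm: "sum ?l ?V = 1"
      using x' fin by (simp add: sum.distrib sum_distrib_left[symmetric])
    have "{w. ?l w \<noteq> 0} \<noteq> {}"
      using sm by (rule support_nonempty)
    moreover have "{w. ?l w \<noteq> 0} \<subseteq> insert v {w. x w \<noteq> 0}" by auto
    ultimately have "{w. ?l w \<noteq> 0} \<in> K"
      using simplicial_complexD(3)[OF K v(2)[OF x'(2)]] by simp
    then show "?l \<in> ?P" using nn sm by (simp add: P_iff)
  qed (auto intro!: continuous_intros)
  then have "contractible_space (geometric_realization K)"
    unfolding contractible_space_def geometric_realization_eq by (intro exI) (rule homotopic_with_symD)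
  then have "trivial_group (reduced_homology_group i (geometric_realization K))" for i
    by (rule trivial_reduced_homology_group_contractible_space)
  then show ?thesis
    using iso_free_rank_0[OF group_reduced_homology_group] v(1)
    unfolding homology_type_def by (metis empty_iff)
qed

context face
begin

text \<open>The convention for the empty complex unites both cases: a class of the empty link in
  degree -1 stands for the class in degree 0 of an isolated vertex.\<close>

lemma relative_homology_type:
  assumes "homology_type lnk g"
  shows "relative_homology_group p (geometric_realization K) (realized del) \<cong> free_rank (g (p - 1))"
proof (cases "lnk = {}")
  case True
  have "homology_group p (top_of_set St) \<cong> free_rank (if p = 0 then 1 else 0)"
    by (rule homology_group_contractible[OF St_contractible]) (use St_nonempty in auto)
  moreover have "g (p - 1) = (if p = 0 then 1 else 0)"
    using assms True by (simp add: homology_type_def)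
  ultimately have "homology_group p (top_of_set St) \<cong> free_rank (g (p - 1))"
    by (simp only:)
  then show ?thesis
    by (rule iso_trans[OF relative_iso_lnk_empty[OF True, of p]])
next
  case False
  then have "reduced_homology_group (p - 1) (geometric_realization lnk) \<cong> free_rank (g (p - 1))"
    using assms by (simp add: homology_type_def)
  then show ?thesis by (rule iso_trans[OF relative_iso_lnk[OF False, of p]])
qed

lemma subtopology_del: "subtopology (geometric_realization K) (realized del) = geometric_realization del"
  by (simp add: geometric_realization_eq subtopology_subtopology P_del_eq Int_absorb1)

abbreviation "incl p \<equiv> hom_induced p (geometric_realization del) {} (geometric_realization K) {} id"
abbreviation "proj p \<equiv> hom_induced p (geometric_realization K) {} (geometric_realization K) (realized del) id"
abbreviation "bdry p \<equiv> hom_boundary p (geometric_realization K) (realized del)"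
abbreviation "HK p \<equiv> reduced_homology_group p (geometric_realization K)"
abbreviation "HD p \<equiv> reduced_homology_group p (geometric_realization del)"
abbreviation "HR p \<equiv> relative_homology_group p (geometric_realization K) (realized del)"

lemma homs:
  assumes "del \<noteq> {}"
  shows "incl p \<in> hom (HD p) (HK p)" "proj p \<in> hom (HK p) (HR p)" "bdry p \<in> hom (HR p) (HD (p - 1))"
    "kernel (HR p) (HD (p - 1)) (bdry p) = proj p ` carrier (HK p)"
    "kernel (HD (p - 1)) (HK (p - 1)) (incl (p - 1)) = bdry p ` carrier (HR p)"
    "kernel (HK p) (HR p) (proj p) = incl p ` carrier (HD p)"
proof -
  have ne: "topspace (geometric_realization K) \<inter> realized del \<noteq> {}"
    using assms realized_empty_iff[OF complex_del] by (auto simp: geometric_realization_eq P_del_eq)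
  show "incl p \<in> hom (HD p) (HK p)" "proj p \<in> hom (HK p) (HR p)" "bdry p \<in> hom (HR p) (HD (p - 1))"
    "kernel (HR p) (HD (p - 1)) (bdry p) = proj p ` carrier (HK p)"
    "kernel (HD (p - 1)) (HK (p - 1)) (incl (p - 1)) = bdry p ` carrier (HR p)"
    "kernel (HK p) (HR p) (proj p) = incl p ` carrier (HD p)"
    using homology_exactness_reduced_1[OF ne, of p] homology_exactness_reduced_2[of p "geometric_realization K" "realized del"]
      homology_exactness_reduced_3[of p "geometric_realization K" "realized del"]
    by (simp_all add: subtopology_del group_hom_def group_hom_axioms_def)
qed

text \<open>The kernel is the image of the relative group in degree \<open>p + 1\<close>, whose rank
  is \<open>g p\<close>. This is the injectivity that the last claim needs; nothing about
  \<open>del\<close> enters.\<close>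

lemma incl_inj:
  assumes "homology_type lnk g" "g p = 0" "del \<noteq> {}"
  shows "inj_on (incl p) (carrier (HD p))"
proof -
  have "trivial_group (HR (p + 1))"
    by (rule trivial_free_rankI[OF _ relative_homology_type[OF assms(1)]]) (use assms in auto)
  then have "bdry (p + 1) ` carrier (HR (p + 1)) \<subseteq> {\<one>\<^bsub>HD p\<^esub>}"
    using trivial_source_hom[OF homs(3)[OF assms(3), of "p + 1"]] by auto
  then have "kernel (HD p) (HK p) (incl p) \<subseteq> {\<one>\<^bsub>HD p\<^esub>}"
    using homs(5)[OF assms(3), of "p + 1"] by simp
  moreover have "group_hom (HD p) (HK p) (incl p)"
    using homs(1)[OF assms(3)] by (simp add: group_hom_def group_hom_axioms_def)
  ultimately show ?thesis
    by (auto simp: group_hom.inj_on_one_iff kernel_def)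
qed

text \<open>If \<open>del\<close> were empty, so would be \<open>lnk\<close>, and both would have a
  class in degree -1, against the disjointness of \<open>f\<close> and \<open>g\<close>.\<close>

lemma del_nonempty: "homology_type del f \<Longrightarrow> homology_type lnk g \<Longrightarrow> (\<And>i. f i = 0 \<or> g i = 0) \<Longrightarrow> del \<noteq> {}"
proof
  assume f: "homology_type del f" and g: "homology_type lnk g" and d: "\<And>i. f i = 0 \<or> g i = 0" and "del = {}"
  then have "lnk = {}" by (auto simp: lnk_def)
  then show False using f g \<open>del = {}\<close> d[of "-1"] by (simp add: homology_type_def)
qed

text \<open>The connecting map runs from a group of rank \<open>g (p - 1)\<close> to one of rank
  \<open>f (p - 1)\<close>. One of these is zero, so the connecting map vanishes and short exact
  sequences with free quotient remain.\<close>

lemma homology_type_add_face: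
  assumes f: "homology_type del f" and g: "homology_type lnk g" and d: "\<And>i. f i = 0 \<or> g i = 0"
  shows "homology_type K (\<lambda>i. f i + g (i - 1))"
proof -
  have ne: "del \<noteq> {}" by (rule del_nonempty[OF assms])
  note homs = homs[OF ne]
  have F: "HD p \<cong> free_rank (f p)" for p using f ne by (simp add: homology_type_def)
  note G = relative_homology_type[OF g]
  have bz: "bdry p x = \<one>\<^bsub>HD (p - 1)\<^esub>" if "x \<in> carrier (HR p)" for p x
    using d[of "p - 1"]
  proof
    assume "f (p - 1) = 0"
    then show ?thesis
      using trivial_target_hom[OF homs(3) _ that] trivial_free_rankI[OF _ F[of "p - 1"]] by simp
  next
    assume "g (p - 1) = 0"
    then show ?thesis
      using trivial_source_hom[OF homs(3) _ _ _ that] trivial_free_rankI[OF _ G[of p]] by simp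
  qed
  have "HK p \<cong> free_rank (f p + g (p - 1))" for p
  proof (rule short_exact_free_rank[where f = "incl p" and g = "proj p", OF _ _ _ _ _ _ _ _ F G])
    show "inj_on (incl p) (carrier (HD p))"
    proof -
      have "kernel (HD p) (HK p) (incl p) \<subseteq> {\<one>\<^bsub>HD p\<^esub>}"
        using homs(5)[of "p + 1"] bz[of _ "p + 1"] by auto
      moreover have "group_hom (HD p) (HK p) (incl p)"
        using homs(1) by (simp add: group_hom_def group_hom_axioms_def)
      ultimately show ?thesis by (auto simp: group_hom.inj_on_one_iff kernel_def)
    qed
    have "kernel (HR p) (HD (p - 1)) (bdry p) = carrier (HR p)"
      using bz by (auto simp: kernel_def)
    then show "proj p ` carrier (HK p) = carrier (HR p)" using homs(4)[of p] by simp
  qed (use homs(1,2,6) comm_group_reduced_homology_group in auto)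
  moreover have "K \<noteq> {}" using s_in by auto
  ultimately show ?thesis by (simp add: homology_type_def)
qed

text \<open>The same sequence read the other way: now the map from \<open>K\<close> to the relative
  group vanishes for degree reasons, so all classes of the link survive in \<open>del\<close> next
  to those of \<open>K\<close>.\<close>

lemma homology_type_remove_face:
  assumes f: "homology_type K f" and g: "homology_type lnk g" and d: "\<And>i. f i = 0 \<or> g (i - 1) = 0"
    and ne: "del \<noteq> {}"
  shows "homology_type del (\<lambda>i. f i + g i)"
proof -
  note homs = homs[OF ne]
  have "K \<noteq> {}" using s_in by auto
  then have F: "HK p \<cong> free_rank (f p)" for p using f by (simp add: homology_type_def)
  note G = relative_homology_type[OF g]
  have pz: "proj p x = \<one>\<^bsub>HR p\<^esub>" if "x \<in> carrier (HK p)" for p x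
    using d[of p]
  proof
    assume "f p = 0"
    then show ?thesis
      using trivial_source_hom[OF homs(2) _ _ _ that] trivial_free_rankI[OF _ F[of p]] by simp
  next
    assume "g (p - 1) = 0"
    then show ?thesis
      using trivial_target_hom[OF homs(2) _ that] trivial_free_rankI[OF _ G[of p]] by simp
  qed
  have "HD p \<cong> free_rank (g p + f p)" for p
  proof (rule short_exact_free_rank[where A = "HR (p + 1)" and f = "bdry (p + 1)" and g = "incl p", OF _ _ _ _ _ _ _ _ _ F])
    show "HR (p + 1) \<cong> free_rank (g p)" using G[of "p + 1"] by simp
    show "bdry (p + 1) \<in> hom (HR (p + 1)) (HD p)" using homs(3)[of "p + 1"] by simp
    show "inj_on (bdry (p + 1)) (carrier (HR (p + 1)))"
    proof -
      have "kernel (HR (p + 1)) (HD p) (bdry (p + 1)) \<subseteq> {\<one>\<^bsub>HR (p + 1)\<^esub>}"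
        using homs(4)[of "p + 1"] pz[of _ "p + 1"] by auto
      moreover have "group_hom (HR (p + 1)) (HD p) (bdry (p + 1))"
        using homs(3)[of "p + 1"] by (simp add: group_hom_def group_hom_axioms_def)
      ultimately show ?thesis by (auto simp: group_hom.inj_on_one_iff kernel_def)
    qed
    have "kernel (HK p) (HR p) (proj p) = carrier (HK p)"
      using pz by (auto simp: kernel_def)
    then show "incl p ` carrier (HD p) = carrier (HK p)" using homs(6)[of p] by simp
    show "kernel (HD p) (HK p) (incl p) = bdry (p + 1) ` carrier (HR (p + 1))"
      using homs(5)[of "p + 1"] by simp
  qed (use homs(1) comm_group_reduced_homology_group in auto)
  then show ?thesis using ne by (simp add: homology_type_def add.commute)
qed

end

section \<open>Independence complexes of the conflict graph\<close>

definition indep :: "('v \<Rightarrow> 'v \<Rightarrow> bool) \<Rightarrow> 'v set \<Rightarrow> 'v set set" where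
  "indep R V = {s. s \<noteq> {} \<and> s \<subseteq> V \<and> (\<forall>x\<in>s. \<forall>y\<in>s. \<not> R x y)}"

lemma indep_empty [simp]: "indep R {} = {}"
  by (auto simp: indep_def)

locale conflict =
  fixes R :: "'v \<Rightarrow> 'v \<Rightarrow> bool"
  assumes sym: "R x y \<Longrightarrow> R y x" and irrefl: "\<not> R x x"
begin

lemma simplicial_complex_indep: "finite V \<Longrightarrow> simplicial_complex (indep R V)"
  unfolding simplicial_complex_def indep_def
  by (auto intro: finite_subset[of _ V])

text \<open>Deletion and link of a vertex are again independence complexes of induced subgraphs, so
  all further work happens on vertex sets.\<close>

lemma face_vertex:
  assumes "finite V" "v \<in> V"
  shows "face (indep R V) {v}" "face.del (indep R V) {v} = indep R (V - {v})"
    "face.lnk (indep R V) {v} = indep R {w \<in> V - {v}. \<not> R v w}"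
proof -
  show f: "face (indep R V) {v}"
    using assms irrefl by (simp add: face_def simplicial_complex_indep) (simp add: indep_def)
  show d: "face.del (indep R V) {v} = indep R (V - {v})"
    unfolding face.del_def[OF f] by (auto simp: indep_def)
  show "face.lnk (indep R V) {v} = indep R {w \<in> V - {v}. \<not> R v w}"
    unfolding face.lnk_def[OF f] d using assms sym irrefl by (auto simp: indep_def)
qed

definition ht :: "'v set \<Rightarrow> (int \<Rightarrow> nat) \<Rightarrow> bool" where
  "ht V f \<longleftrightarrow> homology_type (indep R V) f"

lemma ht_vertex:
  assumes "finite V" "v \<in> V" "ht (V - {v}) f" "ht {w \<in> V - {v}. \<not> R v w} g" "\<And>i. f i = 0 \<or> g i = 0"
  shows "ht V (\<lambda>i. f i + g (i - 1))"
  using face.homology_type_add_face[OF face_vertex(1)[OF assms(1,2)], unfolded face_vertex(2,3)[OF assms(1,2)]]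
    assms(3-5) by (simp add: ht_def)

lemma ht_isolated:
  assumes "finite V" "v \<in> V" "\<And>w. w \<in> V \<Longrightarrow> \<not> R v w"
  shows "ht V (\<lambda>_. 0)"
  unfolding ht_def
proof (rule homology_type_cone[OF simplicial_complex_indep[OF assms(1)]])
  show "{v} \<in> indep R V" using assms irrefl by (auto simp: indep_def)
  show "insert v t \<in> indep R V" if "t \<in> indep R V" for t
    using that assms irrefl sym unfolding indep_def by blast
qed

text \<open>In the link of \<open>v\<close> the vertex \<open>u\<close> has lost all its neighbours.
  The link is thus a cone, and deleting \<open>v\<close> does not change the homology.\<close>

lemma ht_dominated_vertex:
  assumes "finite V" "u \<in> V" "v \<in> V" "u \<noteq> v" "\<not> R u v" "\<And>w. w \<in> V \<Longrightarrow> R u w \<Longrightarrow> R v w" "ht (V - {v}) f"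
  shows "ht V f"
proof -
  have "ht {w \<in> V - {v}. \<not> R v w} (\<lambda>_. 0)"
    by (rule ht_isolated[of _ u]) (use assms sym in auto)
  from ht_vertex[OF assms(1,3,7) this] show ?thesis by simp
qed

lemma ht_dominated:
  assumes "finite F" "finite V" "u \<in> V" "u \<notin> F" "\<And>v. v \<in> F \<Longrightarrow> \<not> R u v"
    "\<And>v w. v \<in> F \<Longrightarrow> w \<in> V \<Longrightarrow> R u w \<Longrightarrow> R v w" "ht (V - F) f"
  shows "ht V f"
  using assms
proof (induction F arbitrary: V rule: finite_induct)
  case (insert v F)
  have eq: "V - {v} - F = V - insert v F" by auto
  have *: "ht (V - {v}) f"
  proof (rule insert.IH)
    show "ht (V - {v} - F) f" using insert.prems(6) eq by simp
  qed (use insert.prems(1-5) in simp_all)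
  show ?case
  proof (cases "v \<in> V")
    case True
    show ?thesis
      by (rule ht_dominated_vertex[OF insert.prems(1,2) True _ _ _ *]) (use insert.prems(3-5) in simp_all)
  qed (use * in simp)
qed simp

text \<open>Deleting \<open>u\<close> isolates \<open>w\<close> and leaves a cone, while the link of
  \<open>u\<close> is the complex on the remaining vertices; its homology enters shifted by
  one.\<close>

lemma ht_edge:
  assumes "finite V" "u \<in> V" "w \<in> V" "R u w" "\<And>x. x \<in> V \<Longrightarrow> x \<noteq> w \<Longrightarrow> \<not> R u x"
    "\<And>x. x \<in> V \<Longrightarrow> x \<noteq> u \<Longrightarrow> \<not> R w x" "ht (V - {u, w}) f"
  shows "ht V (\<lambda>i. f (i - 1))"
proof -
  have "u \<noteq> w" using assms irrefl by auto
  have "ht (V - {u}) (\<lambda>_. 0)"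
    by (rule ht_isolated[of _ w]) (use assms \<open>u \<noteq> w\<close> in auto)
  moreover have "{x \<in> V - {u}. \<not> R u x} = V - {u, w}" using assms by auto
  ultimately show ?thesis using ht_vertex[OF assms(1,2), of "\<lambda>_. 0" f] assms(7) by simp
qed

end

section \<open>The conflict graph of the polygon, its ladders and blocks\<close>

definition delta :: "int \<Rightarrow> int \<Rightarrow> nat" where
  "delta d i = (if i = d then 1 else 0)"

lemma (in conflict) ht_empty: "ht {} (delta (-1))"
  by (auto simp: ht_def homology_type_def delta_def)

text \<open>With \<open>m = n + 1\<close>, the pair \<open>(True, i)\<close> encodes the edge \<open>(i, i + 1)\<close> and \<open>(False, i)\<close> the edge \<open>(i + 1, i)\<close> of the
  polygon, see \<open>edge\<close> below. Two of these edges have a common source, have a common target or form a 2-cycle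
  iff they are in conflict.\<close>
definition adj :: "nat \<Rightarrow> nat \<Rightarrow> nat \<Rightarrow> bool" where
  "adj m i j \<longleftrightarrow> i = j \<or> Suc i = j \<or> Suc j = i \<or> (i = 0 \<and> Suc j = m) \<or> (j = 0 \<and> Suc i = m)"

definition conf :: "nat \<Rightarrow> bool \<times> nat \<Rightarrow> bool \<times> nat \<Rightarrow> bool" where
  "conf m x y \<longleftrightarrow> fst x \<noteq> fst y \<and> adj m (snd x) (snd y)"

interpretation conf: conflict "conf m" for m
  by unfold_locales (auto simp: conf_def adj_def)

text \<open>Conflicts join different directions only, so the conditions of \<open>ht_edge\<close> on
  neighbours become arithmetic on positions.\<close>

lemma conf_edge:
  assumes "conf.ht m (V - {(c, a), (\<not> c, b)}) f" "finite V" "(c, a) \<in> V" "(\<not> c, b) \<in> V" "adj m a b"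
    "\<And>i. (\<not> c, i) \<in> V \<Longrightarrow> adj m a i \<Longrightarrow> i = b" "\<And>i. (c, i) \<in> V \<Longrightarrow> adj m b i \<Longrightarrow> i = a"
  shows "conf.ht m V (\<lambda>i. f (i - 1))"
proof (rule conf.ht_edge[OF assms(2,3,4) _ _ _ assms(1)])
  fix x assume x: "x \<in> V" "x \<noteq> (\<not> c, b)"
  show "\<not> conf m (c, a) x"
  proof
    assume "conf m (c, a) x"
    then obtain i where "x = (\<not> c, i)" "adj m a i" by (cases x) (auto simp: conf_def)
    then show False using assms(6)[of i] x by simp
  qed
next
  fix x assume x: "x \<in> V" "x \<noteq> (c, a)"
  show "\<not> conf m (\<not> c, b) x"
  proof
    assume "conf m (\<not> c, b) x"
    then obtain i where "x = (c, i)" "adj m b i" by (cases x) (auto simp: conf_def)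
    then show False using assms(7)[of i] x by simp
  qed
qed (simp add: conf_def assms(5))

lemma conf_dominated:
  assumes "conf.ht m (V - {c} \<times> I) f" "finite V" "finite I" "(c, a) \<in> V" "a \<notin> I"
    "\<And>i j. i \<in> I \<Longrightarrow> (\<not> c, j) \<in> V \<Longrightarrow> adj m a j \<Longrightarrow> adj m i j"
  shows "conf.ht m V f"
proof (rule conf.ht_dominated[OF _ assms(2,4) _ _ _ assms(1)])
  fix v w assume v: "v \<in> {c} \<times> I" and w: "w \<in> V" "conf m (c, a) w"
  obtain i where "v = (c, i)" "i \<in> I" using v by auto
  moreover obtain j where "w = (\<not> c, j)" "adj m a j" using w(2) by (cases w) (auto simp: conf_def)
  ultimately show "conf m v w" using assms(6)[of i j] w(1) by (simp add: conf_def)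
qed (use assms in \<open>auto simp: conf_def\<close>)

lemma conf_isolated:
  assumes "finite V" "(c, a) \<in> V" "\<And>j. (\<not> c, j) \<in> V \<Longrightarrow> \<not> adj m a j"
  shows "conf.ht m V (\<lambda>_. 0)"
proof (rule conf.ht_isolated[OF assms(1,2)])
  fix w assume w: "w \<in> V"
  show "\<not> conf m (c, a) w"
  proof
    assume "conf m (c, a) w"
    then obtain i where "w = (\<not> c, i)" "adj m a i" by (cases w) (auto simp: conf_def)
    then show False using assms(3)[of i] w by simp
  qed
qed

lemma coloured_set_eqI:
  fixes A B :: "(bool \<times> nat) set"
  assumes "\<And>i. (c, i) \<in> A \<longleftrightarrow> (c, i) \<in> B" "\<And>i. (\<not> c, i) \<in> A \<longleftrightarrow> (\<not> c, i) \<in> B"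
  shows "A = B"
proof (rule Set.set_eqI)
  fix x :: "bool \<times> nat"
  obtain d :: bool and i where x: "x = (d, i)" by (cases x)
  have "d = c \<or> d = (\<not> c)" by auto
  then show "x \<in> A \<longleftrightarrow> x \<in> B" using assms x by auto
qed

text \<open>The shape of a link: a vertex \<open>(c, 0)\<close> excludes the positions 0, 1 and
  \<open>m - 1\<close> of the other direction, which therefore starts one position later than
  direction \<open>c\<close>. The two upper ends are kept independent because two kinds of ladder
  occur.\<close>

definition ladder :: "bool \<Rightarrow> nat \<Rightarrow> nat \<Rightarrow> nat \<Rightarrow> (bool \<times> nat) set" where
  "ladder c s e e' = {x. if fst x = c then s \<le> snd x \<and> snd x \<le> e else s < snd x \<and> snd x \<le> e'}"

definition block :: "nat \<Rightarrow> nat \<Rightarrow> (bool \<times> nat) set" where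
  "block p s = {x. s \<le> snd x \<and> snd x < s + p}"

lemma finite_ladder [simp]: "finite (ladder c s e e')"
proof (rule finite_subset)
  show "ladder c s e e' \<subseteq> UNIV \<times> {..max e e'}" by (auto simp: ladder_def split: if_splits)
qed auto

lemma finite_block [simp]: "finite (block p s)"
proof (rule finite_subset)
  show "block p s \<subseteq> UNIV \<times> {..s + p}" by (auto simp: block_def)
qed auto

lemma ladder_iff [simp]:
  "(d, i) \<in> ladder c s e e' \<longleftrightarrow> (if d = c then s \<le> i \<and> i \<le> e else s < i \<and> i \<le> e')"
  by (simp add: ladder_def)

lemma block_iff [simp]: "(d, i) \<in> block p s \<longleftrightarrow> s \<le> i \<and> i < s + p"
  by (simp add: block_def)

text \<open>In each direction position \<open>s\<close> dominates position \<open>s + 1\<close>;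
  after that the two vertices at \<open>s\<close> form an isolated edge. So two positions are used
  up per suspension. The bound \<open>1 \<le> s\<close> keeps the block away from the wrap-around at
  0.\<close>

lemma block_type:
  "1 \<le> s \<Longrightarrow> conf.ht m (block p s) (delta (int ((p + 1) div 2) - 1))"
proof (induction p arbitrary: s rule: less_induct)
  case (less p)
  consider "p = 0" | "p = 1" | "p \<ge> 2" by linarith
  then show ?case
  proof cases
    case 1
    then have "block p s = {}" by (auto simp: block_def)
    then show ?thesis using 1 conf.ht_empty[of m] by simp
  next
    case 2
    have "block p s - {(True, s), (\<not> True, s)} = {}" using 2 by (auto simp: block_def)
    then have "conf.ht m (block p s - {(True, s), (\<not> True, s)}) (delta (-1))"
      by (simp only: conf.ht_empty)
    then have "conf.ht m (block p s) (\<lambda>i. delta (-1) (i - 1))"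
      by (rule conf_edge) (use 2 less.prems in \<open>auto simp: adj_def\<close>)
    then show ?thesis using 2 by (simp add: delta_def)
  next
    case 3
    let ?V1 = "block p s - {True} \<times> {s + 1}" and ?V2 = "block p s - {True} \<times> {s + 1} - {False} \<times> {s + 1}"
    have "conf.ht m (block (p - 2) (s + 2)) (delta (int ((p - 2 + 1) div 2) - 1))"
      using less 3 by auto
    moreover have "?V2 - {(True, s), (\<not> True, s)} = block (p - 2) (s + 2)"
      using 3 by (auto simp: block_def)
    ultimately have "conf.ht m (?V2 - {(True, s), (\<not> True, s)}) (delta (int ((p - 2 + 1) div 2) - 1))" by simp
    then have "conf.ht m ?V2 (\<lambda>i. delta (int ((p - 2 + 1) div 2) - 1) (i - 1))"
      by (rule conf_edge)
        (use 3 less.prems in \<open>auto simp: adj_def\<close>)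
    then have "conf.ht m ?V1 (\<lambda>i. delta (int ((p - 2 + 1) div 2) - 1) (i - 1))"
      by (rule conf_dominated[where a = s])
        (use 3 less.prems in \<open>auto simp: adj_def\<close>)
    then have "conf.ht m (block p s) (\<lambda>i. delta (int ((p - 2 + 1) div 2) - 1) (i - 1))"
      by (rule conf_dominated[where a = s])
        (use 3 less.prems in \<open>auto simp: adj_def\<close>)
    moreover have "(p + 1) div 2 = (p - 2 + 1) div 2 + 1" using 3 by simp
    ultimately show ?thesis by (simp add: delta_def algebra_simps)
  qed
qed

text \<open>The end vertex \<open>(c, s)\<close> conflicts only with
  \<open>(\<not> c, s + 1)\<close>. It dominates positions \<open>s + 1\<close> and
  \<open>s + 2\<close> of its direction and then splits off with its partner as an isolated edge.
  Now \<open>(\<not> c, s + 2)\<close> is in the same situation with the directions exchanged, so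
  four positions give two suspensions.\<close>

lemma ladder_peel:
  assumes "1 \<le> s" "s + 4 \<le> e" "s + 3 \<le> e'" and f: "conf.ht m (ladder c (s + 4) e e') f"
  shows "conf.ht m (ladder c s e e') (\<lambda>i. f (i - 2))"
proof -
  let ?V1 = "ladder c s e e' - {c} \<times> {s + 1, s + 2}"
  let ?V2 = "?V1 - {(c, s), (\<not> c, s + 1)}"
  let ?V3 = "?V2 - {\<not> c} \<times> {s + 3, s + 4}"
  have "?V3 - {(\<not> c, s + 2), (\<not> \<not> c, s + 3)} = ladder c (s + 4) e e'"
    by (rule coloured_set_eqI[of c]) (use assms(1-3) in auto)
  then have "conf.ht m (?V3 - {(\<not> c, s + 2), (\<not> \<not> c, s + 3)}) f" using f by (simp only:)
  then have "conf.ht m ?V3 (\<lambda>i. f (i - 1))"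
    by (rule conf_edge) (use assms(1-3) in \<open>auto simp: adj_def\<close>)
  then have "conf.ht m ?V2 (\<lambda>i. f (i - 1))"
    by (rule conf_dominated[where a = "s + 2"])
      (use assms(1-3) in \<open>auto simp: adj_def\<close>)
  then have "conf.ht m ?V1 (\<lambda>i. f (i - 1 - 1))"
    by (rule conf_edge) (use assms(1-3) in \<open>auto simp: adj_def\<close>)
  then have "conf.ht m (ladder c s e e') (\<lambda>i. f (i - 1 - 1))"
    by (rule conf_dominated[where a = s])
      (use assms(1-3) in \<open>auto simp: adj_def\<close>)
  then show ?thesis by (simp add: algebra_simps)
qed

text \<open>Read off from the cases \<open>q \<le> 3\<close>: a cone for \<open>q \<le> 1\<close>,
  one isolated edge for \<open>q = 2\<close>, two for \<open>q = 3\<close>. Each peeling adds 4 to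
  \<open>q\<close> and 2 to the degree.\<close>

definition ladder_rank :: "nat \<Rightarrow> int \<Rightarrow> nat" where
  "ladder_rank q = (if q mod 4 = 2 then delta (int (q div 2) - 1) else if q mod 4 = 3 then delta (int (q div 2)) else (\<lambda>_. 0))"

lemma ladder_type:
  "1 \<le> s \<Longrightarrow> conf.ht m (ladder c s (s + q) (s + q - 1)) (ladder_rank q)"
proof (induction q arbitrary: s rule: less_induct)
  case (less q)
  let ?L = "ladder c s (s + q) (s + q - 1)"
  consider "q \<le> 1" | "q = 2" | "q = 3" | "q \<ge> 4" by linarith
  then show ?case
  proof cases
    case 1
    then have "ladder_rank q = (\<lambda>_. 0)" by (auto simp: ladder_rank_def)
    moreover have "conf.ht m ?L (\<lambda>_. 0)"
      by (rule conf_isolated[where c = c and a = s])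
        (use 1 less.prems in \<open>auto simp: adj_def\<close>)
    ultimately show ?thesis by simp
  next
    case 2
    let ?V1 = "?L - {c} \<times> {s + 1, s + 2}"
    have "?V1 - {(c, s), (\<not> c, s + 1)} = {}"
      using 2 by (intro coloured_set_eqI[of c]) auto
    then have V1: "conf.ht m (?V1 - {(c, s), (\<not> c, s + 1)}) (delta (-1))" by (simp only: conf.ht_empty)
    have "conf.ht m ?V1 (\<lambda>i. delta (-1) (i - 1))"
      by (rule conf_edge[OF V1])
        (use 2 less.prems in \<open>auto simp: adj_def\<close>)
    then have "conf.ht m ?L (\<lambda>i. delta (-1) (i - 1))"
      by (rule conf_dominated[where a = s])
        (use 2 less.prems in \<open>auto simp: adj_def\<close>)
    then show ?thesis using 2 by (simp add: ladder_rank_def delta_def)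
  next
    case 3
    let ?V1 = "?L - {c} \<times> {s + 1, s + 2}"
    let ?V2 = "?V1 - {(c, s), (\<not> c, s + 1)}"
    have "?V2 - {(c, s + 3), (\<not> c, s + 2)} = {}"
      using 3 by (intro coloured_set_eqI[of c]) auto
    then have V2: "conf.ht m (?V2 - {(c, s + 3), (\<not> c, s + 2)}) (delta (-1))" by (simp only: conf.ht_empty)
    have "conf.ht m ?V2 (\<lambda>i. delta (-1) (i - 1))"
      by (rule conf_edge[OF V2])
        (use 3 less.prems in \<open>auto simp: adj_def\<close>)
    then have "conf.ht m ?V1 (\<lambda>i. delta (-1) (i - 1 - 1))"
      by (rule conf_edge)
        (use 3 less.prems in \<open>auto simp: adj_def\<close>)
    then have "conf.ht m ?L (\<lambda>i. delta (-1) (i - 1 - 1))"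
      by (rule conf_dominated[where a = s])
        (use 3 less.prems in \<open>auto simp: adj_def\<close>)
    then show ?thesis using 3 by (simp add: ladder_rank_def delta_def)
  next
    case 4
    have "conf.ht m (ladder c (s + 4) (s + 4 + (q - 4)) (s + 4 + (q - 4) - 1)) (ladder_rank (q - 4))"
      by (rule less.IH) (use 4 in auto)
    then have "conf.ht m (ladder c (s + 4) (s + q) (s + q - 1)) (ladder_rank (q - 4))" using 4 by simp
    from ladder_peel[OF less.prems _ _ this] have "conf.ht m ?L (\<lambda>i. ladder_rank (q - 4) (i - 2))"
      using 4 by simp
    moreover have "(\<lambda>i. ladder_rank (q - 4) (i - 2)) = ladder_rank q"
    proof -
      obtain r where "q = r + 4" using 4 by (metis le_Suc_ex add.commute)
      then show ?thesis by (auto simp: ladder_rank_def delta_def fun_eq_iff)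
    qed
    ultimately show ?thesis by simp
  qed
qed

text \<open>The variant whose other direction is not shortened at the far end, which is the link of
  \<open>(True, 1)\<close> once \<open>(True, 0)\<close> is gone. Peeling stops at
  \<open>q = 2\<close>, where removing the dominated vertices isolates
  \<open>(\<not> c, s + 2)\<close>.\<close>

lemma ladder_full_type:
  "1 \<le> s \<Longrightarrow> q mod 4 = 2 \<Longrightarrow> conf.ht m (ladder c s (s + q) (s + q)) (\<lambda>_. 0)"
proof (induction q arbitrary: s rule: less_induct)
  case (less q)
  let ?L = "ladder c s (s + q) (s + q)"
  have "q = 2 \<or> q \<ge> 4" using less.prems by presburger
  then show ?case
  proof
    assume q: "q = 2"
    let ?V1 = "?L - {c} \<times> {s + 1, s + 2}"
    have "conf.ht m ?V1 (\<lambda>_. 0)"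
      by (rule conf_isolated[where c = "\<not> c" and a = "s + 2"])
        (use q less.prems in \<open>auto simp: adj_def\<close>)
    then show "conf.ht m ?L (\<lambda>_. 0)"
      by (rule conf_dominated[where a = s])
        (use q less.prems in \<open>auto simp: adj_def\<close>)
  next
    assume q: "4 \<le> q"
    then have "(q - 4) mod 4 = 2" using less.prems(2) by (simp add: le_mod_geq)
    have "conf.ht m (ladder c (s + 4) (s + 4 + (q - 4)) (s + 4 + (q - 4))) (\<lambda>_. 0)"
    proof (rule less.IH)
      show "(q - 4) mod 4 = 2" by fact
    qed (use q in simp_all)
    then have "conf.ht m (ladder c (s + 4) (s + q) (s + q)) (\<lambda>_. 0)" using q by simp
    from ladder_peel[OF less.prems(1) _ _ this] show "conf.ht m ?L (\<lambda>_. 0)"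
      using q by simp
  qed
qed

section \<open>The whole conflict graph around the polygon\<close>

definition circ :: "nat \<Rightarrow> (bool \<times> nat) set" where
  "circ m = {x. snd x < m}"

lemma finite_circ [simp]: "finite (circ m)"
proof (rule finite_subset)
  show "circ m \<subseteq> UNIV \<times> {..<m}" by (auto simp: circ_def)
qed auto

lemma circ_iff [simp]: "(c, i) \<in> circ m \<longleftrightarrow> i < m"
  by (simp add: circ_def)

text \<open>The two vertices at position 0 conflict, so deleting \<open>(True, 0)\<close> does not
  affect the link of \<open>(False, 0)\<close>, and the two links are mirror images.\<close>

lemma circ_links:
  assumes "m \<ge> 3"
  shows "{w \<in> circ m - {(True, 0)}. \<not> conf m (True, 0) w} = ladder True 1 (1 + (m - 2)) (1 + (m - 2) - 1)"
    "{w \<in> circ m - {(True, 0)} - {(False, 0)}. \<not> conf m (False, 0) w} = ladder False 1 (1 + (m - 2)) (1 + (m - 2) - 1)"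
    "circ m - {(True, 0)} - {(False, 0)} = block (m - 1) 1"
  using assms by (auto intro!: coloured_set_eqI[of True] simp: conf_def adj_def)

lemma circ_link_types:
  assumes "m \<ge> 3"
  shows "conf.ht m {w \<in> circ m - {(True, 0)}. \<not> conf m (True, 0) w} (ladder_rank (m - 2))"
    "conf.ht m {w \<in> circ m - {(True, 0)} - {(False, 0)}. \<not> conf m (False, 0) w} (ladder_rank (m - 2))"
    "conf.ht m (circ m - {(True, 0)} - {(False, 0)}) (delta (int (m div 2) - 1))"
proof -
  have L: "conf.ht m (ladder c 1 (1 + (m - 2)) (1 + (m - 2) - 1)) (ladder_rank (m - 2))" for c
    by (rule ladder_type) simp
  show "conf.ht m {w \<in> circ m - {(True, 0)}. \<not> conf m (True, 0) w} (ladder_rank (m - 2))"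
    unfolding circ_links(1)[OF assms] by (rule L)
  show "conf.ht m {w \<in> circ m - {(True, 0)} - {(False, 0)}. \<not> conf m (False, 0) w} (ladder_rank (m - 2))"
    unfolding circ_links(2)[OF assms] by (rule L)
  have "(m - 1 + 1) div 2 = m div 2" using assms by simp
  then show "conf.ht m (circ m - {(True, 0)} - {(False, 0)}) (delta (int (m div 2) - 1))"
    unfolding circ_links(3)[OF assms] using block_type[of 1 m "m - 1"] by simp
qed

text \<open>The factor 3 counts one class of the block and one from each of the two links, raised by
  one degree into that of the block.\<close>

definition circ_rank :: "nat \<Rightarrow> int \<Rightarrow> nat" where
  "circ_rank m i = (if m mod 4 = 1 then delta (int (m div 2)) i
     else (if m mod 4 = 0 then 3 else 1) * delta (int (m div 2) - 1) i)"

lemma mod4_eq_1E: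
  fixes m :: nat
  assumes "m mod 4 = 1" "m \<ge> 5"
  obtains j where "m = 4 * j + 5"
proof -
  have "m = 4 * (m div 4) + 1" using mult_div_mod_eq[of 4 m] assms by simp
  moreover have "m div 4 \<noteq> 0" using assms by auto
  ultimately show ?thesis using that[of "m div 4 - 1"] by (cases "m div 4") auto
qed

lemma ladder_rank_circ:
  assumes "m \<ge> 3"
  shows "ladder_rank (m - 2) =
    (if m mod 4 = 0 then delta (int (m div 2) - 2)
     else if m mod 4 = 1 then delta (int (m div 2) - 1) else (\<lambda>_. 0))"
proof -
  define k where "k = m div 4"
  have mk: "m = 4 * k + m mod 4" unfolding k_def by simp
  have "m mod 4 < 4" by simp
  then consider "m mod 4 = 0" | "m mod 4 = 1" | "m mod 4 = 2" | "m mod 4 = 3" by linarith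
  then show ?thesis
  proof cases
    case 1
    then obtain j where "m = 4 * j + 4" using mk assms by (cases k) auto
    then show ?thesis using mod_mult_self4[of 4 j 2] by (simp add: ladder_rank_def)
  next
    case 2
    then obtain j where "m = 4 * j + 5" using mk assms by (cases k) auto
    moreover have "(3 + 4 * j) div 2 = 2 * j + 1" "(4 * j + 5) div 2 = 2 * j + 2" by linarith+
    ultimately show ?thesis by (simp add: ladder_rank_def)
  next
    case 3
    then have "m = 4 * k + 2" using mk by simp
    then show ?thesis using mod_mult_self4[of 4 k 2] by (simp add: ladder_rank_def)
  next
    case 4
    then have m3: "m = 4 * k + 3" using mk by simp
    have "(4 * k + 1) mod 4 = 1" by simp
    then show ?thesis using m3 mod_mult_self4[of 4 k 3] by (simp add: ladder_rank_def)
  qed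
qed

text \<open>For \<open>m \<equiv> 1\<close> modulo 4 the long exact sequences of the two deletions leading from \<open>circ\<close> to \<open>block\<close> have nonzero
  connecting maps. Deleting \<open>(True, 1)\<close> as the second vertex instead avoids computing them.\<close>
lemma circ_minus_one_acyclic:
  assumes m: "m mod 4 = 1" "m \<ge> 5"
  shows "conf.ht m (circ m - {(True, 0)}) (\<lambda>_. 0)"
proof -
  obtain j where j: "m = 4 * j + 5" using mod4_eq_1E[OF m] .
  let ?V = "circ m - {(True, 0)}"
  let ?W = "?V - {(True, 1)}"
  \<comment> \<open>With \<open>(True, 0)\<close> and \<open>(True, 1)\<close> gone,
    \<open>(False, 1)\<close> conflicts only with \<open>(True, 2)\<close> and
    \<open>(False, 0)\<close> only with \<open>(True, m - 1)\<close>. Both pairs split off after the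
    dominated vertices are removed, and the ladder that remains has length parameter
    \<open>m - 5\<close>, a multiple of 4, so it is acyclic.\<close>
  let ?W1 = "?W - {False} \<times> {2, 3}"
  let ?W2 = "?W1 - {False} \<times> {m - 1, m - 2}"
  let ?W3 = "?W2 - {(False, 0), (\<not> False, m - 1)}"
  have fin: "finite ?V" "finite ?W" "finite ?W1" "finite ?W2" "finite ?W3"
    using finite_circ by auto
  have "?W3 - {(False, 1), (\<not> False, 2)} = ladder True 3 (3 + (m - 5)) (3 + (m - 5) - 1)"
    by (rule coloured_set_eqI[of True]) (use m in auto)
  moreover have "ladder_rank (m - 5) = (\<lambda>_. 0)"
  proof -
    have "(m - 5) mod 4 = 0" using j by simp
    then show ?thesis by (simp add: ladder_rank_def)
  qed
  ultimately have "conf.ht m (?W3 - {(False, 1), (\<not> False, 2)}) (\<lambda>_. 0)"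
    using ladder_type[of 3 m True "m - 5"] by simp
  then have "conf.ht m ?W3 (\<lambda>_. 0)"
    by (rule conf_edge)
      (use m fin in \<open>auto simp: adj_def\<close>)
  then have "conf.ht m ?W2 (\<lambda>_. 0)"
    by (rule conf_edge)
      (use m fin in \<open>auto simp: adj_def\<close>)
  then have "conf.ht m ?W1 (\<lambda>_. 0)"
    by (rule conf_dominated[where a = 0])
      (use m fin in \<open>auto simp: adj_def\<close>)
  then have W: "conf.ht m ?W (\<lambda>_. 0)"
    by (rule conf_dominated[where a = 1])
      (use m fin in \<open>auto simp: adj_def\<close>)
  have "{w \<in> ?W. \<not> conf m (True, 1) w} = ladder True 2 (2 + (m - 3)) (2 + (m - 3))"
    by (rule coloured_set_eqI[of True]) (use m in \<open>auto simp: conf_def adj_def\<close>)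
  moreover have "(m - 3) mod 4 = 2" using j mod_mult_self4[of 4 j 2] by simp
  ultimately have L: "conf.ht m {w \<in> ?W. \<not> conf m (True, 1) w} (\<lambda>_. 0)"
    using ladder_full_type[of 2 "m - 3" m True] by simp
  have "(True, 1) \<in> ?V" using m by (simp add: circ_def)
  from conf.ht_vertex[OF fin(1) this W L] show ?thesis by simp
qed

lemma circ_type:
  assumes "m \<ge> 3"
  shows "conf.ht m (circ m) (circ_rank m)"
proof -
  note T = circ_link_types[OF assms]
  note lr = ladder_rank_circ[OF assms]
  have in0: "(True, 0) \<in> circ m" "(False, 0) \<in> circ m - {(True, 0)}" using assms by auto
  have fin: "finite (circ m - {(True, 0)})" by simp
  show ?thesis
  proof (cases "m mod 4 = 1")
    case True
    have "m \<noteq> 3" "m \<noteq> 4" using True by auto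
    then have "m \<ge> 5" using assms by linarith
    have "(\<lambda>i. ladder_rank (m - 2) (i - 1)) = circ_rank m"
      using True by (auto simp: lr circ_rank_def delta_def fun_eq_iff)
    with conf.ht_vertex[OF finite_circ in0(1) circ_minus_one_acyclic[OF True \<open>m \<ge> 5\<close>] T(1)]
    show ?thesis by simp
  next
    case False
    \<comment> \<open>Outside residue 1 the links are acyclic or, for residue 0, have their class
      one degree below that of the block, so no connecting map can be nonzero.\<close>
    have disj: "delta (int (m div 2) - 1) i = 0 \<or> ladder_rank (m - 2) i = 0" for i
      using False by (simp add: lr delta_def)
    have disj': "delta (int (m div 2) - 1) i + ladder_rank (m - 2) (i - 1) = 0 \<or> ladder_rank (m - 2) i = 0" for i
      using False by (auto simp: lr delta_def)
    note V1 = conf.ht_vertex[OF fin in0(2) T(3) T(2) disj]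
    note V = conf.ht_vertex[OF finite_circ in0(1) V1 T(1) disj']
    have "(\<lambda>i. delta (int (m div 2) - 1) i + ladder_rank (m - 2) (i - 1) + ladder_rank (m - 2) (i - 1)) = circ_rank m"
      using False by (auto simp: lr delta_def circ_rank_def fun_eq_iff)
    with V show ?thesis by simp
  qed
qed

section \<open>Removing facets and relabelling vertices\<close>

definition boundary :: "'v set \<Rightarrow> 'v set set" where
  "boundary s = {t. t \<noteq> {} \<and> t \<subset> s}"

text \<open>Deleting a vertex \<open>v\<close> leaves a full simplex, and the link of
  \<open>v\<close> is the boundary of that simplex. The induction starts with the empty boundary of
  a point, in degree -1.\<close>

lemma homology_type_boundary:
  "finite s \<Longrightarrow> s \<noteq> {} \<Longrightarrow> homology_type (boundary s) (delta (int (card s) - 2))"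
proof (induction "card s" arbitrary: s)
  case 0
  then show ?case by simp
next
  case (Suc n)
  obtain v where v: "v \<in> s" using Suc.prems by auto
  show ?case
  proof (cases "s = {v}")
    case True
    then have "boundary s = {}" by (auto simp: boundary_def)
    then show ?thesis using True by (auto simp: homology_type_def delta_def)
  next
    case False
    define s' where "s' = s - {v}"
    have s': "s' \<noteq> {}" "finite s'" "card s' = n" "s = insert v s'" "v \<notin> s'"
      using False v Suc by (auto simp: s'_def)
    have "finite (\<Union>(boundary s))"
      by (rule finite_subset[of _ s]) (use Suc.prems in \<open>auto simp: boundary_def\<close>)
    then have cpx: "simplicial_complex (boundary s)"
      by (auto simp: simplicial_complex_def boundary_def)
    have f: "face (boundary s) {v}"
      using cpx s' by (auto simp: face_def boundary_def)
    have del: "face.del (boundary s) {v} = {t. t \<noteq> {} \<and> t \<subseteq> s'}"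
      unfolding face.del_def[OF f] using s' by (auto simp: boundary_def)
    have lnk: "face.lnk (boundary s) {v} = boundary s'"
      unfolding face.lnk_def[OF f] del using s' by (auto simp: boundary_def)
    obtain w where "w \<in> s'" using s' by auto
    then have "homology_type {t. t \<noteq> {} \<and> t \<subseteq> s'} (\<lambda>_. 0)"
      using face.complex_del[OF f] unfolding del
      by (intro homology_type_cone[of _ w]) auto
    moreover have "homology_type (boundary s') (delta (int (card s') - 2))"
      using Suc.hyps(1)[of s'] s' by simp
    ultimately have "homology_type (boundary s) (\<lambda>i. 0 + delta (int (card s') - 2) (i - 1))"
      using face.homology_type_add_face[OF f, of "\<lambda>_. 0"] by (simp add: del lnk)
    moreover have "card s = card s' + 1" using s' by simp
    then have "(\<lambda>i. 0 + delta (int (card s') - 2) (i - 1)) = delta (int (card s) - 2)"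
      by (auto simp: delta_def fun_eq_iff)
    ultimately show ?thesis by simp
  qed
qed

text \<open>By maximality only \<open>s\<close> disappears, and \<open>lnk\<close> is its whole
  boundary sphere. As \<open>K\<close> has no homology in degree \<open>card s - 1\<close>, this
  sphere survives as a new class.\<close>

lemma homology_type_remove_facet:
  assumes K: "simplicial_complex K" and s: "s \<in> K" "\<And>t. t \<in> K \<Longrightarrow> s \<subseteq> t \<Longrightarrow> t = s" "K \<noteq> {s}"
    and f: "homology_type K f" "f (int (card s) - 1) = 0"
  shows "homology_type (K - {s}) (\<lambda>i. f i + delta (int (card s) - 2) i)"
proof -
  have F: "face K s" using K s by (simp add: face_def)
  have del: "face.del K s = K - {s}" unfolding face.del_def[OF F] using s by auto
  have lnk: "face.lnk K s = boundary s"
  proof (intro equalityI subsetI)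
    fix t assume "t \<in> face.lnk K s"
    then have t: "t \<in> K" "\<not> s \<subseteq> t" "t \<union> s \<in> K" unfolding face.lnk_def[OF F] face.del_def[OF F] by auto
    then have "t \<union> s = s" using s by auto
    then show "t \<in> boundary s"
      using t simplicial_complexD(5)[OF K] by (auto simp: boundary_def)
  next
    fix t assume "t \<in> boundary s"
    then have t: "t \<noteq> {}" "t \<subset> s" by (auto simp: boundary_def)
    then have "t \<in> K" using simplicial_complexD(3)[OF K s(1)] by auto
    moreover have "t \<union> s = s" using t by auto
    ultimately show "t \<in> face.lnk K s"
      unfolding face.lnk_def[OF F] face.del_def[OF F] using t s by auto
  qed
  have "homology_type (boundary s) (delta (int (card s) - 2))"
    using simplicial_complexD(4,5)[OF K s(1)] by (intro homology_type_boundary)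
  moreover have "f i = 0 \<or> delta (int (card s) - 2) (i - 1) = 0" for i
    using f(2) by (cases "i = int (card s) - 1") (auto simp: delta_def)
  moreover have "K - {s} \<noteq> {}" using s(1,3) by auto
  ultimately show ?thesis
    using face.homology_type_remove_face[OF F f(1), of "delta (int (card s) - 2)"]
    unfolding del lnk by simp
qed

definition full_cycle :: "bool \<Rightarrow> nat \<Rightarrow> (bool \<times> nat) set" where
  "full_cycle c m = {c} \<times> {..<m}"

definition circ_complex :: "nat \<Rightarrow> (bool \<times> nat) set set" where
  "circ_complex m = indep (conf m) (circ m) - {full_cycle True m} - {full_cycle False m}"

text \<open>Any further vertex would have the other direction and conflict with the vertex of the
  cycle at its own position.\<close>

lemma full_cycle_facet:
  assumes "m \<ge> 1"
  shows "full_cycle c m \<in> indep (conf m) (circ m)"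
    "t \<in> indep (conf m) (circ m) \<Longrightarrow> full_cycle c m \<subseteq> t \<Longrightarrow> t = full_cycle c m"
proof -
  have "(c, 0) \<in> full_cycle c m" using assms by (simp add: full_cycle_def)
  then show "full_cycle c m \<in> indep (conf m) (circ m)"
    unfolding indep_def by (auto simp: full_cycle_def conf_def)
  assume t: "t \<in> indep (conf m) (circ m)" and sub: "full_cycle c m \<subseteq> t"
  have "x \<in> full_cycle c m" if "x \<in> t" for x
  proof (rule ccontr)
    assume n: "x \<notin> full_cycle c m"
    obtain d i where x: "x = (d, i)" by (cases x)
    have "i < m" using t that x by (auto simp: indep_def)
    moreover from this have "d = (\<not> c)" using n x by (auto simp: full_cycle_def)
    moreover have "(c, i) \<in> t" using sub \<open>i < m\<close> by (auto simp: full_cycle_def)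
    ultimately have "conf m x (c, i)" using x by (simp add: conf_def adj_def)
    moreover have "\<not> conf m x (c, i)" using t that \<open>(c, i) \<in> t\<close> by (simp add: indep_def)
    ultimately show False by simp
  qed
  then show "t = full_cycle c m" using sub by auto
qed

lemma simplicial_complex_circ: "simplicial_complex (indep (conf m) (circ m))"
  by (rule conf.simplicial_complex_indep) simp

lemma simplicial_complex_remove_facet:
  assumes "simplicial_complex K" "\<And>t. t \<in> K \<Longrightarrow> s \<subseteq> t \<Longrightarrow> t = s"
  shows "simplicial_complex (K - {s})"
  unfolding simplicial_complex_def
proof (intro conjI ballI allI impI)
  show "finite (\<Union>(K - {s}))"
    by (rule finite_subset[OF _ simplicial_complexD(1)[OF assms(1)]]) auto
  show "{} \<notin> K - {s}" using simplicial_complexD(2)[OF assms(1)] by auto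
  fix t u assume "t \<in> K - {s}" "u \<subseteq> t" "u \<noteq> {}"
  then show "u \<in> K - {s}" using assms(2)[of t] simplicial_complexD(3)[OF assms(1), of t u] by auto
qed

lemma simplicial_complex_circ_complex:
  assumes "m \<ge> 1"
  shows "simplicial_complex (indep (conf m) (circ m) - {full_cycle True m})"
    "simplicial_complex (circ_complex m)"
proof -
  show *: "simplicial_complex (indep (conf m) (circ m) - {full_cycle True m})"
    by (rule simplicial_complex_remove_facet[OF simplicial_complex_circ])
      (rule full_cycle_facet(2)[OF assms])
  show "simplicial_complex (circ_complex m)"
    unfolding circ_complex_def
    by (rule simplicial_complex_remove_facet[OF *]) (use full_cycle_facet(2)[OF assms, of _ False] in simp)
qed

lemma circ_complex_type:
  assumes "m \<ge> 3"
  shows "homology_type (circ_complex m) (\<lambda>i. circ_rank m i + delta (int m - 2) i + delta (int m - 2) i)"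
proof -
  have m1: "m \<ge> 1" using assms by simp
  let ?I = "indep (conf m) (circ m)"
  have card: "card (full_cycle c m) = m" for c by (simp add: full_cycle_def)
  have "(True, 0) \<in> full_cycle True m" "(True, 0) \<notin> full_cycle False m"
    using m1 by (simp_all add: full_cycle_def)
  then have ne: "full_cycle True m \<noteq> full_cycle False m" by metis
  have pt: "{(True, 0)} \<in> ?I" "{(True, 0)} \<noteq> full_cycle c m" for c
  proof -
    show "{(True, 0)} \<in> ?I" using m1 by (auto simp: indep_def conf_def)
    show "{(True, 0)} \<noteq> full_cycle c m"
    proof
      assume "{(True, 0)} = full_cycle c m"
      moreover have "(c, 1) \<in> full_cycle c m" using assms by (simp add: full_cycle_def)
      ultimately show False by auto
    qed
  qed
  \<comment> \<open>The cycles have dimension \<open>m - 1\<close>, whereas \<open>circ_rank\<close>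
    lives in degrees up to \<open>m div 2\<close>, which is smaller. Removing the first cycle adds
    only a class in degree \<open>m - 2\<close>, so the second removal is equally harmless.\<close>
  have z: "circ_rank m (int m - 1) = 0" using assms by (auto simp: circ_rank_def delta_def)
  have I: "homology_type ?I (circ_rank m)" using circ_type[OF assms] by (simp add: conf.ht_def)
  have "homology_type (?I - {full_cycle True m}) (\<lambda>i. circ_rank m i + delta (int (card (full_cycle True m)) - 2) i)"
    by (rule homology_type_remove_facet[OF simplicial_complex_circ full_cycle_facet[OF m1] _ I])
      (use pt z card ne in auto)
  then have 1: "homology_type (?I - {full_cycle True m}) (\<lambda>i. circ_rank m i + delta (int m - 2) i)"
    by (simp add: card)
  define f where "f i = circ_rank m i + delta (int m - 2) i" for i
  have f: "homology_type (?I - {full_cycle True m}) f" using 1 by (simp add: f_def[abs_def])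
  have mem: "full_cycle False m \<in> ?I - {full_cycle True m}"
    using full_cycle_facet(1)[OF m1, of False] ne by simp
  have max: "t = full_cycle False m" if "t \<in> ?I - {full_cycle True m}" "full_cycle False m \<subseteq> t" for t
    using full_cycle_facet(2)[OF m1, of t False] that by simp
  have "{(True, 0)} \<in> ?I - {full_cycle True m}" using pt by simp
  then have ne2: "?I - {full_cycle True m} \<noteq> {full_cycle False m}" using pt(2)[of False] by (metis singletonD)
  have z2: "f (int (card (full_cycle False m)) - 1) = 0"
    using z by (simp add: card delta_def f_def)
  have "homology_type (?I - {full_cycle True m} - {full_cycle False m})
      (\<lambda>i. f i + delta (int (card (full_cycle False m)) - 2) i)"
    by (rule homology_type_remove_facet[OF simplicial_complex_circ_complex(1)[OF m1] mem max ne2 f z2])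
  then show ?thesis by (simp add: card circ_complex_def f_def)
qed

section \<open>Maps of realizations induced by simplicial maps\<close>

lemma realized_support: "x \<in> realized K \<Longrightarrow> x v \<noteq> 0 \<Longrightarrow> v \<in> \<Union>K"
  unfolding realized_def by (rule UnionI[of "{v. x v \<noteq> 0}"]) auto

definition push :: "'v set \<Rightarrow> ('v \<Rightarrow> 'w) \<Rightarrow> ('v \<Rightarrow> real) \<Rightarrow> 'w \<Rightarrow> real" where
  "push V \<phi> x w = (\<Sum>v\<in>{v \<in> V. \<phi> v = w}. x v)"

lemma continuous_push: "continuous_on S (push V \<phi>)"
  unfolding push_def[abs_def]
  by (intro continuous_on_coordinatewise_then_product continuous_on_sum continuous_on_coordinate)

text \<open>Nonnegative weights cannot cancel, so the support of the image is the image of the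
  support.\<close>

lemma push_in:
  assumes K: "simplicial_complex K" and L: "simplicial_complex L" and \<phi>: "\<And>t. t \<in> K \<Longrightarrow> \<phi> ` t \<in> L"
    and x: "x \<in> realized K"
  shows "push (\<Union>K) \<phi> x \<in> realized L"
proof -
  note fin = simplicial_complexD(1)[OF K] simplicial_complexD(1)[OF L]
  have x': "\<And>v. 0 \<le> x v" "{v. x v \<noteq> 0} \<in> K" "sum x (\<Union>K) = 1"
    using x fin by (auto simp: realized_iff[of "\<Union>K" K])
  let ?y = "push (\<Union>K) \<phi> x"
  have nn: "0 \<le> ?y w" for w unfolding push_def by (intro sum_nonneg x')
  have y_iff: "?y w \<noteq> 0 \<longleftrightarrow> (\<exists>v\<in>\<Union>K. \<phi> v = w \<and> x v \<noteq> 0)" for w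
  proof -
    have "finite {v \<in> \<Union>K. \<phi> v = w}" by (rule finite_subset[OF _ fin(1)]) auto
    then show ?thesis
      unfolding push_def using x'(1) by (subst sum_nonneg_eq_0_iff) auto
  qed
  have vK: "v \<in> \<Union>K" if "x v \<noteq> 0" for v
    using that x'(2) by (intro UnionI[of "{v. x v \<noteq> 0}"]) auto
  have supp: "{w. ?y w \<noteq> 0} = \<phi> ` {v. x v \<noteq> 0}"
  proof (intro equalityI subsetI)
    fix w assume "w \<in> {w. ?y w \<noteq> 0}"
    then show "w \<in> \<phi> ` {v. x v \<noteq> 0}" using y_iff[of w] by auto
  next
    fix w assume "w \<in> \<phi> ` {v. x v \<noteq> 0}"
    then obtain v where v: "w = \<phi> v" "x v \<noteq> 0" by auto
    then have "\<exists>v\<in>\<Union>K. \<phi> v = w \<and> x v \<noteq> 0" using vK[OF v(2)] by (intro bexI[of _ v]) auto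
    then show "w \<in> {w. ?y w \<noteq> 0}" using y_iff[of w] by simp
  qed
  have img: "\<phi> ` \<Union>K \<subseteq> \<Union>L" using \<phi> by blast
  have "sum ?y (\<Union>L) = sum x (\<Union>K)"
    unfolding push_def by (rule sum.group[OF fin img])
  then show ?thesis using nn supp \<phi>[OF x'(2)] x' fin by (auto simp: realized_iff[of "\<Union>L" L])
qed

lemma push_fix:
  assumes "finite V" "\<And>v. x v \<noteq> 0 \<Longrightarrow> v \<in> V \<and> \<phi> v = v"
  shows "push V \<phi> x = x"
proof
  fix w
  have z: "x v = 0" if "\<phi> v \<noteq> v \<or> v \<notin> V" for v using assms(2)[of v] that by auto
  have "(\<Sum>v\<in>{v \<in> V. \<phi> v = w}. x v) = (\<Sum>v\<in>{w}. x v)"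
    by (rule sum.mono_neutral_cong) (use assms(1) z in auto)
  then show "push V \<phi> x w = x w" by (simp add: push_def)
qed

lemma push_compose:
  assumes "finite V" "finite W" "\<phi> ` V \<subseteq> W"
  shows "push W \<psi> (push V \<phi> x) = push V (\<psi> \<circ> \<phi>) x"
proof
  fix u
  have "(\<Sum>w\<in>{w \<in> W. \<psi> w = u}. \<Sum>v\<in>{v \<in> {v \<in> V. \<psi> (\<phi> v) = u}. \<phi> v = w}. x v) = (\<Sum>v\<in>{v \<in> V. \<psi> (\<phi> v) = u}. x v)"
    by (rule sum.group) (use assms in auto)
  moreover have "{v \<in> {v \<in> V. \<psi> (\<phi> v) = u}. \<phi> v = w} = {v \<in> V. \<phi> v = w}" if "\<psi> w = u" for w
    using that by auto
  ultimately show "push W \<psi> (push V \<phi> x) u = push V (\<psi> \<circ> \<phi>) x u"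
    by (simp add: push_def)
qed

lemma geometric_realization_relabel:
  assumes K: "simplicial_complex K" and inj: "inj_on \<phi> (\<Union>K)"
  shows "homeomorphic_maps (geometric_realization K) (geometric_realization ((`) \<phi> ` K))
    (push (\<Union>K) \<phi>) (push (\<phi> ` \<Union>K) (inv_into (\<Union>K) \<phi>))"
proof -
  let ?L = "(`) \<phi> ` K" and ?V = "\<Union>K" and ?p = "inv_into (\<Union>K) \<phi>"
  have union_L: "\<Union> ?L = \<phi> ` ?V" by auto
  have fin: "finite ?V" by (rule simplicial_complexD(1)[OF K])
  have pull: "?p ` (\<phi> ` t) = t" if "t \<in> K" for t
    by (rule inv_into_image_cancel[OF inj]) (use that in auto)
  have L: "simplicial_complex ?L"
    unfolding simplicial_complex_def
  proof (intro conjI ballI allI impI)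
    show "finite (\<Union>?L)" unfolding union_L using fin by simp
    show "{} \<notin> ?L" using simplicial_complexD(2)[OF K] by auto
    fix s t assume "s \<in> ?L" "t \<subseteq> s" "t \<noteq> {}"
    then obtain s0 where s0: "s0 \<in> K" "t \<subseteq> \<phi> ` s0" by auto
    then obtain t0 where "t0 \<subseteq> s0" "t = \<phi> ` t0" by (auto simp: subset_image_iff)
    then show "t \<in> ?L" using simplicial_complexD(3)[OF K s0(1)] \<open>t \<noteq> {}\<close> by auto
  qed
  have supK: "v \<in> ?V" if "x \<in> realized K" "x v \<noteq> 0" for x v
    using realized_support[OF that] .
  have supL: "v \<in> \<phi> ` ?V" if "x \<in> realized ?L" "x v \<noteq> 0" for x v
    using realized_support[OF that] union_L by simp
  show ?thesis
    unfolding homeomorphic_maps_def geometric_realization_eq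
  proof (intro conjI ballI)
    show "continuous_map (top_of_set (realized K)) (top_of_set (realized ?L)) (push ?V \<phi>)"
      using push_in[OF K L] continuous_push by auto
    have "push (\<Union>?L) ?p x \<in> realized K" if "x \<in> realized ?L" for x
      by (rule push_in[OF L K _ that]) (use pull in auto)
    then show "continuous_map (top_of_set (realized ?L)) (top_of_set (realized K)) (push (\<phi> ` ?V) ?p)"
      using continuous_push by (auto simp: union_L)
  next
    fix x assume "x \<in> topspace (top_of_set (realized K))"
    then have x: "x \<in> realized K" by simp
    have "push (\<phi> ` ?V) ?p (push ?V \<phi> x) = push ?V (?p \<circ> \<phi>) x"
      by (rule push_compose) (use fin in auto)
    also have "\<dots> = x"
      by (rule push_fix) (use fin inj supK[OF x] in auto)
    finally show "push (\<phi> ` ?V) ?p (push ?V \<phi> x) = x" .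
  next
    fix y assume "y \<in> topspace (top_of_set (realized ?L))"
    then have y: "y \<in> realized ?L" by simp
    have "push ?V \<phi> (push (\<phi> ` ?V) ?p y) = push (\<phi> ` ?V) (\<phi> \<circ> ?p) y"
      by (rule push_compose) (use fin in \<open>auto intro: inv_into_into\<close>)
    also have "\<dots> = y"
      by (rule push_fix) (use fin supL[OF y] in \<open>auto intro: f_inv_into_f\<close>)
    finally show "push ?V \<phi> (push (\<phi> ` ?V) ?p y) = y" .
  qed
qed

section \<open>Null-homotopic cross-polytopes\<close>

definition opposite :: "bool \<times> nat \<Rightarrow> bool \<times> nat \<Rightarrow> bool" where
  "opposite x y \<longleftrightarrow> fst x \<noteq> fst y \<and> snd x = snd y"

interpretation opposite: conflict opposite
  by unfold_locales (auto simp: opposite_def)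

definition cross_vertices :: "nat \<Rightarrow> (bool \<times> nat) set" where
  "cross_vertices d = UNIV \<times> {..d}"

text \<open>The independence complex of \<open>d + 1\<close> disjoint edges is the boundary of the
  cross-polytope of dimension \<open>d + 1\<close>, a \<open>d\<close>-sphere obtained by
  \<open>d + 1\<close> suspensions from the empty complex.\<close>

definition cross_polytope :: "nat \<Rightarrow> (bool \<times> nat) set set" where
  "cross_polytope d = indep opposite (cross_vertices d)"

lemma finite_cross_vertices [simp]: "finite (cross_vertices d)"
  by (simp add: cross_vertices_def)

lemma simplicial_complex_cross_polytope: "simplicial_complex (cross_polytope d)"
  unfolding cross_polytope_def by (rule opposite.simplicial_complex_indep) simp

lemma cross_polytope_type: "homology_type (cross_polytope d) (delta (int d))"
proof -
  have "opposite.ht (UNIV \<times> {..<p}) (delta (int p - 1))" for p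
  proof (induction p)
    case 0
    then show ?case using opposite.ht_empty by simp
  next
    case (Suc p)
    have "UNIV \<times> {..<Suc p} - {(True, p), (False, p)} = UNIV \<times> {..<p}" by (auto simp: less_Suc_eq)
    then have "opposite.ht (UNIV \<times> {..<Suc p} - {(True, p), (False, p)}) (delta (int p - 1))"
      using Suc by simp
    then have "opposite.ht (UNIV \<times> {..<Suc p}) (\<lambda>i. delta (int p - 1) (i - 1))"
      by (rule opposite.ht_edge[rotated 6]) (auto simp: opposite_def)
    then show ?case by (simp add: delta_def algebra_simps)
  qed
  from this[of "Suc d"] show ?thesis
    by (simp add: opposite.ht_def cross_polytope_def cross_vertices_def lessThan_Suc_atMost)
qed

text \<open>Prepares the description by real coordinates: \<open>x (True, i)\<close> and
  \<open>x (False, i)\<close> are the positive and the negative part of coordinate \<open>i\<close>,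
  and the total weight is the l1-norm.\<close>

lemma cross_polytope_points_iff:
  "x \<in> realized (cross_polytope d) \<longleftrightarrow>
    (\<forall>v. 0 \<le> x v) \<and> (\<forall>v. x v \<noteq> 0 \<longrightarrow> snd v \<le> d) \<and> (\<forall>i. x (True, i) = 0 \<or> x (False, i) = 0)
    \<and> (\<Sum>i\<le>d. x (True, i) + x (False, i)) = 1"
proof -
  have "\<Union>(cross_polytope d) \<subseteq> cross_vertices d"
    by (auto simp: cross_polytope_def indep_def)
  note P = realized_iff[OF finite_cross_vertices this]
  have sum: "sum x (cross_vertices d) = (\<Sum>i\<le>d. x (True, i) + x (False, i))"
  proof -
    have "sum x (cross_vertices d) = (\<Sum>c\<in>UNIV. \<Sum>i\<le>d. x (c, i))"
      by (simp add: cross_vertices_def sum.cartesian_product)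
    then show ?thesis by (simp add: UNIV_bool sum.distrib add.commute)
  qed
  have "{v. x v \<noteq> 0} \<in> cross_polytope d \<longleftrightarrow>
      (\<forall>v. x v \<noteq> 0 \<longrightarrow> snd v \<le> d) \<and> (\<forall>i. x (True, i) = 0 \<or> x (False, i) = 0)"
    if s: "sum x (cross_vertices d) = 1"
  proof -
    have ne: "{v. x v \<noteq> 0} \<noteq> {}" using s by (rule support_nonempty)
    have "(\<forall>v\<in>{v. x v \<noteq> 0}. \<forall>w\<in>{v. x v \<noteq> 0}. \<not> opposite v w) \<longleftrightarrow> (\<forall>i. x (True, i) = 0 \<or> x (False, i) = 0)"
    proof
      assume *: "\<forall>v\<in>{v. x v \<noteq> 0}. \<forall>w\<in>{v. x v \<noteq> 0}. \<not> opposite v w"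
      show "\<forall>i. x (True, i) = 0 \<or> x (False, i) = 0"
      proof
        fix i
        have "opposite (True, i) (False, i)" by (simp add: opposite_def)
        then show "x (True, i) = 0 \<or> x (False, i) = 0" using * by blast
      qed
    next
      assume *: "\<forall>i. x (True, i) = 0 \<or> x (False, i) = 0"
      show "\<forall>v\<in>{v. x v \<noteq> 0}. \<forall>w\<in>{v. x v \<noteq> 0}. \<not> opposite v w"
      proof (intro ballI notI)
        fix v w assume vw: "v \<in> {v. x v \<noteq> 0}" "w \<in> {v. x v \<noteq> 0}" "opposite v w"
        obtain c i where v: "v = (c, i)" by (cases v)
        then have w: "w = (\<not> c, i)" using vw(3) by (cases w) (auto simp: opposite_def)
        have "x (c, i) \<noteq> 0" "x (\<not> c, i) \<noteq> 0" using vw(1,2) v w by auto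
        then show False using *[rule_format, of i] by (cases c) auto
      qed
    qed
    moreover have "{v. x v \<noteq> 0} \<subseteq> cross_vertices d \<longleftrightarrow> (\<forall>v. x v \<noteq> 0 \<longrightarrow> snd v \<le> d)"
      by (auto simp: cross_vertices_def mem_Times_iff)
    ultimately show ?thesis using ne unfolding cross_polytope_def indep_def by simp
  qed
  then show ?thesis unfolding P sum[symmetric] by auto
qed

section \<open>The cross-polytope as the unit sphere of the l1-norm\<close>

definition coords :: "(bool \<times> nat \<Rightarrow> real) \<Rightarrow> nat \<Rightarrow> real" where
  "coords x i = x (True, i) - x (False, i)"

definition l1 :: "nat \<Rightarrow> (nat \<Rightarrow> real) \<Rightarrow> real" where
  "l1 d z = (\<Sum>i\<le>d. \<bar>z i\<bar>)"

text \<open>Only the first \<open>d\<close> coordinates count. The extra value 0 at index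
  \<open>d\<close> keeps the maximum defined when \<open>d = 0\<close>.\<close>

definition supnorm :: "nat \<Rightarrow> (nat \<Rightarrow> real) \<Rightarrow> real" where
  "supnorm d z = Max ((\<lambda>i. if i < d then \<bar>z i\<bar> else 0) ` {..d})"

text \<open>Radial projection of the punctured coordinate space onto the l1-sphere, followed by the
  splitting into positive and negative parts.\<close>

definition project :: "nat \<Rightarrow> (nat \<Rightarrow> real) \<Rightarrow> bool \<times> nat \<Rightarrow> real" where
  "project d z v = (if snd v \<le> d then max 0 (if fst v then z (snd v) else - z (snd v)) / l1 d z else 0)"

lemma supnorm_ge: "0 \<le> supnorm d z" "i < d \<Longrightarrow> \<bar>z i\<bar> \<le> supnorm d z"
proof -
  have "(\<lambda>i. if i < d then \<bar>z i\<bar> else 0) d \<le> supnorm d z"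
    unfolding supnorm_def by (intro Max_ge) auto
  then show "0 \<le> supnorm d z" by simp
  assume "i < d"
  then have "(\<lambda>i. if i < d then \<bar>z i\<bar> else 0) i \<le> supnorm d z"
    unfolding supnorm_def by (intro Max_ge) auto
  then show "\<bar>z i\<bar> \<le> supnorm d z" using \<open>i < d\<close> by simp
qed

lemma supnorm_cases: "supnorm d z = 0 \<or> (\<exists>i<d. supnorm d z = \<bar>z i\<bar>)"
proof -
  have "supnorm d z \<in> (\<lambda>i. if i < d then \<bar>z i\<bar> else 0) ` {..d}"
    unfolding supnorm_def by (intro Max_in) auto
  then show ?thesis by (auto split: if_splits)
qed

lemma supnorm_leI: "0 \<le> c \<Longrightarrow> (\<And>i. i < d \<Longrightarrow> \<bar>z i\<bar> \<le> c) \<Longrightarrow> supnorm d z \<le> c"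
  using supnorm_cases[of d z] by auto

lemma continuous_on_Max_image:
  fixes f :: "'i \<Rightarrow> 'a::topological_space \<Rightarrow> real"
  assumes "finite I" "I \<noteq> {}" "\<And>i. i \<in> I \<Longrightarrow> continuous_on S (f i)"
  shows "continuous_on S (\<lambda>x. Max ((\<lambda>i. f i x) ` I))"
  using assms
proof (induction I rule: finite_ne_induct)
  case (insert i I)
  then have "continuous_on S (\<lambda>x. max (f i x) (Max ((\<lambda>i. f i x) ` I)))"
    by (intro continuous_on_max) auto
  then show ?case
    using insert.hyps by simp
qed auto

lemma continuous_supnorm: "continuous_on S (supnorm d)"
  unfolding supnorm_def[abs_def]
proof (rule continuous_on_Max_image)
  show "continuous_on S (\<lambda>z. if i < d then \<bar>z i\<bar> else 0)" for i
    by (cases "i < d") (auto intro!: continuous_intros continuous_on_coordinate)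
qed auto

lemma continuous_l1: "continuous_on S (l1 d)"
  unfolding l1_def[abs_def] by (intro continuous_intros continuous_on_coordinate)

lemma continuous_coords: "continuous_on S coords"
  unfolding coords_def[abs_def]
  by (intro continuous_on_coordinatewise_then_product continuous_intros continuous_on_coordinate)

lemma continuous_project:
  assumes "\<And>z. z \<in> S \<Longrightarrow> l1 d z \<noteq> 0"
  shows "continuous_on S (project d)"
proof (rule continuous_on_coordinatewise_then_product)
  fix v :: "bool \<times> nat"
  have "continuous_on S (\<lambda>z. max 0 (if fst v then z (snd v) else - z (snd v)) / l1 d z)"
    by (cases "fst v") (auto intro!: continuous_intros continuous_on_coordinate continuous_l1 assms)
  then show "continuous_on S (\<lambda>z. project d z v)"
    by (cases "snd v \<le> d") (simp_all add: project_def)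
qed

lemma l1_nonneg: "0 \<le> l1 d z"
  by (simp add: l1_def sum_nonneg)

lemma l1_zero_iff: "l1 d z = 0 \<longleftrightarrow> (\<forall>i\<le>d. z i = 0)"
  unfolding l1_def by (subst sum_nonneg_eq_0_iff) auto

lemma project_in:
  assumes "l1 d z \<noteq> 0"
  shows "project d z \<in> realized (cross_polytope d)"
proof -
  have pos: "l1 d z > 0" using assms l1_nonneg[of d z] by simp
  have "(\<Sum>i\<le>d. project d z (True, i) + project d z (False, i)) = (\<Sum>i\<le>d. \<bar>z i\<bar> / l1 d z)"
    by (rule sum.cong) (auto simp: project_def add_divide_distrib[symmetric] max_def)
  also have "\<dots> = 1" using assms by (simp add: sum_divide_distrib[symmetric] l1_def)
  finally show ?thesis
    unfolding cross_polytope_points_iff using pos by (auto simp: project_def max_def split: if_splits)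
qed

lemma l1_coords:
  assumes "x \<in> realized (cross_polytope d)"
  shows "l1 d (coords x) = 1"
proof -
  have "\<bar>coords x i\<bar> = x (True, i) + x (False, i)" for i
  proof -
    have "x (True, i) = 0 \<or> x (False, i) = 0" "0 \<le> x (True, i)" "0 \<le> x (False, i)"
      using assms unfolding cross_polytope_points_iff by blast+
    then show ?thesis by (auto simp: coords_def)
  qed
  then show ?thesis using assms unfolding cross_polytope_points_iff l1_def by simp
qed

lemma project_coords:
  assumes "x \<in> realized (cross_polytope d)"
  shows "project d (coords x) = x"
proof
  fix v :: "bool \<times> nat"
  obtain c i where v: "v = (c, i)" by (cases v)
  have "x (True, i) = 0 \<or> x (False, i) = 0" "0 \<le> x (True, i)" "0 \<le> x (False, i)" "x v \<noteq> 0 \<Longrightarrow> i \<le> d"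
    using assms v unfolding cross_polytope_points_iff by auto
  then show "project d (coords x) v = x v"
    unfolding project_def l1_coords[OF assms] v by (cases c) (auto simp: coords_def max_def)
qed

text \<open>\<open>collapse\<close> maps the cube \<open>[-1,1]\<^sup>d\<close> to the sphere, with all of its boundary going to the south pole.\<close>
definition collapse :: "nat \<Rightarrow> (nat \<Rightarrow> real) \<Rightarrow> nat \<Rightarrow> real" where
  "collapse d u i = (if i < d then (1 - supnorm d u) * u i else if i = d then 1 - 2 * supnorm d u else 0)"

definition south :: "nat \<Rightarrow> nat \<Rightarrow> real" where
  "south d i = (if i = d then -1 else 0)"

lemma continuous_collapse: "continuous_on S (collapse d)"
proof (rule continuous_on_coordinatewise_then_product)
  fix i
  have "continuous_on S (\<lambda>u. (1 - supnorm d u) * u i)" "continuous_on S (\<lambda>u. 1 - 2 * supnorm d u)"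
    by (intro continuous_intros continuous_on_coordinate continuous_supnorm)+
  then show "continuous_on S (\<lambda>u. collapse d u i)"
    by (cases "i < d"; cases "i = d") (simp_all add: collapse_def)
qed

text \<open>The last coordinate vanishes only at sup norm \<open>1 / 2\<close>, and there a
  coordinate attaining the norm is mapped to \<open>1 / 4\<close> in absolute value.\<close>

lemma l1_collapse: "l1 d (collapse d u) \<noteq> 0"
proof
  assume "l1 d (collapse d u) = 0"
  then have z: "\<And>i. i \<le> d \<Longrightarrow> collapse d u i = 0" by (simp add: l1_zero_iff)
  from z[of d] have s: "supnorm d u = 1 / 2" by (simp add: collapse_def)
  then obtain i where "i < d" "\<bar>u i\<bar> = 1 / 2" using supnorm_cases[of d u] by auto
  then show False using z[of i] s by (auto simp: collapse_def)
qed

lemma collapse_boundary: "supnorm d u = 1 \<Longrightarrow> collapse d u = south d"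
  by (auto simp: collapse_def south_def fun_eq_iff)

lemma l1_south: "l1 d (south d) \<noteq> 0"
  by (auto simp: l1_zero_iff south_def)

text \<open>The cube coordinate \<open>y\<close> in \<open>[0,1]\<close> corresponds to \<open>u = 2 y - 1\<close>; values outside \<open>{..<d}\<close> are padded by \<open>0\<close>.\<close>
definition pad :: "nat \<Rightarrow> (nat \<Rightarrow> real) \<Rightarrow> nat \<Rightarrow> real" where
  "pad d y i = (if i < d then 2 * y i - 1 else 0)"

text \<open>Central projection of the cap \<open>supnorm d z \<le> z d\<close> onto the cube at
  height 1; \<open>upper_cube\<close> is the same map in the coordinates of
  \<open>cube d\<close>.\<close>

definition upper :: "nat \<Rightarrow> (nat \<Rightarrow> real) \<Rightarrow> nat \<Rightarrow> real" where
  "upper d z i = (if i < d then z i / z d else 0)"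

definition upper_cube :: "nat \<Rightarrow> (nat \<Rightarrow> real) \<Rightarrow> nat \<Rightarrow> real" where
  "upper_cube d z = (\<lambda>i\<in>{..<d}. (1 + z i / z d) / 2)"

lemma pad_upper_cube: "pad d (upper_cube d z) = upper d z"
  by (auto simp: pad_def upper_cube_def upper_def fun_eq_iff field_simps)

lemma supnorm_upper:
  assumes "z d > 0"
  shows "supnorm d (upper d z) = supnorm d z / z d"
proof (rule antisym)
  show "supnorm d (upper d z) \<le> supnorm d z / z d"
    using assms supnorm_ge(1)[of d z] supnorm_ge(2)[of _ d z] by (intro supnorm_leI) (auto simp: upper_def divide_right_mono)
  have "supnorm d z \<le> supnorm d (upper d z) * z d"
  proof (rule supnorm_leI)
    show "0 \<le> supnorm d (upper d z) * z d" using assms supnorm_ge(1) by simp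
    fix i assume "i < d"
    then have "\<bar>z i / z d\<bar> \<le> supnorm d (upper d z)" using supnorm_ge(2)[of i d "upper d z"] by (simp add: upper_def)
    then show "\<bar>z i\<bar> \<le> supnorm d (upper d z) * z d" using assms by (simp add: field_simps)
  qed
  then show "supnorm d z / z d \<le> supnorm d (upper d z)" using assms by (simp add: field_simps)
qed

lemma continuous_map_pad: "continuous_map (cube d) euclidean (pad d)"
proof -
  have c: "continuous_map (cube d) euclideanreal (\<lambda>y. y i)" if "i < d" for i
    unfolding cube_def using that
    by (intro continuous_map_from_subtopology continuous_map_product_projection) auto
  have "continuous_map (cube d) euclideanreal (\<lambda>y. pad d y i)" for i
    by (cases "i < d") (auto simp: pad_def intro!: continuous_intros c)
  then show ?thesis
    unfolding euclidean_product_topology[symmetric] continuous_map_componentwise_UNIV by blast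
qed

lemma cube_boundary_supnorm:
  assumes "y \<in> cube_boundary d"
  shows "supnorm d (pad d y) = 1"
proof (rule antisym)
  have y: "0 \<le> y i" "y i \<le> 1" if "i < d" for i
    using assms that by (auto simp: cube_boundary_def cube_def PiE_iff)
  show "supnorm d (pad d y) \<le> 1"
    by (rule supnorm_leI) (use y in \<open>auto simp: pad_def abs_le_iff\<close>)
  obtain i where "i < d" "y i = 0 \<or> y i = 1" using assms by (auto simp: cube_boundary_def)
  then show "1 \<le> supnorm d (pad d y)" using supnorm_ge(2)[of i d "pad d y"] by (auto simp: pad_def)
qed

lemma upper_cube_in:
  assumes "z d > 0" "supnorm d z \<le> z d"
  shows "upper_cube d z \<in> topspace (cube d)"
proof -
  have "-1 \<le> z i / z d \<and> z i / z d \<le> 1" if "i < d" for i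
    using supnorm_ge(2)[OF that, of z] assms by (auto simp: field_simps abs_le_iff)
  then show ?thesis by (force simp: cube_def upper_cube_def)
qed

lemma upper_cube_boundary:
  assumes "z d > 0" "supnorm d z = z d"
  shows "upper_cube d z \<in> cube_boundary d"
proof -
  obtain i where i: "i < d" "\<bar>z i\<bar> = z d" using supnorm_cases[of d z] assms by auto
  then have "z i / z d = 1 \<or> z i / z d = -1" using assms by (auto simp: abs_if field_simps split: if_splits)
  then have "upper_cube d z i = 0 \<or> upper_cube d z i = 1" using i by (auto simp: upper_cube_def)
  then show ?thesis using upper_cube_in[of z d] assms i by (auto simp: cube_boundary_def)
qed

lemma upper_pos:
  assumes "l1 d z \<noteq> 0" "supnorm d z \<le> z d"
  shows "z d > 0"
proof (rule ccontr)
  assume "\<not> z d > 0"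
  then have "z d = 0" "supnorm d z = 0" using assms(2) supnorm_ge(1)[of d z] by auto
  then have "z i = 0" if "i \<le> d" for i
    using supnorm_ge(2)[of i d z] that by (cases "i = d") auto
  then show False using assms(1) by (simp add: l1_zero_iff)
qed

text \<open>A self-map of the sphere homotopic to the identity that factors through \<open>collapse\<close> on a cap around the north pole
  and is constant outside of it, so that maps out of the sphere become maps out of the cube that are constant
  on the boundary.\<close>
definition pinch :: "nat \<Rightarrow> (nat \<Rightarrow> real) \<Rightarrow> nat \<Rightarrow> real" where
  "pinch d z = (if supnorm d z \<le> z d then collapse d (upper d z) else south d)"

text \<open>A point and its image are never antipodal. In the cap the first \<open>d\<close>
  coordinates are only scaled by a nonnegative factor; on the line they vanish only over the north
  axis, where \<open>pinch\<close> points upwards, or for \<open>t = 1\<close> on the rim, where the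
  image is the south pole. Outside the cap only points of the north axis could be antipodal to the
  south pole, and these lie in the cap.\<close>

lemma l1_line_pinch:
  assumes z: "l1 d z \<noteq> 0" and t: "0 \<le> t" "t \<le> 1"
  shows "l1 d (\<lambda>i. (1 - t) * z i + t * pinch d z i) \<noteq> 0"
proof
  assume "l1 d (\<lambda>i. (1 - t) * z i + t * pinch d z i) = 0"
  then have *: "\<And>i. i \<le> d \<Longrightarrow> (1 - t) * z i + t * pinch d z i = 0" by (simp add: l1_zero_iff)
  show False
  proof (cases "supnorm d z \<le> z d")
    case True
    have pos: "z d > 0" by (rule upper_pos[OF z True])
    let ?c = "1 - supnorm d z / z d"
    have c: "0 \<le> ?c" using True pos by (simp add: field_simps)
    have i0: "((1 - t) + t * ?c / z d) * z i = 0" if "i < d" for i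
    proof -
      have "((1 - t) + t * ?c / z d) * z i = (1 - t) * z i + t * (?c * (z i / z d))"
        by (simp add: distrib_right)
      also have "\<dots> = 0"
        using *[of i] that True pos by (simp add: pinch_def collapse_def supnorm_upper) (simp add: upper_def)
      finally show ?thesis .
    qed
    have d0: "(1 - t) * z d + t * (1 - 2 * (supnorm d z / z d)) = 0"
      using *[of d] True pos by (simp add: pinch_def collapse_def supnorm_upper)
    show False
    proof (cases "(1 - t) + t * ?c / z d = 0")
      case True
      moreover have "0 \<le> t * ?c / z d" using c t pos by simp
      ultimately have "t = 1" "t * ?c / z d = 0" using t by linarith+
      then have "supnorm d z / z d = 1" using pos by simp
      then show False using d0 \<open>t = 1\<close> by simp
    next
      case False
      then have "z i = 0" if "i < d" for i using i0[OF that] by simp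
      then have "supnorm d z = 0" using supnorm_cases[of d z] by auto
      then have "(1 - t) * z d + t = 0" using d0 by simp
      moreover have "0 \<le> (1 - t) * z d" using t pos by simp
      ultimately have "t = 0" "(1 - t) * z d = 0" using t by linarith+
      then show False using pos by simp
    qed
  next
    case False
    have i0: "(1 - t) * z i = 0" if "i < d" for i
      using *[of i] that False by (simp add: pinch_def south_def)
    have d0: "(1 - t) * z d - t = 0"
      using *[of d] False by (simp add: pinch_def south_def)
    show False
    proof (cases "t = 1")
      case True
      then show False using d0 by simp
    next
      case t1: False
      then have "z i = 0" if "i < d" for i using i0[OF that] by simp
      then have s0: "supnorm d z = 0" using supnorm_cases[of d z] by auto
      have "(1 - t) * z d \<ge> 0" using d0 t by simp
      then have "z d \<ge> 0" using t t1 by (simp add: zero_le_mult_iff)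
      then show False using False s0 by simp
    qed
  qed
qed

lemma continuous_pinch:
  assumes "\<And>z. z \<in> S \<Longrightarrow> l1 d z \<noteq> 0"
  shows "continuous_on S (pinch d)"
proof -
  let ?U = "{z \<in> S. supnorm d z - z d \<le> 0}"
  have pos: "z d > 0" if "z \<in> ?U" for z using upper_pos[of d z] assms that by auto
  have "continuous_on ?U (\<lambda>z. upper d z i)" for i
  proof (cases "i < d")
    case True
    have "z d \<noteq> 0" if "z \<in> ?U" for z using pos[OF that] by simp
    then have "continuous_on ?U (\<lambda>z. z i / z d)"
      by (intro continuous_intros continuous_on_coordinate) auto
    then show ?thesis using True by (simp add: upper_def)
  qed (simp add: upper_def)
  then have "continuous_on ?U (upper d)" by (rule continuous_on_coordinatewise_then_product)
  then have "continuous_on ?U (\<lambda>z. collapse d (upper d z))"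
    by (rule continuous_on_compose2[OF continuous_collapse[of UNIV]]) simp
  then have "continuous_on S (\<lambda>z. if supnorm d z - z d \<le> 0 then collapse d (upper d z) else south d)"
  proof (rule continuous_on_cases_le)
    \<comment> \<open>The rim of the cap maps to the boundary of the cube, which
      \<open>collapse\<close> sends to the south pole, so the two formulas agree.\<close>
    show "collapse d (upper d z) = south d" if "z \<in> S" "supnorm d z - z d = 0" for z
      using that pos[of z] by (intro collapse_boundary) (simp add: supnorm_upper)
  qed (auto intro!: continuous_intros continuous_supnorm continuous_on_coordinate)
  then show ?thesis by (simp add: pinch_def[abs_def])
qed

text \<open>Up to homotopy \<open>pinch\<close> turns \<open>g\<close> into a map of the cube that
  is constant on the boundary. Connectedness contracts this map relative to the boundary, and the
  contraction is carried back through the cap. For \<open>d = 0\<close> this joins the images of the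
  two points by a path.\<close>

lemma cross_polytope_nullhomotopic:
  assumes Y: "k_connected (int d) Y" and g: "continuous_map (geometric_realization (cross_polytope d)) Y g"
  shows "\<exists>c. homotopic_with (\<lambda>_. True) (geometric_realization (cross_polytope d)) Y g (\<lambda>_. c)"
proof -
  let ?P = "realized (cross_polytope d)"
  let ?O = "top_of_set ?P"
  let ?N = "{z. l1 d z \<noteq> 0}"
  have g: "continuous_map ?O Y g" using g by (simp add: geometric_realization_eq)
  have proj: "continuous_map (top_of_set ?N) ?O (project d)"
    using continuous_project[of ?N d] project_in by auto
  have gproj: "continuous_map (top_of_set ?N) Y (g \<circ> project d)"
    by (rule continuous_map_compose[OF proj g])
  define x0 where "x0 = g (project d (south d))"
  have x0: "x0 \<in> topspace Y"
    using continuous_map_image_subset_topspace[OF g] project_in[OF l1_south] by (auto simp: x0_def)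
  \<comment> \<open>\<open>F\<close> represents an element of the \<open>d\<close>-th homotopy
    group, based at the image of the south pole.\<close>
  define F where "F = g \<circ> project d \<circ> collapse d \<circ> pad d"
  define Q where "Q = (\<lambda>h. \<forall>y\<in>cube_boundary d. h y = x0)"
  have "continuous_map (cube d) (top_of_set ?N) (collapse d \<circ> pad d)"
  proof -
    have "continuous_map euclidean (top_of_set ?N) (collapse d)"
      using continuous_collapse[of UNIV d] l1_collapse[of d]
      by (simp add: continuous_map_in_subtopology)
    then show ?thesis by (rule continuous_map_compose[OF continuous_map_pad])
  qed
  then have F: "continuous_map (cube d) Y F"
    unfolding F_def comp_assoc[of _ "collapse d"] by (rule continuous_map_compose[OF _ gproj])
  have QF: "Q F"
    unfolding Q_def by (auto simp: F_def x0_def collapse_boundary[OF cube_boundary_supnorm])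
  let ?S = "{f. continuous_map (cube d) Y f \<and> (\<forall>x\<in>cube_boundary d. f x = x0)}"
  let ?R = "{(f, g). homotopic_with (\<lambda>h. \<forall>x\<in>cube_boundary d. h x = x0) (cube d) Y f g}"
  have const: "continuous_map (cube d) Y (\<lambda>_. x0)" using x0 by simp
  have "is_singleton (?S // ?R)"
    using Y x0 unfolding k_connected_def homotopy_group_set_def by blast
  then obtain C where C: "?S // ?R = {C}" by (auto simp: is_singleton_def)
  have SF: "F \<in> ?S" and Sc: "(\<lambda>_. x0) \<in> ?S" using F QF const by (simp_all add: Q_def)
  have "?R `` {F} \<in> ?S // ?R" "?R `` {\<lambda>_. x0} \<in> ?S // ?R"
    by (rule quotientI[OF SF]) (rule quotientI[OF Sc])
  then have "?R `` {F} = ?R `` {\<lambda>_. x0}" unfolding C by simp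
  moreover have "(\<lambda>_. x0) \<in> ?R `` {\<lambda>_. x0}" using const by simp
  ultimately have "(\<lambda>_. x0) \<in> ?R `` {F}" by (simp only:)
  then have "homotopic_with Q (cube d) Y F (\<lambda>_. x0)" by (simp add: Q_def)
  then obtain H where H: "continuous_map (prod_topology (top_of_set {0..1}) (cube d)) Y H"
      "\<And>y. H (0::real, y) = F y" "\<And>y. H (1, y) = x0"
      "\<And>t y. 0 \<le> t \<Longrightarrow> t \<le> 1 \<Longrightarrow> y \<in> cube_boundary d \<Longrightarrow> H (t, y) = x0"
    unfolding homotopic_with_def Q_def by force
  let ?J = "prod_topology (top_of_set {0..1::real}) (top_of_set ?N)"
  \<comment> \<open>The contraction \<open>H\<close> on the cap is glued to the constant map
    outside; on the rim they agree because \<open>H\<close> fixes the boundary of the cube.\<close>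
  define G where "G p = (if supnorm d (snd p) \<le> snd p d then H (fst p, upper_cube d (snd p)) else x0)" for p
  have contG: "continuous_map ?J Y G"
    unfolding G_def[abs_def]
  proof (rule continuous_map_cases_le)
    have J: "?J = top_of_set ({0..1} \<times> ?N)" by simp
    show "continuous_map ?J euclideanreal (\<lambda>p. supnorm d (snd p))"
      unfolding J continuous_map_iff_continuous
      by (rule continuous_on_compose2[OF continuous_supnorm[of UNIV]]) (auto intro: continuous_intros)
    show "continuous_map ?J euclideanreal (\<lambda>p. snd p d)"
      unfolding J continuous_map_iff_continuous
      by (rule continuous_on_compose2[OF continuous_on_coordinate[of UNIV d]]) (auto intro: continuous_intros)
    show "continuous_map (subtopology ?J {p \<in> topspace ?J. snd p d \<le> supnorm d (snd p)}) Y (\<lambda>p. x0)"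
      using x0 by simp
    let ?U = "{p \<in> topspace ?J. supnorm d (snd p) \<le> snd p d}"
    have U: "subtopology ?J ?U = top_of_set ?U"
      unfolding J by (simp add: subtopology_subtopology) (rule arg_cong[where f = top_of_set], auto)
    have pos: "snd p d > 0" if "p \<in> ?U" for p using upper_pos[of d "snd p"] that by auto
    have c: "continuous_on ?U (\<lambda>p. (1 + snd p i / snd p d) / 2)" for i
    proof -
      have s: "continuous_on ?U (\<lambda>p. snd p j)" for j
        by (rule continuous_on_compose2[OF continuous_on_coordinate[of UNIV j]]) (auto intro: continuous_intros)
      show ?thesis by (intro continuous_intros s) (use pos in force)+
    qed
    have "continuous_map (top_of_set ?U) (cube d) (\<lambda>p. upper_cube d (snd p))"
      unfolding cube_def continuous_map_in_subtopology continuous_map_componentwise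
    proof (intro conjI ballI)
      show "continuous_map (top_of_set ?U) euclideanreal (\<lambda>p. upper_cube d (snd p) k)" if "k \<in> {..<d}" for k
        using c[of k] that by (simp add: upper_cube_def)
      show "(\<lambda>p. upper_cube d (snd p)) \<in> topspace (top_of_set ?U) \<rightarrow> ({..<d} \<rightarrow>\<^sub>E {0..1})"
      proof
        fix p assume "p \<in> topspace (top_of_set ?U)"
        then have "p \<in> ?U" by simp
        then have "upper_cube d (snd p) \<in> topspace (cube d)" using pos[of p] by (intro upper_cube_in) auto
        then show "upper_cube d (snd p) \<in> {..<d} \<rightarrow>\<^sub>E {0..1}" by (simp add: cube_def)
      qed
    qed (auto simp: upper_cube_def)
    moreover have "continuous_map (top_of_set ?U) (top_of_set {0..1}) fst"
      by (auto intro: continuous_intros)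
    ultimately have "continuous_map (top_of_set ?U) (prod_topology (top_of_set {0..1}) (cube d)) (\<lambda>p. (fst p, upper_cube d (snd p)))"
      by (simp add: continuous_map_pairwise o_def)
    from continuous_map_compose[OF this H(1)]
    show "continuous_map (subtopology ?J ?U) Y (\<lambda>p. H (fst p, upper_cube d (snd p)))"
      unfolding U by (simp add: o_def)
    show "H (fst p, upper_cube d (snd p)) = x0" if "p \<in> topspace ?J" "supnorm d (snd p) = snd p d" for p
    proof -
      have "p \<in> ?U" using that by simp
      then have "upper_cube d (snd p) \<in> cube_boundary d" using pos[of p] that by (intro upper_cube_boundary) auto
      then show ?thesis using that by (intro H(4)) auto
    qed
  qed
  have "homotopic_with (\<lambda>_. True) (top_of_set ?N) Y (g \<circ> project d \<circ> pinch d) (\<lambda>_. x0)"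
    unfolding homotopic_with_def
  proof (intro exI[of _ G] conjI allI ballI contG)
    show "G (0, z) = (g \<circ> project d \<circ> pinch d) z" for z
      by (simp add: G_def H(2) F_def pad_upper_cube pinch_def x0_def)
    show "G (1, z) = x0" for z by (simp add: G_def H(3))
  qed simp
  moreover have "homotopic_with (\<lambda>_. True) (top_of_set ?N) Y (g \<circ> project d \<circ> id) (g \<circ> project d \<circ> pinch d)"
  proof (rule homotopic_with_compose_continuous_map_left[OF _ gproj])
    show "homotopic_with (\<lambda>_. True) (top_of_set ?N) (top_of_set ?N) id (pinch d)"
      by (rule homotopic_with_line)
         (auto intro: continuous_pinch continuous_on_id' simp: l1_line_pinch)
  qed simp
  ultimately have "homotopic_with (\<lambda>_. True) (top_of_set ?N) Y (g \<circ> project d) (\<lambda>_. x0)"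
    by (metis comp_id homotopic_with_trans)
  moreover have "continuous_map ?O (top_of_set ?N) coords"
    using continuous_coords[of ?P] l1_coords by (auto simp: image_subset_iff)
  ultimately have "homotopic_with (\<lambda>_. True) ?O Y (g \<circ> project d \<circ> coords) ((\<lambda>_. x0) \<circ> coords)"
    by (rule homotopic_with_compose_continuous_map_right) simp
  moreover have "homotopic_with (\<lambda>_. True) ?O Y g (g \<circ> project d \<circ> coords)"
    by (rule homotopic_with_equal) (use g project_coords in auto)
  ultimately have "homotopic_with (\<lambda>_. True) ?O Y g ((\<lambda>_. x0) \<circ> coords)"
    by (rule homotopic_with_trans[rotated])
  then show ?thesis unfolding geometric_realization_eq comp_def by blast
qed

section \<open>Components of multipaths\<close>

lemma simple_dipath_snoc:
  assumes es: "simple_dipath es" and e: "fst e = snd (last es)" "fst e \<notin> fst ` set es" "snd e \<notin> snd ` set es"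
    "fst (hd es) \<noteq> snd e"
  shows "simple_dipath (es @ [e])"
  unfolding simple_dipath_def
proof (intro conjI allI impI)
  have ne: "es \<noteq> []" using es by (simp add: simple_dipath_def)
  show "es @ [e] \<noteq> []" by simp
  show "fst (hd (es @ [e])) \<noteq> snd (last (es @ [e]))" using ne e by simp
  fix i
  show "fst ((es @ [e]) ! Suc i) = snd ((es @ [e]) ! i)" if "Suc i < length (es @ [e])"
  proof (cases "Suc i < length es")
    case True
    then show ?thesis using es by (simp add: simple_dipath_def nth_append)
  next
    case False
    then have "i = length es - 1" "i < length es" using that ne by auto
    then show ?thesis using e ne by (simp add: nth_append last_conv_nth)
  qed
  fix j
  assume i: "i < length (es @ [e])" and j: "j < length (es @ [e])"
    and eq: "fst ((es @ [e]) ! i) = fst ((es @ [e]) ! j) \<or> snd ((es @ [e]) ! i) = snd ((es @ [e]) ! j)"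
  have old: "fst (es ! k) \<noteq> fst e" "snd (es ! k) \<noteq> snd e" if "k < length es" for k
    using e(2,3) that by (metis image_eqI nth_mem)+
  have inj: "\<forall>i < length es. \<forall>j < length es. fst (es ! i) = fst (es ! j) \<or> snd (es ! i) = snd (es ! j) \<longrightarrow> i = j"
    using es by (simp add: simple_dipath_def)
  show "i = j"
  proof (cases "i < length es"; cases "j < length es")
    assume "i < length es" "j < length es"
    moreover from this have "fst (es ! i) = fst (es ! j) \<or> snd (es ! i) = snd (es ! j)"
      using eq by (simp add: nth_append)
    ultimately show ?thesis using inj by blast
  next
    assume "i < length es" "\<not> j < length es"
    then show ?thesis using old[of i] eq j by (simp add: nth_append)
  next
    assume "\<not> i < length es" "j < length es"
    then show ?thesis using old[of j] eq i by (simp add: nth_append)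
  next
    assume "\<not> i < length es" "\<not> j < length es"
    then show ?thesis using i j by simp
  qed
qed

lemma simple_dipath_Cons:
  assumes es: "simple_dipath es" and e: "snd e = fst (hd es)" "fst e \<notin> fst ` set es" "snd e \<notin> snd ` set es"
    "fst e \<noteq> snd (last es)"
  shows "simple_dipath (e # es)"
  unfolding simple_dipath_def
proof (intro conjI allI impI)
  have ne: "es \<noteq> []" using es by (simp add: simple_dipath_def)
  show "e # es \<noteq> []" by simp
  show "fst (hd (e # es)) \<noteq> snd (last (e # es))" using ne e by simp
  fix i
  show "fst ((e # es) ! Suc i) = snd ((e # es) ! i)" if "Suc i < length (e # es)"
    using that es e ne by (cases i) (simp_all add: simple_dipath_def hd_conv_nth)
  fix j
  assume i: "i < length (e # es)" and j: "j < length (e # es)"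
    and eq: "fst ((e # es) ! i) = fst ((e # es) ! j) \<or> snd ((e # es) ! i) = snd ((e # es) ! j)"
  have old: "fst (es ! k) \<noteq> fst e" "snd (es ! k) \<noteq> snd e" if "k < length es" for k
    using e(2,3) that by (metis image_eqI nth_mem)+
  have inj: "\<forall>i < length es. \<forall>j < length es. fst (es ! i) = fst (es ! j) \<or> snd (es ! i) = snd (es ! j) \<longrightarrow> i = j"
    using es by (simp add: simple_dipath_def)
  show "i = j"
  proof (cases i; cases j)
    fix k assume "i = 0" "j = Suc k"
    then show ?thesis using old[of k] eq j by simp
  next
    fix k assume "i = Suc k" "j = 0"
    then show ?thesis using old[of k] eq i by simp
  next
    fix k l assume "i = Suc k" "j = Suc l"
    then show ?thesis using inj[rule_format, of k l] eq i j by simp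
  qed simp
qed

text \<open>Look at the last edge of the path that lies in \<open>C\<close>.\<close>
lemma simple_dipath_acyclic:
  assumes es: "simple_dipath es" and C: "C \<subseteq> set es" "C \<noteq> {}" "\<And>e. e \<in> C \<Longrightarrow> \<exists>e'\<in>C. fst e' = snd e"
  shows False
proof -
  have ne: "es \<noteq> []" and ch: "\<And>i. Suc i < length es \<Longrightarrow> fst (es ! Suc i) = snd (es ! i)"
    and inj: "\<And>i j. i < length es \<Longrightarrow> j < length es \<Longrightarrow> fst (es ! i) = fst (es ! j) \<or> snd (es ! i) = snd (es ! j) \<Longrightarrow> i = j"
    and ends: "fst (hd es) \<noteq> snd (last es)"
    using es by (auto simp: simple_dipath_def)
  define I where "I = {i. i < length es \<and> es ! i \<in> C}"
  have "finite I" by (simp add: I_def)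
  moreover have "I \<noteq> {}"
  proof -
    obtain e where "e \<in> C" "e \<in> set es" using C(1,2) by auto
    then show ?thesis by (auto simp: I_def in_set_conv_nth)
  qed
  ultimately have "Max I \<in> I" by (rule Max_in)
  define i where "i = Max I"
  have i: "i < length es" "es ! i \<in> C" using \<open>Max I \<in> I\<close> by (auto simp: i_def I_def)
  obtain e' where e': "e' \<in> C" "fst e' = snd (es ! i)" using C(3)[OF i(2)] by auto
  then have "e' \<in> set es" using C(1) by auto
  then obtain j where j: "j < length es" "es ! j = e'" by (auto simp: in_set_conv_nth)
  then have "j \<le> i" using e' \<open>finite I\<close> unfolding i_def by (intro Max_ge) (auto simp: I_def)
  show False
  proof (cases "Suc i < length es")
    case True
    then have "fst (es ! Suc i) = fst (es ! j)" using ch e' j by simp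
    then have "Suc i = j" using inj True j by blast
    then show False using \<open>j \<le> i\<close> by simp
  next
    case False
    then have "length es - 1 = i" using i by simp
    then have last: "last es = es ! i" using ne by (simp add: last_conv_nth)
    show False
    proof (cases j)
      case 0
      then show False using ends last e' j ne by (simp add: hd_conv_nth)
    next
      case (Suc k)
      then have "snd (es ! k) = snd (es ! i)" using ch[of k] j e' by simp
      then have "k = i" using inj[of k i] i j Suc by simp
      then show False using \<open>j \<le> i\<close> Suc by simp
    qed
  qed
qed

section \<open>Weak connectedness, and paths as components\<close>

definition weak_reach :: "('a \<times> 'a) set \<Rightarrow> 'a \<Rightarrow> 'a set" where
  "weak_reach E v = {u. (v, u) \<in> (E \<union> E\<inverse>)\<^sup>*}"

lemma weak_reach_step:
  "u \<in> weak_reach E v \<Longrightarrow> (u, w) \<in> E \<or> (w, u) \<in> E \<Longrightarrow> w \<in> weak_reach E v"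
  unfolding weak_reach_def by (auto intro: rtrancl_into_rtrancl)

lemma weak_reach_refl: "v \<in> weak_reach E v"
  by (simp add: weak_reach_def)

lemma weak_reach_subset:
  assumes "v \<in> U" "\<And>u w. u \<in> U \<Longrightarrow> (u, w) \<in> E \<or> (w, u) \<in> E \<Longrightarrow> w \<in> U"
  shows "weak_reach E v \<subseteq> U"
proof
  fix u assume "u \<in> weak_reach E v"
  then have "(v, u) \<in> (E \<union> E\<inverse>)\<^sup>*" by (simp add: weak_reach_def)
  then show "u \<in> U" using assms by induction auto
qed

text \<open>A longest simple path inside the component is all of it: with in- and out-degrees at
  most 1, an edge that touches the path without belonging to it could only be attached at an end,
  giving a longer path.\<close>

lemma dipath_of_linear_component:
  assumes fin: "finite E" and src: "\<And>e e'. e \<in> E \<Longrightarrow> e' \<in> E \<Longrightarrow> fst e = fst e' \<Longrightarrow> e = e'"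
    and tgt: "\<And>e e'. e \<in> E \<Longrightarrow> e' \<in> E \<Longrightarrow> snd e = snd e' \<Longrightarrow> e = e'"
    and acyc: "\<And>C. C \<subseteq> E \<Longrightarrow> C \<noteq> {} \<Longrightarrow> \<exists>e\<in>C. \<forall>e'\<in>C. fst e' \<noteq> snd e"
    and W: "W = weak_reach E v" and D: "D = {e \<in> E. fst e \<in> W}" "D \<noteq> {}"
  shows "\<exists>es. simple_dipath es \<and> D = set es \<and> W = fst ` set es \<union> snd ` set es"
proof -
  define Q where "Q es \<longleftrightarrow> simple_dipath es \<and> set es \<subseteq> D" for es
  have finD: "finite D" using fin D by simp
  have DE: "D \<subseteq> E" using D by auto
  obtain e0 where e0: "e0 \<in> D" using D by auto
  have "fst e0 \<noteq> snd e0" using acyc[of "{e0}"] e0 DE by auto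
  then have Q0: "Q [e0]" using e0 by (simp add: Q_def simple_dipath_def)
  have bound: "length es \<le> card D" if "Q es" for es
  proof -
    have "distinct es"
      unfolding distinct_conv_nth using that by (auto simp: Q_def simple_dipath_def)
    then have "length es = card (set es)" by (simp add: distinct_card)
    also have "\<dots> \<le> card D" using that finD by (intro card_mono) (auto simp: Q_def)
    finally show ?thesis .
  qed
  obtain es where es: "Q es" and maxl: "\<And>fs. Q fs \<Longrightarrow> length fs \<le> length es"
    using ex_has_greatest_nat[of Q "[e0]" length "Suc (card D)"] Q0 bound by (auto simp: less_Suc_eq_le)
  have sd: "simple_dipath es" and sub: "set es \<subseteq> D" using es by (auto simp: Q_def)
  have ne: "es \<noteq> []" and ch: "\<And>i. Suc i < length es \<Longrightarrow> fst (es ! Suc i) = snd (es ! i)"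
    using sd by (auto simp: simple_dipath_def)
  have inE: "e \<in> E" if "e \<in> set es" for e using that sub DE by auto
  have WD: "fst e \<in> W" "snd e \<in> W" if "e \<in> D" for e
    using that weak_reach_step[of "fst e" E v "snd e"] by (auto simp: D W)
  have inD: "e \<in> D" if "e \<in> E" "fst e \<in> W \<or> snd e \<in> W" for e
    using that weak_reach_step[of "snd e" E v "fst e"] by (auto simp: D W)
  have nsrc: "fst e \<notin> fst ` set es" and ntgt: "snd e \<notin> snd ` set es" if e: "e \<in> E" "e \<notin> set es" for e
  proof -
    have "e1 \<noteq> e" "e1 \<in> E" if "e1 \<in> set es" for e1 using that e inE by auto
    then show "fst e \<notin> fst ` set es" "snd e \<notin> snd ` set es"
      using src[of e] tgt[of e] e(1) by (metis imageE)+
  qed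
  have follow: "\<exists>e'\<in>set es. fst e' = snd e" if "e \<in> set es" "e \<noteq> last es" for e
  proof -
    obtain i where i: "i < length es" "e = es ! i" using \<open>e \<in> set es\<close> by (auto simp: in_set_conv_nth)
    have "Suc i \<noteq> length es"
    proof
      assume "Suc i = length es"
      then have "length es - 1 = i" by simp
      then show False using i \<open>e \<noteq> last es\<close> ne by (simp add: last_conv_nth)
    qed
    then have "Suc i < length es" using i by simp
    then show ?thesis using ch[of i] i by (intro bexI[of _ "es ! Suc i"]) auto
  qed
  have precede: "\<exists>e'\<in>set es. snd e' = fst e" if "e \<in> set es" "e \<noteq> hd es" for e
  proof -
    obtain i where i: "i < length es" "e = es ! i" using \<open>e \<in> set es\<close> by (auto simp: in_set_conv_nth)
    have "i \<noteq> 0"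
    proof
      assume "i = 0"
      then show False using i \<open>e \<noteq> hd es\<close> ne by (simp add: hd_conv_nth)
    qed
    then obtain k where k: "i = Suc k" by (cases i) auto
    then show ?thesis using ch[of k] i by (intro bexI[of _ "es ! k"]) auto
  qed
  have out: "e \<in> set es" if e: "e \<in> E" "fst e = snd e'" "e' \<in> set es" for e e'
  proof (cases "e' = last es")
    case False
    then obtain e'' where "e'' \<in> set es" "fst e'' = snd e'" using follow e by blast
    then show ?thesis using src[of e e''] e inE by auto
  next
    case True
    show ?thesis
    proof (rule ccontr)
      assume n: "e \<notin> set es"
      \<comment> \<open>If \<open>e\<close> closed up the path, then in the set of its edges
        together with \<open>e\<close> every edge would have a successor, against
        \<open>acyc\<close>.\<close>
      have "fst (hd es) \<noteq> snd e"
      proof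
        assume h: "fst (hd es) = snd e"
        have "\<exists>e1\<in>insert e (set es). \<forall>e2\<in>insert e (set es). fst e2 \<noteq> snd e1"
          using e inE by (intro acyc) auto
        then obtain e1 where e1: "e1 \<in> insert e (set es)" "\<And>e2. e2 \<in> insert e (set es) \<Longrightarrow> fst e2 \<noteq> snd e1"
          by blast
        show False
        proof (cases "e1 = e")
          case True
          then show False using e1(2)[of "hd es"] h ne by simp
        next
          case False
          then have "e1 \<in> set es" using e1 by simp
          then show False using e1(2)[of e] e1(2) follow[of e1] e \<open>e' = last es\<close> by (cases "e1 = last es") auto
        qed
      qed
      then have "simple_dipath (es @ [e])"
        using e True by (intro simple_dipath_snoc sd nsrc ntgt n) auto
      moreover have "e \<in> D" using inD[of e] e WD[of e'] sub by auto
      ultimately have "Q (es @ [e])" using sub by (simp add: Q_def)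
      then show False using maxl[of "es @ [e]"] by simp
    qed
  qed
  have into: "e \<in> set es" if e: "e \<in> E" "snd e = fst e'" "e' \<in> set es" for e e'
  proof (cases "e' = hd es")
    case False
    then obtain e'' where "e'' \<in> set es" "snd e'' = fst e'" using precede e by blast
    then show ?thesis using tgt[of e e''] e inE by auto
  next
    case True
    show ?thesis
    proof (rule ccontr)
      assume n: "e \<notin> set es"
      \<comment> \<open>Otherwise \<open>e\<close> would leave the end of the path and hence lie on
        it by \<open>out\<close>.\<close>
      have "fst e \<noteq> snd (last es)" using out[of e "last es"] e n ne by auto
      then have "simple_dipath (e # es)"
        using e True by (intro simple_dipath_Cons sd nsrc ntgt n) auto
      moreover have "e \<in> D" using inD[of e] e WD[of e'] sub by auto
      ultimately have "Q (e # es)" using sub by (simp add: Q_def)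
      then show False using maxl[of "e # es"] by simp
    qed
  qed
  let ?U = "fst ` set es \<union> snd ` set es"
  have touch: "e \<in> set es" if e: "e \<in> E" and t: "fst e \<in> ?U \<or> snd e \<in> ?U" for e
  proof -
    obtain e1 where e1: "e1 \<in> set es" "fst e = fst e1 \<or> fst e = snd e1 \<or> snd e = fst e1 \<or> snd e = snd e1"
      using t by (elim disjE UnE imageE) simp_all
    from e1(2) show ?thesis
    proof (elim disjE)
      show ?thesis if "fst e = fst e1" using src[OF e inE[OF e1(1)] that] e1(1) by simp
      show ?thesis if "fst e = snd e1" by (rule out[OF e that e1(1)])
      show ?thesis if "snd e = fst e1" by (rule into[OF e that e1(1)])
      show ?thesis if "snd e = snd e1" using tgt[OF e inE[OF e1(1)] that] e1(1) by simp
    qed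
  qed
  have UW: "?U \<subseteq> W" using sub WD by auto
  have "W \<subseteq> ?U"
  proof -
    have hd: "fst (hd es) \<in> ?U" using ne by auto
    then have hW: "fst (hd es) \<in> W" using UW by auto
    have "W \<subseteq> weak_reach E (fst (hd es))"
    proof
      fix w assume "w \<in> W"
      have "sym (E \<union> E\<inverse>)" by (auto simp: sym_def)
      then have "(fst (hd es), v) \<in> (E \<union> E\<inverse>)\<^sup>*"
        using hW sym_rtrancl[of "E \<union> E\<inverse>"] by (auto simp: W weak_reach_def dest: symD)
      then show "w \<in> weak_reach E (fst (hd es))"
        using \<open>w \<in> W\<close> by (auto simp: W weak_reach_def)
    qed
    also have "\<dots> \<subseteq> ?U"
    proof (rule weak_reach_subset[OF hd])
      fix u w assume u: "u \<in> ?U" and uw: "(u, w) \<in> E \<or> (w, u) \<in> E"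
      from uw show "w \<in> ?U"
      proof
        assume "(u, w) \<in> E"
        then have "(u, w) \<in> set es" by (rule touch) (use u in auto)
        then show ?thesis using imageI[of "(u, w)" "set es" snd] by simp
      next
        assume "(w, u) \<in> E"
        then have "(w, u) \<in> set es" by (rule touch) (use u in auto)
        then show ?thesis using imageI[of "(w, u)" "set es" fst] by simp
      qed
    qed
    finally show ?thesis .
  qed
  with UW have WU: "W = ?U" by blast
  have "D \<subseteq> set es"
  proof
    fix e assume "e \<in> D"
    then show "e \<in> set es" using touch[of e] WD(1)[of e] DE WU by blast
  qed
  then have "D = set es" using sub by blast
  then show ?thesis using sd WU by blast
qed

definition weak_component :: "('a \<times> 'a) set \<Rightarrow> 'a \<Rightarrow> ('a, 'a \<times> 'a) pre_digraph" where
  "weak_component E v = \<lparr>verts = weak_reach E v, arcs = {e \<in> E. fst e \<in> weak_reach E v}, tail = fst, head = snd\<rparr>"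

text \<open>Connectedness is strong connectedness of the symmetric closure, and reachability there
  is \<open>weak_reach\<close>.\<close>

lemma connected_pair_iff:
  fixes C :: "('a, 'a \<times> 'a) pre_digraph"
  assumes "wf_digraph C" "tail C = fst" "head C = snd"
  shows "Digraph_Component.connected C \<longleftrightarrow>
    verts C \<noteq> {} \<and> (\<forall>u\<in>verts C. verts C \<subseteq> weak_reach (arcs C) u)"
proof -
  interpret wf_digraph C by fact
  interpret M: pair_wf_digraph "mk_symmetric C" by (rule wellformed_mk_symmetric)
  have p: "parcs (mk_symmetric C) = arcs C \<union> (arcs C)\<inverse>"
    using assms by (auto simp: mk_symmetric_def)
  have v: "pverts (mk_symmetric C) = verts C" by (simp add: mk_symmetric_def)
  have "(u \<rightarrow>\<^sup>*\<^bsub>with_proj (mk_symmetric C)\<^esub> w) \<longleftrightarrow> w \<in> weak_reach (arcs C) u"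
    if "u \<in> verts C" "w \<in> verts C" for u w
    unfolding M.reachable_conv weak_reach_def using that by (simp add: v p)
  then show ?thesis
    unfolding Digraph_Component.connected_def strongly_connected_def by (auto simp: v)
qed


lemma weak_reach_sym: "u \<in> weak_reach E v \<Longrightarrow> v \<in> weak_reach E u"
proof -
  have "sym ((E \<union> E\<inverse>)\<^sup>*)" by (intro sym_rtrancl) (auto simp: sym_def)
  then show "u \<in> weak_reach E v \<Longrightarrow> v \<in> weak_reach E u"
    by (auto simp: weak_reach_def dest: symD)
qed

lemma weak_reach_trans:
  "w \<in> weak_reach E u \<Longrightarrow> u \<in> weak_reach E v \<Longrightarrow> w \<in> weak_reach E v"
  unfolding weak_reach_def by (auto intro: rtrancl_trans)

lemma weak_reach_mono: "E \<subseteq> F \<Longrightarrow> weak_reach E v \<subseteq> weak_reach F v"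
  unfolding weak_reach_def using rtrancl_mono[of "E \<union> E\<inverse>" "F \<union> F\<inverse>"] by blast

lemma wf_weak_component: "wf_digraph (weak_component E v)"
proof
  fix e assume "e \<in> arcs (weak_component E v)"
  then have "e \<in> E" "fst e \<in> weak_reach E v" by (auto simp: weak_component_def)
  then show "tail (weak_component E v) e \<in> verts (weak_component E v)"
    "head (weak_component E v) e \<in> verts (weak_component E v)"
    using weak_reach_step[of "fst e" E v "snd e"] by (auto simp: weak_component_def)
qed

lemma weak_component_connected: "Digraph_Component.connected (weak_component E v)"
proof -
  let ?W = "weak_reach E v" and ?A = "arcs (weak_component E v)"
  have A: "?A = {e \<in> E. fst e \<in> ?W}" by (simp add: weak_component_def)
  have "?W \<subseteq> ?W \<inter> weak_reach ?A v"
  proof (rule weak_reach_subset)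
    show "v \<in> ?W \<inter> weak_reach ?A v" by (simp add: weak_reach_refl)
    fix u w assume u: "u \<in> ?W \<inter> weak_reach ?A v" and uw: "(u, w) \<in> E \<or> (w, u) \<in> E"
    then have w: "w \<in> ?W" using weak_reach_step[of u E v w] by simp
    then have "(u, w) \<in> ?A \<or> (w, u) \<in> ?A" using u uw by (auto simp: A)
    then show "w \<in> ?W \<inter> weak_reach ?A v" using w u weak_reach_step[of u ?A v w] by simp
  qed
  then have "w \<in> weak_reach ?A u" if "u \<in> ?W" "w \<in> ?W" for u w
    using that weak_reach_sym[of u ?A v] weak_reach_trans[of w ?A v u] by auto
  moreover have "verts (weak_component E v) = ?W" by (simp add: weak_component_def)
  ultimately show ?thesis
    using connected_pair_iff[OF wf_weak_component, of E v] weak_reach_refl[of v E]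
    by (auto simp: weak_component_def)
qed

context
  fixes H :: "'a pair_pre_digraph"
  assumes wf: "parcs H \<subseteq> pverts H \<times> pverts H"
begin

lemma wf_with_proj: "wf_digraph (with_proj H)"
  using wf by unfold_locales auto

lemma weak_reach_pverts: "v \<in> pverts H \<Longrightarrow> weak_reach (parcs H) v \<subseteq> pverts H"
  by (rule weak_reach_subset) (use wf in auto)

lemma weak_component_subgraph: "v \<in> pverts H \<Longrightarrow> subgraph (weak_component (parcs H) v) (with_proj H)"
  unfolding subgraph_def using weak_reach_pverts[of v] wf_weak_component wf_with_proj
  by (auto simp: weak_component_def compatible_def)

lemma subgraph_weak_componentI:
  assumes C: "subgraph C (with_proj H)" "Digraph_Component.connected C" and v: "v \<in> verts C"
  shows "subgraph C (weak_component (parcs H) v)"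
proof -
  have C': "verts C \<subseteq> pverts H" "arcs C \<subseteq> parcs H" "wf_digraph C" "tail C = fst" "head C = snd"
    using C(1) by (auto simp: subgraph_def compatible_def)
  have "verts C \<subseteq> weak_reach (arcs C) v"
    using C(2) v connected_pair_iff[OF C'(3-5)] by auto
  then have V: "verts C \<subseteq> weak_reach (parcs H) v" using weak_reach_mono[OF C'(2), of v] by auto
  have "fst e \<in> verts C" if "e \<in> arcs C" for e
    using wf_digraph.tail_in_verts[OF C'(3) that] C'(4) by simp
  then show ?thesis
    unfolding subgraph_def using V C' wf_weak_component by (auto simp: weak_component_def compatible_def)
qed

text \<open>A connected subgraph lies inside the weak component of any of its vertices, so the weak
  components are exactly the maximal ones.\<close>

lemma component_iff:
  "component C (with_proj H) \<longleftrightarrow> (\<exists>v\<in>pverts H. C = weak_component (parcs H) v)"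
proof
  assume "component C (with_proj H)"
  then have C: "subgraph C (with_proj H)" "Digraph_Component.connected C"
    and max: "\<And>C'. C' \<noteq> C \<Longrightarrow> subgraph C C' \<Longrightarrow> \<not> (subgraph C' (with_proj H) \<and> Digraph_Component.connected C')"
    unfolding component_def pre_digraph.max_subgraph_def by auto
  obtain v where v: "v \<in> verts C"
    using C(2) by (auto simp: Digraph_Component.connected_def strongly_connected_def mk_symmetric_def)
  then have "v \<in> pverts H" using C(1) by (auto simp: subgraph_def)
  moreover from this have "C = weak_component (parcs H) v"
    using max[of "weak_component (parcs H) v"] subgraph_weak_componentI[OF C v]
      weak_component_subgraph weak_component_connected by metis
  ultimately show "\<exists>v\<in>pverts H. C = weak_component (parcs H) v" by blast
next
  assume "\<exists>v\<in>pverts H. C = weak_component (parcs H) v"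
  then obtain v where v: "v \<in> pverts H" and C: "C = weak_component (parcs H) v" by blast
  have "C' = C" if C': "subgraph C C'" "subgraph C' (with_proj H)" "Digraph_Component.connected C'" for C'
  proof -
    have "v \<in> verts C'"
      using C'(1) weak_reach_refl[of v "parcs H"] by (auto simp: C subgraph_def weak_component_def)
    then have "subgraph C' C" using subgraph_weak_componentI[OF C'(2,3)] C by simp
    then show ?thesis using C'(1)
      by (intro pre_digraph.equality) (auto simp: subgraph_def compatible_def)
  qed
  then show "component C (with_proj H)"
    unfolding component_def pre_digraph.max_subgraph_def
  proof (intro conjI allI impI notI)
    show "subgraph C (with_proj H)" using weak_component_subgraph[OF v] C by simp
    show "Digraph_Component.connected C" using weak_component_connected C by simp
  qed (elim conjE, simp)
qed

end

section \<open>Edges of the polygon and their successors\<close>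

definition edge :: "nat \<Rightarrow> bool \<times> nat \<Rightarrow> nat \<times> nat" where
  "edge m x = (let i = snd x; j = (if Suc i = m then 0 else Suc i) in if fst x then (i, j) else (j, i))"

lemma parcs_BP: "parcs (BP n) = edge (n + 1) ` circ (n + 1)"
proof -
  have *: "(i + 1) mod (n + 1) = (if Suc i = n + 1 then 0 else Suc i)" if "i \<le> n" for i
    using that by auto
  have "parcs (BP n) = (\<Union>i\<in>{0..n}. {edge (n + 1) (True, i), edge (n + 1) (False, i)})"
    unfolding BP_def using * by (simp add: edge_def Let_def)
  also have "\<dots> = edge (n + 1) ` circ (n + 1)"
  proof (intro equalityI subsetI)
    fix e assume "e \<in> edge (n + 1) ` circ (n + 1)"
    then obtain c i where "e = edge (n + 1) (c, i)" "i \<le> n" by (auto simp: circ_def)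
    then show "e \<in> (\<Union>i\<in>{0..n}. {edge (n + 1) (True, i), edge (n + 1) (False, i)})"
      by (cases c) auto
  qed (auto intro!: imageI)
  finally show ?thesis .
qed

text \<open>For \<open>m = 2\<close> this fails: \<open>(True, 0)\<close> and
  \<open>(False, 1)\<close> would both give the edge from 0 to 1.\<close>

lemma edge_inj: "m \<ge> 3 \<Longrightarrow> inj_on (edge m) (circ m)"
  by (rule inj_onI) (auto simp: edge_def Let_def circ_def split: if_splits)

lemma conf_edges:
  assumes "m \<ge> 3" "x \<in> circ m" "y \<in> circ m"
  shows "conf m x y \<longleftrightarrow> x \<noteq> y \<and> (fst (edge m x) = fst (edge m y) \<or> snd (edge m x) = snd (edge m y)
    \<or> (fst (edge m x) = snd (edge m y) \<and> snd (edge m x) = fst (edge m y)))"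
  using assms by (cases x; cases y) (auto simp: conf_def adj_def edge_def Let_def circ_def split: if_splits)

text \<open>Two edges leave the target of \<open>x\<close>: the next one in the same direction and
  the reversal of \<open>x\<close>, which conflicts with \<open>x\<close>. So an independent set
  never changes direction along a path.\<close>

lemma edge_successor:
  assumes "m \<ge> 3" "x \<in> circ m"
  defines "y \<equiv> (fst x, if fst x then (if Suc (snd x) = m then 0 else Suc (snd x)) else (if snd x = 0 then m - 1 else snd x - 1))"
  shows "y \<in> circ m" "fst (edge m y) = snd (edge m x)"
    "\<And>z. z \<in> circ m \<Longrightarrow> fst (edge m z) = snd (edge m x) \<Longrightarrow> \<not> conf m x z \<Longrightarrow> z = y"
proof -
  show "y \<in> circ m" "fst (edge m y) = snd (edge m x)"
    using assms by (auto simp: y_def edge_def Let_def circ_def)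
  show "z = y" if "z \<in> circ m" "fst (edge m z) = snd (edge m x)" "\<not> conf m x z" for z
    using that assms by (cases x; cases z) (auto simp: y_def edge_def Let_def circ_def conf_def adj_def split: if_splits)
qed

lemma cyclic_closed:
  assumes J: "J \<subseteq> {..<m}" "J \<noteq> {}"
    and closed: "\<And>j. j \<in> J \<Longrightarrow> (if c then (if Suc j = m then 0 else Suc j) else (if j = 0 then m - 1 else j - 1)) \<in> J"
  shows "J = {..<m::nat}"
proof (cases c)
  case True
  have fin: "finite J" by (rule finite_subset[OF J(1)]) simp
  have "Max J \<in> J" using fin J(2) by (rule Max_in)
  moreover have "Suc (Max J) \<notin> J" using Max_ge[OF fin, of "Suc (Max J)"] by auto
  ultimately have 0: "0 \<in> J" using closed[of "Max J"] True by (simp split: if_splits)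
  have "j < m \<Longrightarrow> j \<in> J" for j
  proof (induction j)
    case (Suc j)
    then show ?case using closed[of j] True by simp
  qed (use 0 in simp)
  then show ?thesis using J(1) by auto
next
  case False
  have fin: "finite J" by (rule finite_subset[OF J(1)]) simp
  have "Min J \<in> J" using fin J(2) by (rule Min_in)
  have "Min J = 0"
  proof (rule ccontr)
    assume n: "Min J \<noteq> 0"
    then have "Min J - 1 \<in> J" using closed[OF \<open>Min J \<in> J\<close>] False by simp
    from Min_le[OF fin this] n show False by linarith
  qed
  then have "m - 1 \<in> J" using closed[of 0] \<open>Min J \<in> J\<close> False by simp
  then have "k < m \<Longrightarrow> m - 1 - k \<in> J" for k
  proof (induction k)
    case (Suc k)
    then show ?case using closed[of "m - 1 - k"] False by simp
  qed simp
  then have "j \<in> J" if "j < m" for j using that \<open>\<And>k. k < m \<Longrightarrow> m - 1 - k \<in> J\<close>[of "m - 1 - j"] by simp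
  then show ?thesis using J(1) by auto
qed

section \<open>The multipath complex of the polygon\<close>

lemma multipath_dipath:
  assumes H: "multipath H (BP n)" and e: "e \<in> parcs H"
  obtains es where "simple_dipath es" "set es = {e' \<in> parcs H. fst e' \<in> weak_reach (parcs H) (fst e)}"
proof -
  have sub: "subgraph (with_proj H) (with_proj (BP n))"
    and comp: "\<And>C. component C (with_proj H) \<Longrightarrow> is_single_vertex C \<or> is_simple_dipath C"
    using H by (auto simp: multipath_def spanning_def)
  have wf: "parcs H \<subseteq> pverts H \<times> pverts H"
  proof
    fix e assume "e \<in> parcs H"
    moreover have "wf_digraph (with_proj H)" using sub by (simp add: subgraph_def)
    ultimately have "fst e \<in> pverts H" "snd e \<in> pverts H"
      using wf_digraph.tail_in_verts[of "with_proj H" e] wf_digraph.head_in_verts[of "with_proj H" e] by auto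
    then show "e \<in> pverts H \<times> pverts H" by (simp add: mem_Times_iff)
  qed
  let ?C = "weak_component (parcs H) (fst e)"
  have "fst e \<in> pverts H" using wf e by auto
  then have "component ?C (with_proj H)" using component_iff[OF wf] by blast
  moreover have "e \<in> arcs ?C" using e by (simp add: weak_component_def weak_reach_refl)
  ultimately have "is_simple_dipath ?C" using comp by (auto simp: is_single_vertex_def)
  then obtain es where "simple_dipath es" "arcs ?C = set es" by (auto simp: is_simple_dipath_def)
  then show ?thesis using that by (simp add: weak_component_def)
qed

lemma multipath_complex_BP_subset:
  assumes n: "n \<ge> 2" and H: "multipath H (BP n)" and ne: "parcs H \<noteq> {}"
  shows "parcs H \<in> (`) (edge (n + 1)) ` circ_complex (n + 1)"
proof -
  define m where "m = n + 1"
  have m: "m \<ge> 3" "m \<ge> 1" using n by (auto simp: m_def)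
  let ?E = "parcs H"
  have EB: "?E \<subseteq> edge m ` circ m"
    using H parcs_BP[of n] by (auto simp: multipath_def spanning_def subgraph_def m_def)
  define t where "t = {x \<in> circ m. edge m x \<in> ?E}"
  have tE: "edge m ` t = ?E" using EB by (auto simp: t_def)
  have tc: "t \<subseteq> circ m" by (auto simp: t_def)
  have inE: "edge m x \<in> ?E" if "x \<in> t" for x using that by (simp add: t_def)
  \<comment> \<open>Edges in conflict share a vertex, hence lie in one component and on one simple
    path. A common source or target violates its injectivity, and a 2-cycle violates its
    acyclicity.\<close>
  have noconf: False if xy: "x \<in> t" "y \<in> t" "conf m x y" for x y
  proof -
    have xy': "x \<in> circ m" "y \<in> circ m" using xy tc by auto
    note c = xy(3)[unfolded conf_edges[OF m(1) xy']]
    have neq: "edge m x \<noteq> edge m y" using c edge_inj[OF m(1)] xy' by (auto dest: inj_onD)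
    obtain es where es: "simple_dipath es"
      "set es = {e' \<in> ?E. fst e' \<in> weak_reach ?E (fst (edge m x))}"
      by (rule multipath_dipath[OF H inE[OF xy(1)]])
    have st: "w \<in> weak_reach ?E u" if "(u, w) \<in> ?E \<or> (w, u) \<in> ?E" for u w
      using weak_reach_step[OF weak_reach_refl[of u ?E], of w] that by simp
    have ex: "edge m x \<in> ?E" "edge m y \<in> ?E" using inE xy by auto
    have sx: "snd (edge m x) \<in> weak_reach ?E (fst (edge m x))" using st[of "fst (edge m x)" "snd (edge m x)"] ex by simp
    have fy: "fst (edge m y) \<in> weak_reach ?E (snd (edge m y))" using st[of "snd (edge m y)" "fst (edge m y)"] ex by simp
    have "fst (edge m y) \<in> weak_reach ?E (fst (edge m x))"
      using c sx fy weak_reach_trans[of "fst (edge m y)" ?E "snd (edge m y)" "fst (edge m x)"]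
        weak_reach_refl[of "fst (edge m x)" ?E] by auto
    then have mem: "edge m x \<in> set es" "edge m y \<in> set es"
      using es(2) ex weak_reach_refl[of "fst (edge m x)" ?E] by auto
    then obtain i j where ij: "i < length es" "es ! i = edge m x" "j < length es" "es ! j = edge m y"
      by (auto simp: in_set_conv_nth)
    then have "\<not> (fst (edge m x) = fst (edge m y) \<or> snd (edge m x) = snd (edge m y))"
      using es(1) neq unfolding simple_dipath_def by metis
    then have back_forth: "fst (edge m x) = snd (edge m y)" "snd (edge m x) = fst (edge m y)" using c by auto
    show False
    proof (rule simple_dipath_acyclic[OF es(1), of "{edge m x, edge m y}"])
      show "\<exists>e'\<in>{edge m x, edge m y}. fst e' = snd e" if "e \<in> {edge m x, edge m y}" for e
        using that back_forth by auto
    qed (use mem in auto)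
  qed
  have "t \<in> indep (conf m) (circ m)"
    using noconf tc tE ne by (auto simp: indep_def)
  \<comment> \<open>A full cycle is connected, so a single simple path would contain all its edges
    although each of them has a successor.\<close>
  moreover have "t \<noteq> full_cycle c m" for c
  proof
    assume t: "t = full_cycle c m"
    have ct: "(c, i) \<in> t" if "i < m" for i using that t by (simp add: full_cycle_def)
    have reach: "i < m \<Longrightarrow> i \<in> weak_reach ?E 0" for i
    proof (induction i)
      case (Suc i)
      have "(i, Suc i) \<in> ?E \<or> (Suc i, i) \<in> ?E"
        using inE[OF ct[of i]] Suc.prems by (cases c) (auto simp: edge_def Let_def split: if_splits)
      then show ?case using weak_reach_step[OF Suc.IH] Suc.prems by simp
    qed (rule weak_reach_refl)
    have lt: "fst e < m" if "e \<in> ?E" for e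
      using that EB by (auto simp: edge_def Let_def circ_def split: if_splits)
    let ?e0 = "edge m (c, 0)"
    have e0: "?e0 \<in> ?E" using inE[OF ct[of 0]] m by simp
    obtain es where es: "simple_dipath es"
      "set es = {e' \<in> ?E. fst e' \<in> weak_reach ?E (fst ?e0)}"
      by (rule multipath_dipath[OF H e0])
    have "?E \<subseteq> set es"
    proof
      fix e assume e: "e \<in> ?E"
      have "fst e \<in> weak_reach ?E (fst ?e0)"
        using weak_reach_trans[OF reach[OF lt[OF e]] weak_reach_sym[OF reach[OF lt[OF e0]]]] .
      then show "e \<in> set es" using e es(2) by simp
    qed
    moreover have "\<exists>e'\<in>?E. fst e' = snd e" if "e \<in> ?E" for e
    proof -
      have "e \<in> edge m ` t" using that tE by simp
      then obtain x where x: "x \<in> t" "e = edge m x" by auto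
      have "x \<in> full_cycle c m" using x(1) by (simp only: t)
      then have xc: "x \<in> circ m" "fst x = c" using subsetD[OF tc x(1)] by (auto simp: full_cycle_def)
      note y = edge_successor(1,2)[OF m(1) xc(1)]
      show ?thesis
      proof (rule bexI)
        show "fst (edge m (fst x, if fst x then (if Suc (snd x) = m then 0 else Suc (snd x)) else (if snd x = 0 then m - 1 else snd x - 1))) = snd e"
          using y x by simp
        show "edge m (fst x, if fst x then (if Suc (snd x) = m then 0 else Suc (snd x)) else (if snd x = 0 then m - 1 else snd x - 1)) \<in> ?E"
          by (rule inE) (use y(1) xc ct in \<open>simp add: circ_def\<close>)
      qed
    qed
    ultimately show False using simple_dipath_acyclic[OF es(1), of ?E] ne by blast
  qed
  ultimately have "t \<in> circ_complex m" by (simp add: circ_complex_def)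
  then show ?thesis using tE by (auto simp: m_def)
qed

lemma circ_complex_multipath:
  assumes n: "n \<ge> 2" and t: "t \<in> circ_complex (n + 1)"
  shows "edge (n + 1) ` t \<in> multipath_complex (BP n)"
proof -
  define m where "m = n + 1"
  have m: "m \<ge> 3" "m \<ge> 1" using n by (auto simp: m_def)
  have tI: "t \<in> indep (conf m) (circ m)" and tcl: "t \<noteq> full_cycle c m" for c
    using t by (cases c; simp add: circ_complex_def m_def)+
  have tc: "t \<subseteq> circ m" and noconf: "\<And>x y. x \<in> t \<Longrightarrow> y \<in> t \<Longrightarrow> \<not> conf m x y" and tne: "t \<noteq> {}"
    using tI by (auto simp: indep_def)
  define E where "E = edge m ` t"
  define H where "H = \<lparr>pverts = {0..n}, parcs = E\<rparr>"
  have pH: "pverts H = {0..n}" "parcs H = E" by (auto simp: H_def)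
  have finE: "finite E" using finite_subset[OF tc] by (simp add: E_def)
  have wf: "parcs H \<subseteq> pverts H \<times> pverts H"
    using tc unfolding pH E_def by (auto simp: edge_def Let_def circ_def m_def split: if_splits)
  have wfB: "parcs (BP n) \<subseteq> pverts (BP n) \<times> pverts (BP n)"
    unfolding parcs_BP by (auto simp: BP_def edge_def Let_def circ_def split: if_splits)
  have span: "spanning (with_proj H) (with_proj (BP n))"
  proof -
    have "E \<subseteq> parcs (BP n)" using tc parcs_BP[of n] by (auto simp: E_def m_def)
    then show ?thesis
      using wf_with_proj[OF wf] wf_with_proj[OF wfB]
      by (simp add: spanning_def subgraph_def compatible_def pH BP_def)
  qed
  have src: "e = e'" if "e \<in> E" "e' \<in> E" "fst e = fst e'" for e e'
  proof -
    obtain x y where "x \<in> t" "y \<in> t" "e = edge m x" "e' = edge m y" using \<open>e \<in> E\<close> \<open>e' \<in> E\<close> by (auto simp: E_def)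
    then show ?thesis using noconf[of x y] conf_edges[OF m(1), of x y] tc that(3) by auto
  qed
  have tgt: "e = e'" if "e \<in> E" "e' \<in> E" "snd e = snd e'" for e e'
  proof -
    obtain x y where "x \<in> t" "y \<in> t" "e = edge m x" "e' = edge m y" using \<open>e \<in> E\<close> \<open>e' \<in> E\<close> by (auto simp: E_def)
    then show ?thesis using noconf[of x y] conf_edges[OF m(1), of x y] tc that(3) by auto
  qed
  \<comment> \<open>Following successors keeps the direction and never stops, so it visits every
    position; \<open>t\<close> would contain a full cycle and equal it by maximality.\<close>
  have acyc: "\<exists>e\<in>C. \<forall>e'\<in>C. fst e' \<noteq> snd e" if C: "C \<subseteq> E" "C \<noteq> {}" for C
  proof (rule ccontr)
    assume "\<not> ?thesis"
    then have cl: "\<And>e. e \<in> C \<Longrightarrow> \<exists>e'\<in>C. fst e' = snd e" by auto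
    obtain e0 where "e0 \<in> C" "e0 \<in> E" using C by auto
    then obtain x0 where x0: "x0 \<in> t" "edge m x0 \<in> C" by (auto simp: E_def)
    define c where "c = fst x0"
    define J where "J = {j. (c, j) \<in> t \<and> edge m (c, j) \<in> C}"
    have "J = {..<m}"
    proof (rule cyclic_closed[where c = c])
      show "J \<subseteq> {..<m}" using tc by (auto simp: J_def circ_def)
      have "snd x0 \<in> J" using x0 by (simp add: J_def c_def)
      then show "J \<noteq> {}" by auto
      fix j assume j: "j \<in> J"
      then have cj: "(c, j) \<in> t" "(c, j) \<in> circ m" "edge m (c, j) \<in> C" using tc by (auto simp: J_def)
      obtain e' where e': "e' \<in> C" "fst e' = snd (edge m (c, j))" using cl[OF cj(3)] by auto
      then obtain z where z: "z \<in> t" "e' = edge m z" using C(1) by (auto simp: E_def)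
      have "z = (c, if c then (if Suc j = m then 0 else Suc j) else (if j = 0 then m - 1 else j - 1))"
        using edge_successor(3)[OF m(1) cj(2), of z] z e' noconf[OF cj(1) z(1)] tc by auto
      then show "(if c then (if Suc j = m then 0 else Suc j) else (if j = 0 then m - 1 else j - 1)) \<in> J"
        using z e' by (simp only: J_def mem_Collect_eq)
    qed
    then have "full_cycle c m \<subseteq> t" by (auto simp: J_def full_cycle_def)
    then have "t = full_cycle c m" by (rule full_cycle_facet(2)[OF m(2) tI])
    then show False using tcl by simp
  qed
  have "is_single_vertex C \<or> is_simple_dipath C" if C: "component C (with_proj H)" for C
  proof -
    obtain v where v: "v \<in> pverts H" "C = weak_component E v"
      using C component_iff[OF wf] pH by auto
    define W where "W = weak_reach E v"
    define D where "D = {e \<in> E. fst e \<in> W}"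
    have vC: "verts C = W" "arcs C = D" using v by (auto simp: weak_component_def W_def D_def)
    show ?thesis
    proof (cases "D = {}")
      case True
      have "W \<subseteq> {v}"
        unfolding W_def
      proof (rule weak_reach_subset)
        fix u w assume u: "u \<in> {v}" and uw: "(u, w) \<in> E \<or> (w, u) \<in> E"
        have "u \<in> W" using u weak_reach_refl[of v E] by (simp add: W_def)
        moreover from this have "w \<in> W" using uw weak_reach_step[of u E v w] by (simp add: W_def)
        ultimately have "D \<noteq> {}" using uw by (auto simp: D_def)
        then show "w \<in> {v}" using True by simp
      qed simp
      then have "W = {v}" using weak_reach_refl[of v E] by (auto simp: W_def)
      then show ?thesis using True vC by (simp add: is_single_vertex_def)
    next
      case False
      have "\<exists>es. simple_dipath es \<and> D = set es \<and> W = fst ` set es \<union> snd ` set es"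
        by (rule dipath_of_linear_component[OF finE src tgt acyc W_def D_def False])
      then show ?thesis using vC by (auto simp: is_simple_dipath_def)
    qed
  qed
  then have "multipath H (BP n)" using span by (simp add: multipath_def)
  moreover have "parcs H = edge (n + 1) ` t" by (simp add: pH E_def m_def)
  moreover have "parcs H \<noteq> {}" using tne by (simp add: pH E_def)
  ultimately show ?thesis unfolding multipath_complex_def by (metis (mono_tags, lifting) mem_Collect_eq)
qed

lemma multipath_complex_BP:
  assumes "n \<ge> 2"
  shows "multipath_complex (BP n) = (`) (edge (n + 1)) ` circ_complex (n + 1)"
proof (intro equalityI subsetI)
  fix s assume "s \<in> multipath_complex (BP n)"
  then show "s \<in> (`) (edge (n + 1)) ` circ_complex (n + 1)"
    using multipath_complex_BP_subset[OF assms] by (auto simp: multipath_complex_def)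
qed (use circ_complex_multipath[OF assms] in auto)

lemma geometric_realization_BP:
  assumes "n \<ge> 2"
  obtains f g where "homeomorphic_maps (geometric_realization (circ_complex (n + 1)))
    (geometric_realization (multipath_complex (BP n))) f g"
proof -
  have "\<Union>(circ_complex (n + 1)) \<subseteq> circ (n + 1)" by (auto simp: circ_complex_def indep_def)
  then have "inj_on (edge (n + 1)) (\<Union>(circ_complex (n + 1)))"
    using edge_inj[of "n + 1"] assms by (auto intro: inj_on_subset)
  then show ?thesis
    using geometric_realization_relabel[OF simplicial_complex_circ_complex(2)[of "n + 1"], of "edge (n + 1)"] that
    by (simp add: multipath_complex_BP[OF assms])
qed

section \<open>Failure of connectedness\<close>

lemma nullhomotopic_reduced_trivial:
  assumes "homotopic_with (\<lambda>_. True) X Y f (\<lambda>_. c)" "topspace X \<noteq> {}" "a \<in> carrier (reduced_homology_group p X)"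
  shows "hom_induced p X {} Y {} f a = \<one>\<^bsub>homology_group p Y\<^esub>"
proof -
  let ?pt = "discrete_topology {()}"
  have cont: "continuous_map X Y (\<lambda>_. c)" using assms(1) homotopic_with_imp_continuous_maps by blast
  then have c: "c \<in> topspace Y" using assms(2) by simp
  have "hom_induced p X {} Y {} f a = hom_induced p X {} Y {} (\<lambda>_. c) a"
    using homology_homotopy_empty[OF assms(1)] by simp
  \<comment> \<open>A constant map factors through a point, where reduced classes vanish by
    definition.\<close>
  also have "(\<lambda>_. c) = (\<lambda>_. c) \<circ> (\<lambda>x. ())" by auto
  also have "hom_induced p X {} Y {} \<dots> a = hom_induced p ?pt {} Y {} (\<lambda>_. c) (hom_induced p X {} ?pt {} (\<lambda>x. ()) a)"
    by (rule hom_induced_compose'[symmetric]) (use c in auto)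
  also have "hom_induced p X {} ?pt {} (\<lambda>x. ()) a = \<one>\<^bsub>homology_group p ?pt\<^esub>"
    using assms(3) by (simp add: carrier_reduced_homology_group kernel_def)
  also have "hom_induced p ?pt {} Y {} (\<lambda>_. c) \<dots> = \<one>\<^bsub>homology_group p Y\<^esub>"
    by (rule hom_one[OF hom_induced_empty_hom]) auto
  finally show ?thesis .
qed

text \<open>Distinct odd positions are never adjacent when 0 is left out, so opposite vertices are
  the only conflicts. Avoiding position 0 also keeps the image clear of the full cycles.\<close>

definition odd_vertex :: "bool \<times> nat \<Rightarrow> bool \<times> nat" where
  "odd_vertex x = (fst x, 2 * snd x + 1)"

text \<open>Positions \<open>2 * k + 1\<close> and \<open>2 * k + 2\<close> both go to
  \<open>k\<close>. This is simplicial on the block because equal images come from equal or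
  neighbouring positions, where different directions conflict.\<close>

definition odd_retract :: "bool \<times> nat \<Rightarrow> bool \<times> nat" where
  "odd_retract x = (fst x, (snd x - 1) div 2)"

lemma odd_vertex_simplex:
  assumes "m \<ge> 3" "t \<in> cross_polytope (m div 2 - 1)"
  shows "odd_vertex ` t \<in> indep (conf m) (block (m - 1) 1)" "odd_vertex ` t \<in> circ_complex m"
proof -
  have t: "t \<noteq> {}" "\<And>x. x \<in> t \<Longrightarrow> snd x \<le> m div 2 - 1" "\<And>x y. x \<in> t \<Longrightarrow> y \<in> t \<Longrightarrow> \<not> opposite x y"
    using assms(2) by (auto simp: cross_polytope_def indep_def cross_vertices_def)
  have lt: "2 * snd x + 1 < m" if "x \<in> t" for x using t(2)[OF that] assms(1) by linarith
  have nc: "\<not> conf m (odd_vertex x) (odd_vertex y)" if "x \<in> t" "y \<in> t" for x y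
  proof
    assume c: "conf m (odd_vertex x) (odd_vertex y)"
    then have "fst x \<noteq> fst y" by (simp add: conf_def odd_vertex_def)
    moreover have "snd x = snd y"
    proof -
      have "snd x = snd y \<or> Suc (2 * snd x) = 2 * snd y \<or> Suc (2 * snd y) = 2 * snd x"
        using c by (auto simp: conf_def adj_def odd_vertex_def)
      then show ?thesis by presburger
    qed
    ultimately show False using t(3)[OF that] by (simp add: opposite_def)
  qed
  then show 1: "odd_vertex ` t \<in> indep (conf m) (block (m - 1) 1)"
  proof -
    have "odd_vertex x \<in> block (m - 1) 1" if "x \<in> t" for x
      unfolding block_def odd_vertex_def using lt[OF that] by (simp add: less_diff_conv)
    then show ?thesis using t(1) nc by (auto simp: indep_def)
  qed
  have "odd_vertex ` t \<noteq> full_cycle c m" for c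
  proof
    assume "odd_vertex ` t = full_cycle c m"
    moreover have "(c, 0) \<in> full_cycle c m" using assms(1) by (simp add: full_cycle_def)
    ultimately show False by (auto simp: odd_vertex_def)
  qed
  then show "odd_vertex ` t \<in> circ_complex m"
    using 1 by (auto simp: circ_complex_def indep_def block_def circ_def)
qed

lemma odd_retract_simplex:
  assumes "m \<ge> 3" "t \<in> indep (conf m) (block (m - 1) 1)"
  shows "odd_retract ` t \<in> cross_polytope (m div 2 - 1)"
proof -
  have t: "t \<noteq> {}" "\<And>x. x \<in> t \<Longrightarrow> 1 \<le> snd x \<and> snd x < m" "\<And>x y. x \<in> t \<Longrightarrow> y \<in> t \<Longrightarrow> \<not> conf m x y"
    using assms by (auto simp: indep_def block_def)
  have "\<not> opposite (odd_retract x) (odd_retract y)" if "x \<in> t" "y \<in> t" for x y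
  proof
    assume o: "opposite (odd_retract x) (odd_retract y)"
    have "snd x = snd y \<or> Suc (snd x) = snd y \<or> Suc (snd y) = snd x"
    proof -
      have "(snd x - 1) div 2 = (snd y - 1) div 2" using o by (simp add: opposite_def odd_retract_def)
      then show ?thesis using t(2)[OF that(1)] t(2)[OF that(2)] by linarith
    qed
    then show False using o t(3)[OF that] by (auto simp: opposite_def odd_retract_def conf_def adj_def)
  qed
  moreover have "(snd x - 1) div 2 \<le> m div 2 - 1" if "x \<in> t" for x using t(2)[OF that] by linarith
  ultimately show ?thesis
    using t(1) by (auto simp: cross_polytope_def indep_def cross_vertices_def odd_retract_def)
qed

lemma continuous_map_realization_inclusion:
  "K \<subseteq> L \<Longrightarrow> continuous_map (geometric_realization K) (geometric_realization L) id"
  unfolding geometric_realization_eq by (auto simp: realized_def intro: continuous_on_id')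

text \<open>The two vertices at position 0 are put back one after the other. Each inclusion is
  injective in degree \<open>m div 2 - 1\<close> because the link has no homology there, which is
  where residue 1 is excluded.\<close>

lemma circ_block_incl_inj:
  assumes m: "m \<ge> 3" "m mod 4 \<noteq> 1"
  defines "B \<equiv> geometric_realization (indep (conf m) (block (m - 1) 1))"
    and "I \<equiv> geometric_realization (indep (conf m) (circ m))"
  shows "continuous_map B I id"
    "inj_on (hom_induced (int (m div 2) - 1) B {} I {} id) (carrier (reduced_homology_group (int (m div 2) - 1) B))"
proof -
  let ?V = "circ m - {(True, 0)}"
  let ?M = "geometric_realization (indep (conf m) ?V)"
  let ?p = "int (m div 2) - 1"
  have in0: "(True, 0) \<in> circ m" "(False, 0) \<in> ?V" using m by auto
  have fin: "finite (circ m)" "finite ?V" by auto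
  note f1 = conf.face_vertex[of "circ m" "(True, 0)" m, OF fin(1) in0(1)]
  note f2 = conf.face_vertex[of ?V "(False, 0)" m, OF fin(2) in0(2)]
  note blk = circ_links(3)[OF m(1)]
  have z: "ladder_rank (m - 2) ?p = 0" using m(2) by (simp add: ladder_rank_circ[OF m(1)] delta_def)
  note T = circ_link_types[OF m(1), unfolded conf.ht_def]
  have ne: "{(True, 1)} \<in> indep (conf m) (block (m - 1) 1)" "{(True, 1)} \<in> indep (conf m) ?V"
    using m by (auto simp: indep_def conf_def)
  have mono: "continuous_map (geometric_realization (indep (conf m) U)) (geometric_realization (indep (conf m) W)) id"
    if "U \<subseteq> W" for U W
    by (rule continuous_map_realization_inclusion) (use that in \<open>auto simp: indep_def\<close>)
  have sub: "block (m - 1) 1 \<subseteq> ?V" "?V \<subseteq> circ m" "block (m - 1) 1 \<subseteq> circ m" using blk by auto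
  show "continuous_map B I id" unfolding B_def I_def by (rule mono[OF sub(3)])
  have 1: "inj_on (hom_induced ?p ?M {} I {} id) (carrier (reduced_homology_group ?p ?M))"
    using face.incl_inj[OF f1(1), of "ladder_rank (m - 2)" ?p] T(1) z ne(2) unfolding f1(2,3) I_def by auto
  have 2: "inj_on (hom_induced ?p B {} ?M {} id) (carrier (reduced_homology_group ?p B))"
    using face.incl_inj[OF f2(1), of "ladder_rank (m - 2)" ?p] T(2) z ne(1) unfolding f2(2,3) blk B_def by auto
  have comp: "hom_induced ?p B {} I {} id a = hom_induced ?p ?M {} I {} id (hom_induced ?p B {} ?M {} id a)" for a
    using hom_induced_compose'[of B ?M id "{}" "{}" I id "{}" ?p a] mono[OF sub(1)] mono[OF sub(2)]
    by (simp add: B_def I_def)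
  show "inj_on (hom_induced ?p B {} I {} id) (carrier (reduced_homology_group ?p B))"
  proof (rule inj_onI)
    fix a b assume a: "a \<in> carrier (reduced_homology_group ?p B)" and b: "b \<in> carrier (reduced_homology_group ?p B)"
      and eq: "hom_induced ?p B {} I {} id a = hom_induced ?p B {} I {} id b"
    have "hom_induced ?p B {} ?M {} id a = hom_induced ?p B {} ?M {} id b"
      using inj_onD[OF 1 eq[unfolded comp]] hom_induced_reduced[OF a] hom_induced_reduced[OF b] by blast
    then show "a = b" using inj_onD[OF 2] a b by blast
  qed
qed

lemma circ_complex_not_connected:
  assumes m: "m \<ge> 3" "m mod 4 \<noteq> 1" and Y: "homeomorphic_maps (geometric_realization (circ_complex m)) Y h h'"
  shows "\<not> k_connected (int (m div 2) - 1) Y"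
proof
  assume k: "k_connected (int (m div 2) - 1) Y"
  define d where "d = m div 2 - 1"
  have d: "int d = int (m div 2) - 1" using m by (simp add: d_def of_nat_diff)
  let ?O = "geometric_realization (cross_polytope d)"
  let ?X = "geometric_realization (circ_complex m)"
  let ?B = "geometric_realization (indep (conf m) (block (m - 1) 1))"
  let ?I = "geometric_realization (indep (conf m) (circ m))"
  let ?Vo = "\<Union>(cross_polytope d)"
  let ?Vb = "\<Union>(indep (conf m) (block (m - 1) 1))"
  let ?f = "push ?Vo odd_vertex" and ?r = "push ?Vb odd_retract"
  note cO = simplicial_complex_cross_polytope[of d]
  have cB: "simplicial_complex (indep (conf m) (block (m - 1) 1))"
    by (rule conf.simplicial_complex_indep) simp
  have cX: "simplicial_complex (circ_complex m)" using simplicial_complex_circ_complex(2) m by simp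
  have fX: "continuous_map ?O ?X ?f"
    unfolding geometric_realization_eq
    using push_in[OF cO cX odd_vertex_simplex(2)[OF m(1), folded d_def]] continuous_push by auto
  have fB: "continuous_map ?O ?B ?f"
    unfolding geometric_realization_eq
    using push_in[OF cO cB odd_vertex_simplex(1)[OF m(1), folded d_def]] continuous_push by auto
  have rO: "continuous_map ?B ?O ?r"
    unfolding geometric_realization_eq
    using push_in[OF cB cO odd_retract_simplex[OF m(1), folded d_def]] continuous_push by auto
  have rf: "?r (?f x) = x" if "x \<in> topspace ?O" for x
  proof -
    have "odd_vertex ` ?Vo \<subseteq> ?Vb"
      using odd_vertex_simplex(1)[OF m(1), folded d_def] by blast
    then have "?r (?f x) = push ?Vo (odd_retract \<circ> odd_vertex) x"
      by (intro push_compose simplicial_complexD(1) cO cB)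
    also have "\<dots> = x"
    proof (rule push_fix)
      show "finite ?Vo" by (rule simplicial_complexD(1)[OF cO])
      show "v \<in> ?Vo \<and> (odd_retract \<circ> odd_vertex) v = v" if "x v \<noteq> 0" for v
        using realized_support[of x "cross_polytope d" v] \<open>x \<in> topspace ?O\<close> that
        by (auto simp: geometric_realization_eq odd_retract_def odd_vertex_def)
    qed
    finally show ?thesis .
  qed
  have h: "continuous_map ?X Y h" "continuous_map Y ?X h'" "\<And>x. x \<in> topspace ?X \<Longrightarrow> h' (h x) = x"
    using Y by (auto simp: homeomorphic_maps_def)
  \<comment> \<open>The contraction is moved on to \<open>?I\<close>, where the full cycles are
    filled in, since that is where injectivity from the block is known.\<close>
  have XI: "continuous_map ?X ?I id"
    by (rule continuous_map_realization_inclusion) (auto simp: circ_complex_def)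
  obtain c where c: "homotopic_with (\<lambda>_. True) ?O Y (h \<circ> ?f) (\<lambda>_. c)"
    using cross_polytope_nullhomotopic[of d Y "h \<circ> ?f"] k d continuous_map_compose[OF fX h(1)] by auto
  have "homotopic_with (\<lambda>_. True) ?O ?I (h' \<circ> (h \<circ> ?f)) (h' \<circ> (\<lambda>_. c))"
    by (rule homotopic_with_compose_continuous_map_left[OF c]) (use continuous_map_compose[OF h(2) XI] in auto)
  moreover have "homotopic_with (\<lambda>_. True) ?O ?I ?f (h' \<circ> (h \<circ> ?f))"
    by (rule homotopic_with_equal)
      (use continuous_map_compose[OF fX XI] h(3) continuous_map_image_subset_topspace[OF fX] in auto)
  ultimately have "homotopic_with (\<lambda>_. True) ?O ?I ?f (h' \<circ> (\<lambda>_. c))"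
    by (rule homotopic_with_trans[rotated])
  then have null: "homotopic_with (\<lambda>_. True) ?O ?I ?f (\<lambda>_. h' c)" by (simp add: o_def)
  have neO: "cross_polytope d \<noteq> {}"
  proof -
    have "{(True, 0)} \<in> cross_polytope d"
      by (auto simp: cross_polytope_def indep_def cross_vertices_def opposite_def)
    then show ?thesis by auto
  qed
  then have neO': "topspace ?O \<noteq> {}"
    using realized_empty_iff[OF cO] by (simp add: geometric_realization_eq)
  \<comment> \<open>A class of the sphere dies in \<open>?I\<close>, hence already in
    \<open>?B\<close> by injectivity, hence in the sphere itself, which is a retract of
    \<open>?B\<close>. This contradicts rank 1 in degree \<open>d\<close>.\<close>
  have "trivial_group (reduced_homology_group (int d) ?O)"
  proof -
    have "a = \<one>\<^bsub>reduced_homology_group (int d) ?O\<^esub>" if a: "a \<in> carrier (reduced_homology_group (int d) ?O)" for a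
    proof -
      let ?b = "hom_induced (int d) ?O {} ?B {} ?f a"
      have b: "?b \<in> carrier (reduced_homology_group (int d) ?B)" using hom_induced_reduced[OF a] .
      note inj = circ_block_incl_inj[OF m]
      have "hom_induced (int d) ?B {} ?I {} id ?b = hom_induced (int d) ?O {} ?I {} (id \<circ> ?f) a"
        by (rule hom_induced_compose') (use fB inj(1) in auto)
      also have "\<dots> = \<one>\<^bsub>homology_group (int d) ?I\<^esub>"
        using nullhomotopic_reduced_trivial[OF null neO' a] by simp
      also have "\<dots> = hom_induced (int d) ?B {} ?I {} id \<one>\<^bsub>homology_group (int d) ?B\<^esub>"
        by (rule hom_one[symmetric, OF hom_induced_empty_hom]) auto
      finally have "?b = \<one>\<^bsub>homology_group (int d) ?B\<^esub>"
        using inj_onD[OF inj(2)[folded d]] b group.is_monoid[THEN monoid.one_closed, OF group_reduced_homology_group]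
        by (metis one_reduced_homology_group)
      then have "hom_induced (int d) ?B {} ?O {} ?r ?b = \<one>\<^bsub>homology_group (int d) ?O\<^esub>"
        using hom_one[OF hom_induced_empty_hom[of "int d" ?B ?O ?r]] by simp
      moreover have "hom_induced (int d) ?B {} ?O {} ?r ?b = hom_induced (int d) ?O {} ?O {} (?r \<circ> ?f) a"
        by (rule hom_induced_compose') (use fB rO in auto)
      moreover have "hom_induced (int d) ?O {} ?O {} (?r \<circ> ?f) a = a"
      proof (rule hom_induced_id_gen[OF continuous_map_compose[OF fB rO]])
        show "a \<in> carrier (homology_group (int d) ?O)" using a carrier_reduced_homology_group_subset by blast
        show "(?r \<circ> ?f) x = x" if "x \<in> topspace ?O" for x using rf[OF that] by simp
      qed
      ultimately show ?thesis by (simp add: one_reduced_homology_group)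
    qed
    then show ?thesis
      by (auto simp: trivial_group_def intro: group.is_monoid[THEN monoid.one_closed])
  qed
  moreover have "reduced_homology_group (int d) ?O \<cong> free_rank (delta (int d) (int d))"
    using cross_polytope_type[of d] neO by (simp add: homology_type_def)
  then have "reduced_homology_group (int d) ?O \<cong> free_rank 1" by (simp add: delta_def)
  ultimately have "trivial_group (free_rank 1)"
    using isomorphic_group_triviality[of "reduced_homology_group (int d) ?O" "free_rank 1"] by simp
  then show False using free_rank_trivial_iff[of 1] by simp
qed

theorem theorem2p10:
  fixes n :: nat
  assumes "n \<ge> 2"
  defines "X \<equiv> geometric_realization (multipath_complex (BP n))"
  defines "\<nu> \<equiv> (int n - 1) div 2 - 1"
  shows "(\<forall>i::int. homology_group i X \<cong>
            Z_pow ((if i = 0 then 1 else 0)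
                 + (if i = int n - 1 then 2 else 0)
                 + (if i = (int n - 1) div 2 \<and> (n mod 4 = 1 \<or> n mod 4 = 2) then 1 else 0)
                 + (if i = (int n - 1) div 2 \<and> n mod 4 = 3 then 3 else 0)
                 + (if i = (int n - 1) div 2 + 1 \<and> n mod 4 = 0 then 1 else 0)))
         \<and> (n mod 4 = 1 \<or> n mod 4 = 2 \<or> n mod 4 = 3 \<longrightarrow> \<not> k_connected (\<nu> + 1) X)"
proof -
  have m: "n + 1 \<ge> 3" using assms(1) by simp
  obtain h h' where hom: "homeomorphic_maps (geometric_realization (circ_complex (n + 1))) X h h'"
    using geometric_realization_BP[OF assms(1)] unfolding X_def by blast
  \<comment> \<open>With \<open>m = n + 1\<close>, the degree \<open>m div 2 - 1\<close> is the
    floor of \<open>(n - 1) / 2\<close>, and \<open>m div 2\<close> is one more.\<close>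
  have half: "int ((n + 1) div 2) = (int n - 1) div 2 + 1" by linarith
  have cases: "n mod 4 = 0 \<or> n mod 4 = 1 \<or> n mod 4 = 2 \<or> n mod 4 = 3" by linarith
  have mod: "(n + 1) mod 4 = (if n mod 4 = 3 then 0 else n mod 4 + 1)" by (simp add: mod_Suc)
  let ?rank = "\<lambda>i. circ_rank (n + 1) i + delta (int (n + 1) - 2) i + delta (int (n + 1) - 2) i"
  have rank: "?rank i + (if i = 0 then 1 else 0) = (if i = 0 then 1 else 0)
                 + (if i = int n - 1 then 2 else 0)
                 + (if i = (int n - 1) div 2 \<and> (n mod 4 = 1 \<or> n mod 4 = 2) then 1 else 0)
                 + (if i = (int n - 1) div 2 \<and> n mod 4 = 3 then 3 else 0)
                 + (if i = (int n - 1) div 2 + 1 \<and> n mod 4 = 0 then 1 else 0)" for i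
    using cases unfolding circ_rank_def mod half delta_def by auto
  have "{(True, 0)} \<in> circ_complex (n + 1)"
  proof -
    have "{(True, 0)} \<noteq> full_cycle c (n + 1)" for c
    proof
      assume "{(True, 0)} = full_cycle c (n + 1)"
      moreover have "(c, 1) \<in> full_cycle c (n + 1)" using m by (simp add: full_cycle_def)
      ultimately show False by auto
    qed
    then show ?thesis by (auto simp: circ_complex_def indep_def conf_def)
  qed
  then have ne: "circ_complex (n + 1) \<noteq> {}" by auto
  have "homology_group i X \<cong> Z_pow (?rank i + (if i = 0 then 1 else 0))" for i
  proof -
    let ?C = "geometric_realization (circ_complex (n + 1))"
    have "X homeomorphic_space ?C"
      using hom homeomorphic_maps_sym unfolding homeomorphic_space_def by blast
    then have "homology_group i X \<cong> homology_group i ?C"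
      by (rule homeomorphic_space_imp_isomorphic_homology_groups)
    also have "\<dots> \<cong> free_rank (?rank i + (if i = 0 then 1 else 0))"
    proof (rule homology_group_of_reduced)
      show "topspace ?C \<noteq> {}"
        using ne realized_empty_iff[OF simplicial_complex_circ_complex(2)[of "n + 1"]]
        by (simp add: geometric_realization_eq)
      show "reduced_homology_group i ?C \<cong> free_rank (?rank i)"
        using circ_complex_type[OF m] ne by (simp add: homology_type_def)
    qed
    also have "\<dots> \<cong> Z_pow (?rank i + (if i = 0 then 1 else 0))" by (rule free_rank_Z_pow)
    finally show ?thesis .
  qed
  moreover have "\<not> k_connected (\<nu> + 1) X" if "n mod 4 = 1 \<or> n mod 4 = 2 \<or> n mod 4 = 3"
  proof -
    have "(n + 1) mod 4 \<noteq> 1" using that mod by auto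
    from circ_complex_not_connected[OF m this hom] show ?thesis
      unfolding half by (simp add: \<nu>_def)
  qed
  ultimately show ?thesis unfolding rank by blast
qed

end
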